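(* Let $T>0$. Let $\Phi(x)=1+\|x\|_2^2$ on $\mathbb{R}^d$; let $\Xi\in C_b(\mathbb{R}_+)\cap C^1(\mathbb{R}_+)$ be globally Lipschitz with $\kappa\le \Xi(r)\le K$ for all $r\ge 0$, where $0<\kappa<K<\infty$ and $K/\kappa\le 2$; and let the probability density $p_0\in L^\infty(\mathbb{R}^d)\cap L^1(\mathbb{R}^d)$ satisfy $p_0(x)\le c_0\exp\{-b_0\|x\|_2^2\}$ for all $x$, with some $c_0>0$ and some $b_0>\kappa/2$ satisfying also $b_0>\Xi(0)$. Let $p_t$ be the density of $X_t$, where $X$ is the unique strong solution of $dX_t=-\Xi(p_t(X_t))\nabla\Phi(X_t)\,dt+\sqrt2\,dW_t$, $X_0\sim p_0$. Then $$p_t(x)\le c\exp\{-\Xi(0)\|x\|_2^2\},\qquad\forall\,(t,x)\in(0,T)\times\mathbb{R}^d,$$ with some constant $c:=c(b_0,c_0,\Xi(0))>0$ independent of $T$.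
   Context: $d\ge1$, $\mathbb{R}_+=[0,\infty)$, $\|\cdot\|_2$ is the Euclidean norm on $\mathbb{R}^d$, $W$ is a standard $d$-dimensional Brownian motion; $\nabla\Phi(x)=2x$. Under the stated hypotheses the SDE has a unique strong solution, and its density $p$ is locally parabolically H\"older continuous on $(0,T)\times\mathbb{R}^d$, satisfies $\partial_t p-\Delta p-\operatorname{div}(\nabla\Phi\,\Xi(p)p)=0$ with $p(0,\cdot)=p_0$ in the weak sense, and satisfies $p_t(x)\le c_T\exp\{-\gamma_T\|x\|_2^2\}$ on $(0,T)\times\mathbb{R}^d$ with some $c_T>0$, $\gamma_T\in(0,\kappa/2)$ possibly depending on $T$.
   Formalization: The constant c is allowed to depend also on the Lipschitz constant of Ξ, not only on b_0, c_0 and Ξ(0); a bound uniform over all Ξ with the same Ξ(0) is false. Independence of T is kept. *)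

theory Defs
  imports "HOL-Probability.Probability"
begin

definition Phi :: "real^'n \<Rightarrow> real" where
  "Phi x = 1 + (norm x)\<^sup>2"

definition grad_Phi :: "real^'n \<Rightarrow> real^'n" where
  "grad_Phi x = 2 *\<^sub>R x"

lemma GDERIV_Phi:
  fixes x :: "real^'n"
  shows "GDERIV Phi x :> grad_Phi x"
proof -
  have "((\<lambda>y. 1 + y \<bullet> y) has_derivative (\<lambda>h. x \<bullet> h + h \<bullet> x)) (at x)"
    by (auto intro!: derivative_eq_intros)
  moreover have "(\<lambda>h. x \<bullet> h + h \<bullet> x) = (\<lambda>h. h \<bullet> grad_Phi x)"
    by (simp add: grad_Phi_def inner_commute fun_eq_iff)
  moreover have "(Phi :: real^'n \<Rightarrow> real) = (\<lambda>y. 1 + y \<bullet> y)"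
    by (simp add: Phi_def fun_eq_iff power2_norm_eq_inner)
  ultimately show ?thesis
    by (simp add: gderiv_def)
qed

text \<open>Functions in C_b and C^1 on the closed half line; the derivative at 0 is one-sided.\<close>

definition Cb_C1_halfline :: "(real \<Rightarrow> real) \<Rightarrow> bool" where
  "Cb_C1_halfline f \<longleftrightarrow>
     continuous_on {0..} f \<and> bounded (f ` {0..}) \<and>
     (\<exists>f'. (\<forall>r\<ge>0. (f has_real_derivative f' r) (at r within {0..})) \<and> continuous_on {0..} f')"

definition probability_density :: "(real^'n \<Rightarrow> real) \<Rightarrow> bool" where
  "probability_density f \<longleftrightarrow>
     f \<in> borel_measurable lborel \<and> (\<forall>x. 0 \<le> f x) \<and>
     integrable lborel f \<and> integral\<^sup>L lborel f = 1"

definition essentially_bounded :: "(real^'n \<Rightarrow> real) \<Rightarrow> bool" where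
  "essentially_bounded f \<longleftrightarrow> (\<exists>B. AE x in lborel. \<bar>f x\<bar> \<le> B)"


text \<open>Brownian paths as random elements of the product space with index set I.\<close>

definition path_on :: "real set \<Rightarrow> (real \<Rightarrow> 'w \<Rightarrow> real^'n) \<Rightarrow> 'w \<Rightarrow> real \<Rightarrow> real^'n" where
  "path_on I W \<omega> = (\<lambda>t\<in>I. W t \<omega>)"

text \<open>
  Independence of random elements whose value types may differ (the library's \<open>indep_var\<close>
  requires a common type).
\<close>

definition independent_rvs ::
    "'w measure \<Rightarrow> 'a measure \<Rightarrow> ('w \<Rightarrow> 'a) \<Rightarrow> 'b measure \<Rightarrow> ('w \<Rightarrow> 'b) \<Rightarrow> bool" where
  "independent_rvs M N1 Y1 N2 Y2 \<longleftrightarrow>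
     Y1 \<in> measurable M N1 \<and> Y2 \<in> measurable M N2 \<and>
     prob_space.indep_set M (sets (vimage_algebra (space M) Y1 N1))
                            (sets (vimage_algebra (space M) Y2 N2))"

definition standard_brownian_motion :: "'w measure \<Rightarrow> (real \<Rightarrow> 'w \<Rightarrow> real^'n) \<Rightarrow> bool" where
  "standard_brownian_motion M W \<longleftrightarrow>
     (\<forall>t\<ge>0. W t \<in> borel_measurable M) \<and>
     (AE \<omega> in M. W 0 \<omega> = 0) \<and>
     (AE \<omega> in M. continuous_on {0..} (\<lambda>t. W t \<omega>)) \<and>
     (\<forall>s t. 0 \<le> s \<and> s < t \<longrightarrow>
        distributed M lborel (\<lambda>\<omega>. W t \<omega> - W s \<omega>)
          (\<lambda>x. ennreal (\<Prod>i\<in>UNIV. normal_density 0 (sqrt (t - s)) (x $ i))) \<and>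
        independent_rvs M (Pi\<^sub>M {0..s} (\<lambda>_. borel)) (path_on {0..s} W)
          borel (\<lambda>\<omega>. W t \<omega> - W s \<omega>))"

definition augmented_filtration ::
    "'w measure \<Rightarrow> ('w \<Rightarrow> real^'n) \<Rightarrow> (real \<Rightarrow> 'w \<Rightarrow> real^'n) \<Rightarrow> real \<Rightarrow> 'w measure" where
  "augmented_filtration M X0 W t = sigma (space M)
     ({X0 -` A \<inter> space M | A. A \<in> sets borel} \<union>
      {W s -` A \<inter> space M | s A. 0 \<le> s \<and> s \<le> t \<and> A \<in> sets borel} \<union>
      null_sets M)"

text \<open>
  Strong solution on [0,T] of dX = b(t,X) dt + sqrt 2 dW. The noise is additive with constant
  coefficient, so its stochastic integral over [0,t] is sqrt 2 times W t (as W 0 = 0).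
\<close>

definition strong_solution ::
    "'w measure \<Rightarrow> (real \<Rightarrow> 'w \<Rightarrow> real^'n) \<Rightarrow> real \<Rightarrow> (real \<Rightarrow> real^'n \<Rightarrow> real^'n) \<Rightarrow>
     (real \<Rightarrow> 'w \<Rightarrow> real^'n) \<Rightarrow> bool" where
  "strong_solution M W T b X \<longleftrightarrow>
     independent_rvs M borel (X 0) (Pi\<^sub>M {0..} (\<lambda>_. borel)) (path_on {0..} W) \<and>
     (\<forall>t\<in>{0..T}. X t \<in> borel_measurable (augmented_filtration M (X 0) W t)) \<and>
     (AE \<omega> in M. continuous_on {0..T} (\<lambda>t. X t \<omega>)) \<and>
     (AE \<omega> in M. \<forall>t\<in>{0..T}.
        set_integrable lborel {0..t} (\<lambda>s. b s (X s \<omega>)) \<and>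
        X t \<omega> = X 0 \<omega> + (LINT s:{0..t}|lborel. b s (X s \<omega>)) + sqrt 2 *\<^sub>R W t \<omega>)"


definition locally_parabolic_holder :: "real \<Rightarrow> (real \<Rightarrow> real^'n \<Rightarrow> real) \<Rightarrow> bool" where
  "locally_parabolic_holder T p \<longleftrightarrow>
     (\<forall>C. compact C \<and> C \<subseteq> {0<..<T} \<times> UNIV \<longrightarrow>
        (\<exists>\<alpha> H. 0 < \<alpha> \<and> \<alpha> < 1 \<and>
           (\<forall>(t, x)\<in>C. \<forall>(s, y)\<in>C.
              \<bar>p t x - p s y\<bar> \<le> H * (norm (x - y) + sqrt \<bar>t - s\<bar>) powr \<alpha>)))"

definition dir_deriv :: "'v::real_normed_vector \<Rightarrow> ('v \<Rightarrow> real) \<Rightarrow> 'v \<Rightarrow> real" where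
  "dir_deriv v f z = frechet_derivative f (at z) v"

text \<open>C^k functions on the whole space, by recursion over all directional derivatives.\<close>

primrec Ck :: "nat \<Rightarrow> ('v::real_normed_vector \<Rightarrow> real) \<Rightarrow> bool" where
  "Ck 0 f \<longleftrightarrow> continuous_on UNIV f"
| "Ck (Suc k) f \<longleftrightarrow> (\<forall>z. f differentiable (at z)) \<and> (\<forall>v. Ck k (dir_deriv v f))"

text \<open>
  Smooth functions on the whole of space-time whose support is compact and contained in
  \<open>{..<T} \<times> UNIV\<close>: their restrictions to nonnegative times are exactly the smooth functions
  with compact support in \<open>{0..<T} \<times> UNIV\<close>, which need not vanish at time 0.
\<close>

definition test_function :: "real \<Rightarrow> (real \<times> (real^'n) \<Rightarrow> real) \<Rightarrow> bool" where
  "test_function T \<phi> \<longleftrightarrow>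
     (\<forall>k. Ck k \<phi>) \<and> compact (closure {z. \<phi> z \<noteq> 0}) \<and>
     closure {z. \<phi> z \<noteq> 0} \<subseteq> {..<T} \<times> UNIV"

definition partial_t :: "(real \<times> (real^'n) \<Rightarrow> real) \<Rightarrow> real \<times> (real^'n) \<Rightarrow> real" where
  "partial_t \<phi> = dir_deriv (1, 0) \<phi>"

definition partial_x :: "'n \<Rightarrow> (real \<times> (real^'n) \<Rightarrow> real) \<Rightarrow> real \<times> (real^'n) \<Rightarrow> real" where
  "partial_x i \<phi> = dir_deriv (0, axis i 1) \<phi>"

definition grad_x :: "(real \<times> (real^'n) \<Rightarrow> real) \<Rightarrow> real \<times> (real^'n) \<Rightarrow> real^'n" where
  "grad_x \<phi> z = (\<chi> i. partial_x i \<phi> z)"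

definition laplace_x :: "(real \<times> (real^'n) \<Rightarrow> real) \<Rightarrow> real \<times> (real^'n) \<Rightarrow> real" where
  "laplace_x \<phi> z = (\<Sum>i\<in>UNIV. partial_x i (partial_x i \<phi>) z)"

text \<open>
  Weak form of \<open>\<partial>\<^sub>t p - \<Delta> p - div (\<nabla>Phi \<Xi>(p) p) = 0\<close> on \<open>{0<..<T} \<times> UNIV\<close> with initial value p0:
  all derivatives are moved to the test function, and the initial value appears as the boundary
  term of the integration by parts in time.
\<close>

definition weak_FP_solution ::
    "(real \<Rightarrow> real) \<Rightarrow> real \<Rightarrow> (real^'n \<Rightarrow> real) \<Rightarrow> (real \<Rightarrow> real^'n \<Rightarrow> real) \<Rightarrow> bool" where
  "weak_FP_solution \<Xi> T p0 p \<longleftrightarrow>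
     (\<forall>\<phi>. test_function T \<phi> \<longrightarrow>
        (LINT (t, x):{0<..<T} \<times> UNIV|lborel.
            p t x * (partial_t \<phi> (t, x) + laplace_x \<phi> (t, x)
                     - \<Xi> (p t x) * (grad_Phi x \<bullet> grad_x \<phi> (t, x))))
        + (LINT x|lborel. p0 x * \<phi> (0, x)) = 0)"

end

theory Submission
  imports Defs "HOL-Computational_Algebra.Polynomial"
begin

text \<open>
  Let \<open>Q\<close> solve \<open>Q' = - \<Xi>(Q) Q\<close> on the line and put \<open>q(x) = Q(|x|^2)\<close>. The flux
  \<open>\<nabla>q + 2 x \<Xi>(q) q\<close> vanishes identically, so \<open>q\<close> is a stationary solution. Starting \<open>Q\<close> from a
  sufficiently large value gives \<open>q \<ge> p0\<close>: as long as \<open>Q\<close> is large its logarithm decreases at rate at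
  most \<open>K \<le> 2 \<kappa> \<le> 2 \<Xi>(0)\<close>, and once \<open>Q\<close> is small the rate is at most \<open>b0\<close>. Since \<open>Q\<close> decays
  exponentially and \<open>\<Xi>\<close> is Lipschitz, \<open>\<Xi>(Q) - \<Xi>(0)\<close> is integrable, whence \<open>q \<le> c exp(- \<Xi>(0) |x|^2)\<close>.

  It remains to compare \<open>p\<close> with \<open>q\<close>. The difference \<open>w = p - q\<close> solves \<open>w_t = \<Delta>w + div g\<close> weakly
  with \<open>|g| \<le> 2 \<Lambda> |x| |w|\<close>. For the mollified equation, the time derivative of \<open>\<integral> max(0,w)^3\<close>
  is, after an integration by parts and completing the square, at most \<open>3/2 \<integral> max(0,w) |g|^2\<close>. No
  derivative of \<open>w\<close> is left, so the mollification can be removed by dominated convergence. The factor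
  \<open>|x|^2\<close> is absorbed by splitting at \<open>|x| = R\<close> and using the Gaussian bound on \<open>p\<close>.
\<close>

section \<open>Smooth functions\<close>

text \<open>The cube is forced by the integration by parts. It differentiates
  \<open>3 * max 0 v ^ 2\<close> once more, pointwise and everywhere; the derivative of the square
  has a corner at 0 and would not allow this.

  Since p is only a weak solution, the kernel acts in space alone: tested with products \<theta>(s)
  \<eta>(x - y), the equation becomes a weak ordinary differential equation in time for each fixed
  x, and such a solution is classical and attains its initial value. The vanishing flux of q is a
  linear identity and survives mollification, so the error is measured by the mollified g alone.

  The obstacle is the unbounded factor |x|^2 in the growth rate. Cutting at radius R gives growth
  exp(const R^2 t) against a tail exp(-\<gamma> R^2); with R free, the tail wins on time intervals
  whose length does not depend on their starting point, and these are strung together.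

  The assumed Gaussian bound on p, with constants depending on T, only justifies limits and supplies
  that tail. The final constant comes from the profile, that is from c0, b0, \<Xi>(0) and the
  Lipschitz constant, which is why T does not enter.\<close>

lemma dir_deriv_eqI:
  "(f has_derivative f') (at z) \<Longrightarrow> dir_deriv v f z = f' v"
  unfolding dir_deriv_def by (metis frechet_derivative_at)

lemma Ck_SucD: "Ck (Suc k) f \<Longrightarrow> Ck k f"
proof (induction k arbitrary: f)
  case 0
  then show ?case
    by (auto simp: continuous_on_eq_continuous_at intro!: differentiable_imp_continuous_within)
next
  case (Suc k)
  then show ?case by (metis Ck.simps(2))
qed

lemma Ck_const: "Ck k (\<lambda>_. c)"
proof (induction k arbitrary: c)
  case (Suc k)
  have "dir_deriv v (\<lambda>_. c) = (\<lambda>_. 0)" for v :: 'a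
    by (auto intro!: ext dir_deriv_eqI derivative_eq_intros)
  with Suc show ?case by simp
qed simp

lemma Ck_bounded_linear:
  assumes "bounded_linear f"
  shows "Ck k f"
proof (cases k)
  case 0
  with assms show ?thesis by (simp add: linear_continuous_on)
next
  case (Suc j)
  have "dir_deriv v f = (\<lambda>_. f v)" for v
    by (intro ext dir_deriv_eqI bounded_linear_imp_has_derivative assms)
  with Suc assms show ?thesis
    by (simp add: Ck_const bounded_linear_imp_differentiable)
qed

lemma differentiable_has_derivative_at:
  "f differentiable (at z) \<Longrightarrow> (f has_derivative (\<lambda>v. dir_deriv v f z)) (at z)"
  unfolding dir_deriv_def by (metis frechet_derivative_works eta_contract_eq)

lemma Ck_add:
  "Ck k f \<Longrightarrow> Ck k g \<Longrightarrow> Ck k (\<lambda>z. f z + g z)"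
proof (induction k arbitrary: f g)
  case 0
  then show ?case by (simp add: continuous_on_add)
next
  case (Suc k)
  have "dir_deriv v (\<lambda>z. f z + g z) = (\<lambda>z. dir_deriv v f z + dir_deriv v g z)" for v
    using Suc.prems
    by (auto intro!: ext dir_deriv_eqI has_derivative_add differentiable_has_derivative_at)
  with Suc show ?case by auto
qed

lemma Ck_mult:
  "Ck k f \<Longrightarrow> Ck k g \<Longrightarrow> Ck k (\<lambda>z. f z * g z)"
proof (induction k arbitrary: f g)
  case 0
  then show ?case by (simp add: continuous_on_mult)
next
  case (Suc k)
  have "dir_deriv v (\<lambda>z. f z * g z) = (\<lambda>z. f z * dir_deriv v g z + dir_deriv v f z * g z)" for v
    using Suc.prems
    by (auto intro!: ext dir_deriv_eqI has_derivative_mult differentiable_has_derivative_at)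
  moreover have "Ck k f" "Ck k g"
    using Suc.prems by (auto intro: Ck_SucD)
  ultimately show ?case using Suc by (auto intro!: Ck_add)
qed

lemma dir_deriv_compose_real:
  assumes "h differentiable (at (f z))" "f differentiable (at z)"
  shows "dir_deriv v (\<lambda>z. h (f z)) z = dir_deriv 1 h (f z) * dir_deriv v f z"
proof -
  have "((\<lambda>z. h (f z)) has_derivative (\<lambda>v. dir_deriv (dir_deriv v f z) h (f z))) (at z)"
    using has_derivative_compose[OF differentiable_has_derivative_at[OF assms(2)]
        differentiable_has_derivative_at[OF assms(1)]] .
  moreover have "linear (\<lambda>r. dir_deriv r h (f z))"
    using differentiable_has_derivative_at[OF assms(1)] has_derivative_linear by blast
  hence "dir_deriv r h (f z) = dir_deriv 1 h (f z) * r" for r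
    using linear_cmul[of "\<lambda>r. dir_deriv r h (f z)" r 1] by simp
  ultimately show ?thesis
    using dir_deriv_eqI by metis
qed

text \<open>With a real outer function the chain rule is a product, so the induction closes through
  \<open>Ck_mult\<close>. It runs for arbitrary \<open>h\<close> because the induction hypothesis is
  applied to the derivative of \<open>h\<close> with the same \<open>f\<close>.\<close>

lemma Ck_compose_real:
  fixes h :: "real \<Rightarrow> real"
  shows "Ck k h \<Longrightarrow> Ck k f \<Longrightarrow> Ck k (\<lambda>z. h (f z))"
proof (induction k arbitrary: h f)
  case 0
  then show ?case
    using continuous_on_compose2[of UNIV h UNIV f] by simp
next
  case (Suc k)
  have "dir_deriv v (\<lambda>z. h (f z)) = (\<lambda>z. dir_deriv 1 h (f z) * dir_deriv v f z)" for v
    using Suc.prems by (auto intro!: ext dir_deriv_compose_real)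
  moreover have "Ck k f"
    using Suc.prems by (auto intro: Ck_SucD)
  moreover have "Ck k (\<lambda>z. dir_deriv 1 h (f z) * dir_deriv v f z)" for v
    using Suc.prems Suc.IH[of "dir_deriv 1 h" f] \<open>Ck k f\<close>
    by (intro Ck_mult[of k "\<lambda>z. dir_deriv 1 h (f z)"]) simp_all
  moreover have "(\<lambda>z. h (f z)) differentiable (at z)" for z
    using Suc.prems differentiable_compose[of h f z UNIV] by simp
  ultimately show ?case by simp
qed

lemma Ck_compose_affine:
  fixes f :: "'v::real_normed_vector \<Rightarrow> real" and l :: "'u::real_normed_vector \<Rightarrow> 'v"
  assumes l: "bounded_linear l" and f: "Ck k f"
  shows "Ck k (\<lambda>z. f (a + l z))"
  using f
proof (induction k arbitrary: f)
  case 0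
  have "continuous_on UNIV (\<lambda>z. a + l z)"
    by (intro continuous_on_add continuous_on_const linear_continuous_on l)
  with 0 show ?case
    using continuous_on_compose2[of UNIV f UNIV "\<lambda>z. a + l z"] by simp
next
  case (Suc k)
  have 1: "((\<lambda>z. f (a + l z)) has_derivative (\<lambda>v. dir_deriv (l v) f (a + l z))) (at z)" for z
    using Suc.prems
    by (intro has_derivative_compose[of "\<lambda>z. a + l z" l z UNIV f, OF _ differentiable_has_derivative_at])
       (auto intro!: derivative_eq_intros bounded_linear_imp_has_derivative l)
  hence "dir_deriv v (\<lambda>z. f (a + l z)) = (\<lambda>z. dir_deriv (l v) f (a + l z))" for v
    by (auto intro!: ext dir_deriv_eqI)
  with Suc 1 show ?case by (auto simp: differentiable_def)
qed

lemma Ck_real_derivI: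
  fixes f :: "real \<Rightarrow> real"
  assumes "\<And>x. (f has_real_derivative f' x) (at x)" and "Ck k f'"
  shows "Ck (Suc k) f"
proof -
  have "(f has_derivative (\<lambda>v. v * f' x)) (at x)" for x
    using assms(1)[of x] by (simp add: has_field_derivative_def mult.commute[of _ "f' x"])
  hence "dir_deriv v f = (\<lambda>x. v * f' x)" "f differentiable (at x)" for v x
    by (auto intro!: ext dir_deriv_eqI simp: differentiable_def)
  with assms(2) show ?thesis by (auto intro!: Ck_mult Ck_const)
qed

section \<open>A smooth function that is flat at the origin, and bumps built from it\<close>

definition flat_exp :: "real poly \<Rightarrow> real \<Rightarrow> real" where
  "flat_exp P x = (if x > 0 then poly P (1 / x) * exp (- (1 / x)) else 0)"

lemma poly_exp_minus_tendsto_0: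
  fixes P :: "real poly"
  shows "((\<lambda>y. poly P y * exp (- y)) \<longlongrightarrow> 0) at_top"
proof -
  \<comment> \<open>The free power \<open>k\<close> absorbs the degree shift of
    \<open>pCons\<close>: \<open>y * poly P y\<close> with weight \<open>y ^ k\<close> is
    \<open>poly P y\<close> with weight \<open>y ^ Suc k\<close>.\<close>
  have "((\<lambda>y. y ^ k * (poly P y * exp (- y))) \<longlongrightarrow> 0) at_top" for k
  proof (induction P arbitrary: k)
    case (pCons a P)
    have "((\<lambda>y. a * (y ^ k / exp y) + y ^ Suc k * (poly P y * exp (- y))) \<longlongrightarrow> a * 0 + 0) at_top"
      by (intro tendsto_intros tendsto_power_div_exp_0 pCons.IH)
    then show ?case by (simp add: algebra_simps exp_minus divide_inverse)
  qed simp
  from this[of 0] show ?thesis by simp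
qed

text \<open>Differentiation turns P(1/x) exp(-1/x) into (1/x)^2 (P - P')(1/x) exp(-1/x), which has
  the same shape. The polynomial parameter thus makes the family closed under differentiation, and
  smoothness of all members is a single induction.\<close>

lemma flat_exp_has_derivative:
  "(flat_exp P has_real_derivative flat_exp ([:0, 0, 1:] * (P - pderiv P)) x) (at x)"
proof (cases "x = 0")
  case False
  consider "x > 0" | "x < 0" using False by linarith
  then show ?thesis
  proof cases
    case 1
    have "((\<lambda>x. poly P (1 / x) * exp (- (1 / x))) has_real_derivative
        flat_exp ([:0, 0, 1:] * (P - pderiv P)) x) (at x)"
      using 1
      by (auto intro!: derivative_eq_intros DERIV_chain'[of "\<lambda>x. 1 / x" _ _ _ "poly P"] poly_DERIV
          simp: flat_exp_def field_simps power2_eq_square)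
    moreover have "eventually (\<lambda>y. flat_exp P y = poly P (1 / y) * exp (- (1 / y))) (nhds x)"
      using 1 eventually_nhds_in_open[of "{0<..}" x] by (auto elim!: eventually_mono simp: flat_exp_def)
    ultimately show ?thesis
      using DERIV_cong_ev by fastforce
  next
    case 2
    have "((\<lambda>x. 0) has_real_derivative flat_exp ([:0, 0, 1:] * (P - pderiv P)) x) (at x)"
      using 2 by (simp add: flat_exp_def)
    moreover have "eventually (\<lambda>y. flat_exp P y = 0) (nhds x)"
      using 2 eventually_nhds_in_open[of "{..<0}" x] by (auto elim!: eventually_mono simp: flat_exp_def)
    ultimately show ?thesis
      using DERIV_cong_ev by fastforce
  qed
next
  case True
  \<comment> \<open>Dividing by \<open>h\<close> only adds a factor 1/h, that is a
    \<open>pCons 0\<close>; the substitution y = 1/h then moves the limit to infinity.\<close>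
  have "((\<lambda>h. flat_exp P h / h) \<longlongrightarrow> 0) (at_right 0)"
  proof -
    have "((\<lambda>h. poly (pCons 0 P) (inverse h) * exp (- inverse h)) \<longlongrightarrow> 0) (at_right (0::real))"
      by (rule filterlim_compose[OF poly_exp_minus_tendsto_0 filterlim_inverse_at_top_right])
    then show ?thesis
      by (rule Lim_transform_eventually)
        (auto simp: eventually_at_right_less flat_exp_def field_simps eventually_at_filter)
  qed
  moreover have "((\<lambda>h. flat_exp P h / h) \<longlongrightarrow> 0) (at_left 0)"
    by (rule tendsto_eventually) (auto simp: eventually_at_filter flat_exp_def)
  ultimately have "((\<lambda>h. flat_exp P h / h) \<longlongrightarrow> 0) (at 0)"
    by (simp add: filterlim_split_at)
  then show ?thesis
    using True by (simp add: DERIV_def flat_exp_def)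
qed

lemma Ck_flat_exp: "Ck k (flat_exp P)"
proof (induction k arbitrary: P)
  case 0
  show ?case
    by (auto simp: continuous_on_eq_continuous_at intro: DERIV_isCont flat_exp_has_derivative)
next
  case (Suc k)
  show ?case by (rule Ck_real_derivI[OF flat_exp_has_derivative Suc])
qed

text \<open>The classical bump exp(-1 / (r^2 - |x|^2)) on the ball of radius r, extended by zero.
  The squared norm keeps it smooth at the origin.\<close>

definition bump :: "real \<Rightarrow> 'v::euclidean_space \<Rightarrow> real" where
  "bump r x = flat_exp 1 (r\<^sup>2 - (norm x)\<^sup>2)"

lemma bump_nonneg: "0 \<le> bump r x"
  by (simp add: bump_def flat_exp_def)

lemma bump_pos: "norm x < r \<Longrightarrow> 0 < bump r x"
  by (auto simp: bump_def flat_exp_def intro!: power_strict_mono)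

lemma bump_eq_0: "0 < r \<Longrightarrow> r \<le> norm x \<Longrightarrow> bump r x = 0"
  by (simp add: bump_def flat_exp_def not_less power_mono)

lemma Ck_norm_square: "Ck k (\<lambda>x::'v::euclidean_space. (norm x)\<^sup>2)"
proof (cases k)
  case 0
  then show ?thesis by (auto intro!: continuous_intros)
next
  case (Suc j)
  have 1: "((\<lambda>x::'v. (norm x)\<^sup>2) has_derivative (\<lambda>v. 2 * (x \<bullet> v))) (at x)" for x
    unfolding power2_norm_eq_inner
    by (auto intro!: derivative_eq_intros simp: inner_commute)
  hence "dir_deriv v (\<lambda>x::'v. (norm x)\<^sup>2) = (\<lambda>x. 2 * (x \<bullet> v))" for v
    by (auto intro!: ext dir_deriv_eqI)
  moreover have "Ck j (\<lambda>x::'v. 2 * (x \<bullet> v))" for v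
    by (intro Ck_mult Ck_const Ck_bounded_linear bounded_linear_inner_left)
  ultimately show ?thesis
    using Suc 1 by (auto simp: differentiable_def)
qed

lemma Ck_bump: "Ck k (bump r :: 'v::euclidean_space \<Rightarrow> real)"
proof -
  have "Ck k (\<lambda>x::'v. flat_exp 1 (r\<^sup>2 + (-1) * (norm x)\<^sup>2))"
    by (rule Ck_compose_real[OF Ck_flat_exp], intro Ck_add Ck_mult Ck_const Ck_norm_square)
  then show ?thesis unfolding bump_def[abs_def] by simp
qed

section \<open>The stationary profile\<close>

lemma continuous_antiderivative_exists:
  fixes g :: "real \<Rightarrow> real"
  assumes "continuous_on UNIV g"
  shows "\<exists>G. \<forall>x. (G has_real_derivative g x) (at x)"
proof -
  define G where "G x = (if 0 \<le> x then integral {0..x} g else - integral {x..0} g)" for x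
  have int: "g integrable_on {a..b}" for a b
    by (intro integrable_continuous_interval continuous_on_subset[OF assms]) auto
  have "(G has_real_derivative g x) (at x)" for x
  proof -
    let ?a = "- \<bar>x\<bar> - 1" and ?b = "\<bar>x\<bar> + 1"
    \<comment> \<open>On a bounded window around \<open>x\<close> both branches of \<open>G\<close>
      are, up to a constant, one indefinite integral from the left end of the window, so the
      fundamental theorem applies even at 0.\<close>
    have eq: "G y = integral {?a..y} g - integral {?a..0} g" if "y \<in> {?a..?b}" for y
    proof (cases "0 \<le> y")
      case True
      with Henstock_Kurzweil_Integration.integral_combine[of ?a 0 y g] int that show ?thesis by (simp add: G_def)
    next
      case False
      with Henstock_Kurzweil_Integration.integral_combine[of ?a y 0 g] int that show ?thesis by (simp add: G_def)
    qed
    have "((\<lambda>y. integral {?a..y} g) has_real_derivative g x) (at x within {?a..?b})"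
      by (rule integral_has_real_derivative[OF continuous_on_subset[OF assms]]) auto
    hence "((\<lambda>y. integral {?a..y} g - integral {?a..0} g) has_real_derivative g x) (at x within {?a..?b})"
      by (auto intro!: derivative_eq_intros)
    hence "(G has_real_derivative g x) (at x within {?a..?b})"
      by (rule has_field_derivative_transform_within[of _ _ _ _ 1]) (auto simp: eq)
    moreover have "at x within {?a..?b} = at x"
      by (rule at_within_interior) auto
    ultimately show ?thesis by simp
  qed
  then show ?thesis by blast
qed

text \<open>Separation of variables: \<psi> is an antiderivative of 1/g and u(s) is the preimage of
  \<psi>(m) - s. The bounds on \<open>g\<close> make \<psi> an increasing bijection of the line, so
  the solution is global. \<psi> is returned as well because later comparisons of \<open>u\<close>
  with a barrier are made on the scale of \<psi>.\<close>

lemma autonomous_ode_solution: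
  fixes g :: "real \<Rightarrow> real"
  assumes g: "continuous_on UNIV g" and bd: "\<And>x. 0 < \<kappa> \<and> \<kappa> \<le> g x \<and> g x \<le> K"
  obtains \<psi> u where "\<And>x. (\<psi> has_real_derivative 1 / g x) (at x)"
    "\<And>s. \<psi> (u s) = \<psi> m - s" "\<And>s. (u has_real_derivative - g (u s)) (at s)" "u 0 = m"
    "strict_mono \<psi>"
proof -
  have gpos: "0 < g x" for x using bd[of x] by linarith
  have K: "K > 0" using bd[of 0] by linarith
  have gne: "g x \<noteq> 0" for x using gpos[of x] by simp
  have "continuous_on UNIV (\<lambda>x. 1 / g x)"
    by (intro continuous_on_divide continuous_on_const g) (simp add: gne)
  then obtain \<psi> where \<psi>: "(\<psi> has_real_derivative 1 / g x) (at x)" for x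
    using continuous_antiderivative_exists[of "\<lambda>x. 1 / g x"] by blast
  have mono: "strict_mono \<psi>"
    by (rule strict_monoI, rule DERIV_pos_imp_increasing)
      (use \<psi> gpos in \<open>auto intro!: exI conjI\<close>)
  have cont: "isCont \<psi> x" for x using \<psi> by (rule DERIV_isCont)
  have grow: "(b - a) / K \<le> \<psi> b - \<psi> a" if "a \<le> b" for a b
  proof -
    have "\<psi> a - a / K \<le> \<psi> b - b / K"
    proof (rule DERIV_nonneg_imp_nondecreasing[OF that, where f = "\<lambda>x. \<psi> x - x / K"])
      fix x
      have "((\<lambda>x. \<psi> x - x / K) has_real_derivative 1 / g x - 1 / K) (at x)"
        using gne K by (auto intro!: derivative_eq_intros \<psi>)
      moreover have "1 / K \<le> 1 / g x"
        using bd[of x] gpos[of x] by (intro divide_left_mono) auto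
      ultimately show "\<exists>y. ((\<lambda>x. \<psi> x - x / K) has_real_derivative y) (at x) \<and> 0 \<le> y"
        by force
    qed
    then show ?thesis by (simp add: diff_divide_distrib)
  qed
  \<comment> \<open>A slope of at least 1/K makes \<psi> unbounded in both directions.\<close>
  have "\<exists>x. \<psi> x = y" for y
  proof -
    let ?M = "K * (\<bar>y - \<psi> 0\<bar>)"
    have M: "?M \<ge> 0" using K by simp
    have "\<psi> (- ?M) \<le> y" using grow[of "- ?M" 0] K M by simp
    moreover have "y \<le> \<psi> ?M" using grow[of 0 ?M] K M by simp
    ultimately show ?thesis
      using IVT[of \<psi> "- ?M" y ?M] cont M by auto
  qed
  then obtain inv where inv: "\<And>y. \<psi> (inv y) = y" by metis
  have inj: "\<psi> x = \<psi> y \<Longrightarrow> x = y" for x y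
    using mono by (simp add: strict_mono_eq)
  have continv: "isCont inv y" for y
    using isCont_inverse_function[of 1 "inv y" inv \<psi>] inv inj cont by auto
  have dinv: "(inv has_real_derivative g (inv y)) (at y)" for y
    using DERIV_inverse_function[where f = \<psi> and g = inv and D = "1 / g (inv y)" and x = y and a = "y - 1" and b = "y + 1"] \<psi>[of "inv y"] gne[of "inv y"] inv continv
    by simp
  define u where "u s = inv (\<psi> m - s)" for s
  have "(u has_real_derivative - g (u s)) (at s)" for s
  proof -
    have "((\<lambda>s. \<psi> m - s) has_real_derivative - 1) (at s)"
      by (auto intro!: derivative_eq_intros)
    with DERIV_chain2[where f = inv and g = "\<lambda>s. \<psi> m - s", OF dinv] show ?thesis
      by (fastforce simp: u_def[abs_def])
  qed
  moreover have "\<psi> (u s) = \<psi> m - s" for s by (simp add: u_def inv)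
  moreover have "u 0 = m" by (simp add: u_def inv inj)
  ultimately show ?thesis using \<psi> mono by (intro that[of \<psi> u])
qed

text \<open>For u = ln Q the profile equation is u' = -\<Xi>(exp u), with a rate bounded away from 0
  and infinity. The constant \<open>c\<close> is fixed before \<Xi>, \<kappa> and K, so it can be
  built only from c0, b0, \<xi>0 and L.\<close>

lemma stationary_profile_exists:
  fixes c0 b0 \<xi>0 L :: real
  assumes c0: "0 < c0" and \<xi>0: "0 < \<xi>0" and b0: "\<xi>0 < b0" and L: "0 \<le> L"
  obtains c where "0 < c"
    "\<And>\<Xi> \<kappa> K. L-lipschitz_on {0..} \<Xi> \<Longrightarrow> \<Xi> 0 = \<xi>0 \<Longrightarrow> 0 < \<kappa> \<Longrightarrow> K \<le> 2 * \<kappa> \<Longrightarrow>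
       (\<And>r. 0 \<le> r \<Longrightarrow> \<kappa> \<le> \<Xi> r \<and> \<Xi> r \<le> K) \<Longrightarrow>
       \<exists>Q. (\<forall>s. 0 < Q s \<and> (Q has_real_derivative - (\<Xi> (Q s) * Q s)) (at s)) \<and>
           (\<forall>s\<ge>0. c0 * exp (- b0 * s) \<le> Q s \<and> Q s \<le> c * exp (- \<xi>0 * s))"
proof -
  \<comment> \<open>Below the level \<open>ul\<close> the deviation \<open>L * exp v\<close> is at
    most \<open>b0 - \<xi>0\<close>, so the rate there is at most \<open>b0\<close>;
    \<open>L + 1\<close> keeps the quotient meaningful for \<open>L = 0\<close>.\<close>
  define ul where "ul = ln ((b0 - \<xi>0) / (L + 1))"
  have ul: "L * exp ul \<le> b0 - \<xi>0"
    using b0 L by (simp add: ul_def exp_ln divide_le_eq field_simps)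
  \<comment> \<open>From this time on the barrier \<open>ln c0 - b0 * s\<close>, the logarithm of
    the bound on the initial density, lies at or below \<open>ul\<close>.\<close>
  define s1 where "s1 = max 0 ((ln c0 - ul) / b0)"
  \<comment> \<open>Descending at rate at most \<open>2 * \<xi>0\<close>, a start at this height has
    not fallen below \<open>ln c0\<close> at time \<open>s1\<close>.\<close>
  define m where "m = ln c0 + 2 * \<xi>0 * s1"
  \<comment> \<open>The correction to \<open>m\<close> is the integral over all s \<ge> 0 of
    \<open>L * exp (m - \<xi>0 / 2 * s)\<close>, which bounds the accumulated deviation of the rate
    from \<open>\<xi>0\<close>.\<close>
  define c where "c = exp (m + 2 * L * exp m / \<xi>0)"
  have b0pos: "0 < b0" using b0 \<xi>0 by simp
  have s1: "0 \<le> s1" "ln c0 - b0 * s1 \<le> ul"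
    using b0pos by (auto simp: s1_def max_def field_simps)
  show ?thesis
  proof (rule that[of c])
    show "0 < c" by (simp add: c_def)
    fix \<Xi> :: "real \<Rightarrow> real" and \<kappa> K :: real
    assume lip: "L-lipschitz_on {0..} \<Xi>" and \<Xi>0: "\<Xi> 0 = \<xi>0" and \<kappa>: "0 < \<kappa>" and K: "K \<le> 2 * \<kappa>"
      and bd: "\<And>r. 0 \<le> r \<Longrightarrow> \<kappa> \<le> \<Xi> r \<and> \<Xi> r \<le> K"
    define g where "g v = \<Xi> (exp v)" for v
    have g_bd: "0 < \<kappa> \<and> \<kappa> \<le> g v \<and> g v \<le> K" for v
      using bd[of "exp v"] \<kappa> by (simp add: g_def)
    have g_lip: "\<bar>g v - \<xi>0\<bar> \<le> L * exp v" for v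
      using lipschitz_onD[OF lip, of "exp v" 0] \<Xi>0 by (simp add: g_def dist_real_def)
    \<comment> \<open>The ratio condition keeps every rate within a factor two of
      \<open>\<xi>0\<close>: K \<le> 2 \<kappa> \<le> 2 \<xi>0, and \<kappa> \<ge> K/2 \<ge>
      \<xi>0/2.\<close>
    have K2: "g v \<le> 2 * \<xi>0" "\<xi>0 / 2 \<le> g v" for v
      using bd[of 0] \<Xi>0 K g_bd[of v] by auto
    have gpos: "0 < g v" for v using g_bd[of v] by linarith
    have g_cont: "continuous_on UNIV g"
      unfolding g_def
      by (rule continuous_on_compose2[OF lipschitz_on_continuous_on[OF lip]])
         (auto intro!: continuous_intros)
    obtain \<psi> u where \<psi>: "\<And>x. (\<psi> has_real_derivative 1 / g x) (at x)"
      and \<psi>u: "\<And>s. \<psi> (u s) = \<psi> m - s" and u: "\<And>s. (u has_real_derivative - g (u s)) (at s)"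
      and u0: "u 0 = m" and mono: "strict_mono \<psi>"
      using autonomous_ode_solution[OF g_cont g_bd, of m] by blast
    have lower: "ln c0 - b0 * s \<le> u s" if s: "0 \<le> s" for s
    proof -
      \<comment> \<open>Since \<open>\<psi> (u s) = \<psi> m - s\<close>, lying above the barrier
        means that \<psi> of the barrier plus s is at most \<open>\<psi> m\<close>. Up to
        \<open>s1\<close> it suffices to compare with the highest point \<open>ln c0\<close> of the
        barrier.\<close>
      have early: "\<psi> (ln c0 - b0 * r) + r \<le> \<psi> m" if r: "0 \<le> r" "r \<le> s1" for r
      proof -
        have "\<psi> (ln c0) - ln c0 / (2 * \<xi>0) \<le> \<psi> m - m / (2 * \<xi>0)"
        proof (rule DERIV_nonneg_imp_nondecreasing[where f = "\<lambda>x. \<psi> x - x / (2 * \<xi>0)"])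
          show "ln c0 \<le> m" using s1 \<xi>0 by (simp add: m_def)
          fix x
          have "((\<lambda>x. \<psi> x - x / (2 * \<xi>0)) has_real_derivative 1 / g x - 1 / (2 * \<xi>0)) (at x)"
            using \<xi>0 by (auto intro!: derivative_eq_intros \<psi>)
          moreover have "1 / (2 * \<xi>0) \<le> 1 / g x"
            using K2(1)[of x] gpos[of x] by (intro divide_left_mono) auto
          ultimately show "\<exists>y. ((\<lambda>x. \<psi> x - x / (2 * \<xi>0)) has_real_derivative y) (at x) \<and> 0 \<le> y"
            by force
        qed
        moreover have "m / (2 * \<xi>0) - ln c0 / (2 * \<xi>0) = s1"
          using \<xi>0 by (simp add: m_def field_simps)
        moreover have "\<psi> (ln c0 - b0 * r) \<le> \<psi> (ln c0)"
          using mono r b0pos by (simp add: strict_mono_less_eq)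
        ultimately show ?thesis using r by linarith
      qed
      have "\<psi> (ln c0 - b0 * s) + s \<le> \<psi> m"
      proof (cases "s \<le> s1")
        case True
        with early s show ?thesis by blast
      next
        case False
        \<comment> \<open>Below \<open>ul\<close> the rate is at most \<open>b0\<close>, so along
          the barrier \<psi> drops at least as fast as time passes.\<close>
        have "\<psi> (ln c0 - b0 * s1) + s1 \<ge> \<psi> (ln c0 - b0 * s) + s"
        proof (rule DERIV_nonpos_imp_nonincreasing[where f = "\<lambda>x. \<psi> (ln c0 - b0 * x) + x"])
          show "s1 \<le> s" using False by simp
          fix x assume x: "s1 \<le> x" "x \<le> s"
          let ?y = "ln c0 - b0 * x"
          have "((\<lambda>x. \<psi> (ln c0 - b0 * x) + x) has_real_derivative 1 / g ?y * (- b0) + 1) (at x)"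
            by (auto intro!: derivative_eq_intros DERIV_chain2[OF \<psi>])
          moreover have "g ?y \<le> b0"
          proof -
            have "?y \<le> ul" using s1(2) x b0pos mult_left_mono[of s1 x b0] by linarith
            hence "L * exp ?y \<le> L * exp ul" using L by (simp add: mult_left_mono)
            with g_lip[of ?y] ul show ?thesis by linarith
          qed
          hence "1 / g ?y * (- b0) + 1 \<le> 0" using gpos[of ?y] by (simp add: field_simps)
          ultimately show "\<exists>y. ((\<lambda>x. \<psi> (ln c0 - b0 * x) + x) has_real_derivative y) (at x) \<and> y \<le> 0"
            by blast
        qed
        with early[of s1] s1 show ?thesis by linarith
      qed
      hence "\<psi> (ln c0 - b0 * s) \<le> \<psi> (u s)" by (simp add: \<psi>u)
      with mono show ?thesis by (simp add: strict_mono_less_eq)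
    qed
    have upper: "u s \<le> m + 2 * L * exp m / \<xi>0 - \<xi>0 * s" if s: "0 \<le> s" for s
    proof -
      \<comment> \<open>The crude rate \<open>\<xi>0 / 2\<close> already makes
        \<open>exp (u r)\<close> decay exponentially, and this makes the deviation of the rate from
        \<open>\<xi>0\<close> integrable.\<close>
      have u_half: "u r \<le> m - \<xi>0 / 2 * r" if r: "0 \<le> r" for r
      proof -
        have "u 0 + \<xi>0 / 2 * 0 \<ge> u r + \<xi>0 / 2 * r"
        proof (rule DERIV_nonpos_imp_nonincreasing[OF r, where f = "\<lambda>x. u x + \<xi>0 / 2 * x"])
          fix x
          have "((\<lambda>x. u x + \<xi>0 / 2 * x) has_real_derivative - g (u x) + \<xi>0 / 2) (at x)"
            by (auto intro!: derivative_eq_intros u)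
          with K2(2)[of "u x"] show "\<exists>y. ((\<lambda>x. u x + \<xi>0 / 2 * x) has_real_derivative y) (at x) \<and> y \<le> 0"
            by force
        qed
        then show ?thesis using u0 by simp
      qed
      \<comment> \<open>The derivative of the last summand is
        \<open>- L * exp (m - \<xi>0 / 2 * x)\<close>, which compensates the largest possible
        deviation of the rate from \<open>\<xi>0\<close>.\<close>
      let ?z = "\<lambda>x. u x + \<xi>0 * x + 2 * L / \<xi>0 * exp (m - \<xi>0 / 2 * x)"
      have "?z 0 \<ge> ?z s"
      proof (rule DERIV_nonpos_imp_nonincreasing[OF s, where f = ?z])
        fix x assume x: "0 \<le> x" "x \<le> s"
        have "(?z has_real_derivative - g (u x) + \<xi>0 - L * exp (m - \<xi>0 / 2 * x)) (at x)"
          using \<xi>0 by (auto intro!: derivative_eq_intros u)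
        moreover have "- g (u x) + \<xi>0 - L * exp (m - \<xi>0 / 2 * x) \<le> 0"
        proof -
          have "L * exp (u x) \<le> L * exp (m - \<xi>0 / 2 * x)"
            using u_half[OF x(1)] L by (intro mult_left_mono) auto
          with g_lip[of "u x"] show ?thesis by linarith
        qed
        ultimately show "\<exists>y. (?z has_real_derivative y) (at x) \<and> y \<le> 0" by blast
      qed
      moreover have "0 \<le> 2 * L / \<xi>0 * exp (m - \<xi>0 / 2 * s)" using L \<xi>0 by simp
      ultimately show ?thesis using u0 by simp
    qed
    define Q where "Q s = exp (u s)" for s
    have "(Q has_real_derivative - (\<Xi> (Q s) * Q s)) (at s)" for s
      unfolding Q_def[abs_def] by (auto intro!: derivative_eq_intros u simp: g_def)
    moreover have "c0 * exp (- b0 * s) \<le> Q s" if "0 \<le> s" for s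
    proof -
      have "c0 * exp (- b0 * s) = exp (ln c0 - b0 * s)"
        using c0 by (simp add: exp_diff exp_minus field_simps)
      with lower[OF that] show ?thesis by (simp add: Q_def)
    qed
    moreover have "Q s \<le> c * exp (- \<xi>0 * s)" if "0 \<le> s" for s
      using upper[OF that] by (simp add: Q_def c_def exp_add[symmetric])
    ultimately show "\<exists>Q. (\<forall>s. 0 < Q s \<and> (Q has_real_derivative - (\<Xi> (Q s) * Q s)) (at s)) \<and>
           (\<forall>s\<ge>0. c0 * exp (- b0 * s) \<le> Q s \<and> Q s \<le> c * exp (- \<xi>0 * s))"
      by (intro exI[of _ Q]) (auto simp: Q_def)
  qed
qed

section \<open>Gaussian domination\<close>

text \<open>The exponential of the squared norm factors over the coordinates, and in one dimension
  it is a multiple of the normal density with variance 1 / (2 \<delta>).\<close>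

lemma integrable_gaussian:
  assumes "0 < \<delta>"
  shows "integrable lborel (\<lambda>x::'v::euclidean_space. exp (- \<delta> * (norm x)\<^sup>2))"
proof (rule integrableI_bounded)
  define \<sigma> where "\<sigma> = 1 / sqrt (2 * \<delta>)"
  have \<sigma>: "0 < \<sigma>" "2 * \<sigma>\<^sup>2 = 1 / \<delta>"
    using assms by (auto simp: \<sigma>_def power_divide)
  have eq: "exp (- \<delta> * r\<^sup>2) = sqrt (2 * pi * \<sigma>\<^sup>2) * normal_density 0 \<sigma> r" for r
    using \<sigma> assms by (simp add: normal_density_def field_simps)
  have "integrable lborel (\<lambda>r. exp (- \<delta> * r\<^sup>2))"
    unfolding eq using \<sigma>(1) by (intro integrable_mult_right integrable_normal_density)
  then have fin: "(\<integral>\<^sup>+r. ennreal (exp (- \<delta> * r\<^sup>2)) \<partial>lborel) < \<infinity>"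
    by (simp add: integrable_iff_bounded)
  have "exp (- \<delta> * (norm x)\<^sup>2) = (\<Prod>b\<in>Basis. exp (- \<delta> * (x \<bullet> b)\<^sup>2))" for x :: 'v
    by (simp add: exp_sum[symmetric] sum_distrib_left[symmetric] sum_negf norm_eq_sqrt_inner
        euclidean_inner[of x x] power2_eq_square[symmetric] sum_nonneg)
  then have "(\<integral>\<^sup>+x. ennreal (exp (- \<delta> * (norm (x::'v))\<^sup>2)) \<partial>lborel)
      = (\<integral>\<^sup>+x. (\<Prod>b\<in>Basis. ennreal (exp (- \<delta> * ((x::'v) \<bullet> b)\<^sup>2))) \<partial>lborel)"
    by (simp add: prod_ennreal)
  also have "\<dots> = (\<Prod>b\<in>(Basis::'v set). (\<integral>\<^sup>+r. ennreal (exp (- \<delta> * r\<^sup>2)) \<partial>lborel))"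
    by (rule nn_integral_lborel_prod) auto
  also have "\<dots> < \<infinity>"
    using fin by (simp add: ennreal_prod_eq_top less_top[symmetric] power_eq_top_ennreal)
  finally show "(\<integral>\<^sup>+x. ennreal (norm (exp (- \<delta> * (norm (x::'v))\<^sup>2))) \<partial>lborel) < \<infinity>"
    by simp
qed simp

text \<open>One pair C, \<delta> serves the whole index set. This uniformity supplies the integrable
  majorant for every limit in time, in a space shift or in the mollifier index. A single function is
  treated as a family over \<open>unit\<close>.\<close>

definition gauss_dominated :: "'i set \<Rightarrow> ('i \<Rightarrow> 'v::euclidean_space \<Rightarrow> real) \<Rightarrow> bool" where
  "gauss_dominated S f \<longleftrightarrow>
     (\<exists>C \<delta>. 0 < \<delta> \<and> (\<forall>i\<in>S. \<forall>x. \<bar>f i x\<bar> \<le> C * exp (- \<delta> * (norm x)\<^sup>2)))"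

lemma gauss_dominatedE:
  assumes "gauss_dominated S f"
  obtains C \<delta> where "0 < \<delta>" "0 \<le> C" "\<And>i x. i \<in> S \<Longrightarrow> \<bar>f i x\<bar> \<le> C * exp (- \<delta> * (norm x)\<^sup>2)"
proof -
  obtain C \<delta> where *: "0 < \<delta>" "\<And>i x. i \<in> S \<Longrightarrow> \<bar>f i x\<bar> \<le> C * exp (- \<delta> * (norm x)\<^sup>2)"
    using assms by (auto simp: gauss_dominated_def)
  have "\<bar>f i x\<bar> \<le> \<bar>C\<bar> * exp (- \<delta> * (norm x)\<^sup>2)" if "i \<in> S" for i x
    using *(2)[OF that, of x] by (smt (verit) mult_right_mono exp_ge_zero)
  with * that[of \<delta> "\<bar>C\<bar>"] show ?thesis by auto
qed

lemma gauss_dominatedI: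
  "0 < \<delta> \<Longrightarrow> (\<And>i x. i \<in> S \<Longrightarrow> \<bar>f i x\<bar> \<le> C * exp (- \<delta> * (norm x)\<^sup>2)) \<Longrightarrow> gauss_dominated S f"
  unfolding gauss_dominated_def by blast

lemma gauss_dominated_reindex:
  assumes "gauss_dominated S f" "\<And>j. j \<in> S' \<Longrightarrow> \<pi> j \<in> S"
  shows "gauss_dominated S' (\<lambda>j. f (\<pi> j))"
proof -
  obtain C \<delta> where "0 < \<delta>" "\<And>i x. i \<in> S \<Longrightarrow> \<bar>f i x\<bar> \<le> C * exp (- \<delta> * (norm x)\<^sup>2)"
    using assms(1) by (rule gauss_dominatedE) blast
  with assms(2) show ?thesis by (intro gauss_dominatedI[of \<delta> _ _ C]) auto
qed

lemma gauss_dominated_bound: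
  assumes "gauss_dominated S g" "\<And>i x. i \<in> S \<Longrightarrow> \<bar>f i x\<bar> \<le> B * \<bar>g i x\<bar>"
  shows "gauss_dominated S f"
proof -
  obtain C \<delta> where *: "0 < \<delta>" "0 \<le> C" "\<And>i x. i \<in> S \<Longrightarrow> \<bar>g i x\<bar> \<le> C * exp (- \<delta> * (norm x)\<^sup>2)"
    using assms(1) by (rule gauss_dominatedE) blast
  have "\<bar>f i x\<bar> \<le> (\<bar>B\<bar> * C) * exp (- \<delta> * (norm x)\<^sup>2)" if "i \<in> S" for i x
  proof -
    have "\<bar>f i x\<bar> \<le> \<bar>B\<bar> * \<bar>g i x\<bar>"
      using assms(2)[OF that, of x] by (smt (verit) mult_right_mono abs_ge_zero)
    also have "\<dots> \<le> \<bar>B\<bar> * (C * exp (- \<delta> * (norm x)\<^sup>2))"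
      by (intro mult_left_mono * that) auto
    finally show ?thesis by (simp add: mult.assoc)
  qed
  with *(1) show ?thesis by (rule gauss_dominatedI)
qed

lemma gauss_dominated_mult_bounded:
  assumes "gauss_dominated S g" "\<And>i x. i \<in> S \<Longrightarrow> \<bar>f i x\<bar> \<le> B"
  shows "gauss_dominated S (\<lambda>i x. f i x * g i x)" "gauss_dominated S (\<lambda>i x. g i x * f i x)"
  using assms(2) by (auto intro!: gauss_dominated_bound[OF assms(1), of _ B] mult_right_mono
      simp: abs_mult mult.commute[of "\<bar>g _ _\<bar>"])

lemma gauss_dominated_bounded:
  assumes "gauss_dominated S g"
  obtains B where "0 \<le> B" "\<And>i x. i \<in> S \<Longrightarrow> \<bar>g i x\<bar> \<le> B"
proof -
  obtain C \<delta> where *: "0 < \<delta>" "0 \<le> C" "\<And>i x. i \<in> S \<Longrightarrow> \<bar>g i x\<bar> \<le> C * exp (- \<delta> * (norm x)\<^sup>2)"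
    using assms(1) by (rule gauss_dominatedE) blast
  have "C * exp (- \<delta> * r\<^sup>2) \<le> C" for r
    using * by (intro mult_left_le) auto
  with *(3) have "\<bar>g i x\<bar> \<le> C" if "i \<in> S" for i x
    using that order_trans by blast
  with *(2) that show ?thesis by blast
qed

lemma gauss_dominated_mult:
  assumes "gauss_dominated S f" "gauss_dominated S g"
  shows "gauss_dominated S (\<lambda>i x. f i x * g i x)"
proof -
  obtain B where "\<And>i x. i \<in> S \<Longrightarrow> \<bar>f i x\<bar> \<le> B"
    using assms(1) by (rule gauss_dominated_bounded) blast
  with assms(2) show ?thesis by (rule gauss_dominated_mult_bounded)
qed

lemma gauss_dominated_cmult:
  "gauss_dominated S f \<Longrightarrow> gauss_dominated S (\<lambda>i x. c * f i x)"
  by (rule gauss_dominated_mult_bounded[where B = "\<bar>c\<bar>"]) auto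

lemma gauss_dominated_power:
  "gauss_dominated S f \<Longrightarrow> 0 < k \<Longrightarrow> gauss_dominated S (\<lambda>i x. f i x ^ k)"
proof (induction k)
  case (Suc k)
  then show ?case by (cases "k = 0") (auto intro: gauss_dominated_mult)
qed simp

lemma gauss_dominated_add:
  fixes f g :: "'i \<Rightarrow> 'v::euclidean_space \<Rightarrow> real"
  assumes "gauss_dominated S f" "gauss_dominated S g"
  shows "gauss_dominated S (\<lambda>i x. f i x + g i x)"
proof -
  obtain C \<delta> where f: "0 < \<delta>" "0 \<le> C" "\<And>i x. i \<in> S \<Longrightarrow> \<bar>f i x\<bar> \<le> C * exp (- \<delta> * (norm x)\<^sup>2)"
    using assms(1) by (rule gauss_dominatedE) blast
  obtain D \<epsilon> where g: "0 < \<epsilon>" "0 \<le> D" "\<And>i x. i \<in> S \<Longrightarrow> \<bar>g i x\<bar> \<le> D * exp (- \<epsilon> * (norm x)\<^sup>2)"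
    using assms(2) by (rule gauss_dominatedE) blast
  show ?thesis
  proof (rule gauss_dominatedI[of "min \<delta> \<epsilon>" _ _ "C + D"])
    fix i and x :: 'v assume "i \<in> S"
    have "C * exp (- \<delta> * (norm x)\<^sup>2) \<le> C * exp (- min \<delta> \<epsilon> * (norm x)\<^sup>2)"
      "D * exp (- \<epsilon> * (norm x)\<^sup>2) \<le> D * exp (- min \<delta> \<epsilon> * (norm x)\<^sup>2)"
      using f g by (auto intro!: mult_left_mono mult_right_mono)
    with f(3)[OF \<open>i \<in> S\<close>, of x] g(3)[OF \<open>i \<in> S\<close>, of x]
    show "\<bar>f i x + g i x\<bar> \<le> (C + D) * exp (- min \<delta> \<epsilon> * (norm x)\<^sup>2)"
      unfolding distrib_right by linarith
  qed (use f g in auto)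
qed

lemma gauss_dominated_diff:
  "gauss_dominated S f \<Longrightarrow> gauss_dominated S g \<Longrightarrow> gauss_dominated S (\<lambda>i x. f i x - g i x)"
  using gauss_dominated_add[of S f "\<lambda>i x. - 1 * g i x"] gauss_dominated_cmult[of S g "- 1"]
  by simp

lemma gauss_dominated_sum:
  "finite A \<Longrightarrow> (\<And>a. a \<in> A \<Longrightarrow> gauss_dominated S (f a)) \<Longrightarrow>
    gauss_dominated S (\<lambda>i x. \<Sum>a\<in>A. f a i x)"
proof (induction A rule: finite_induct)
  case empty
  show ?case by (auto intro!: gauss_dominatedI[of 1 _ _ 0])
next
  case (insert a A)
  then show ?case by (simp add: gauss_dominated_add)
qed

text \<open>Half of the exponent pays for the factor: r \<le> 1 + r^2 \<le> (1 + 2/\<delta>)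
  exp(\<delta> r^2 / 2).\<close>

lemma gauss_dominated_norm_mult:
  assumes "gauss_dominated S f"
  shows "gauss_dominated S (\<lambda>i x. norm x * f i x)"
proof -
  obtain C \<delta> where f: "0 < \<delta>" "0 \<le> C" "\<And>i x. i \<in> S \<Longrightarrow> \<bar>f i x\<bar> \<le> C * exp (- \<delta> * (norm x)\<^sup>2)"
    using assms(1) by (rule gauss_dominatedE) blast
  have r: "r * exp (- \<delta> * r\<^sup>2) \<le> (1 + 2 / \<delta>) * exp (- (\<delta> / 2) * r\<^sup>2)" for r
  proof -
    have "r \<le> 1 + r\<^sup>2" using power2_nonneg_ge_1_iff[of r] sum_squares_bound[of r 1]
      by (simp add: power2_eq_square) (smt (verit) zero_le_square)
    also have "\<dots> \<le> exp (\<delta> / 2 * r\<^sup>2) + 2 / \<delta> * exp (\<delta> / 2 * r\<^sup>2)"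
    proof (rule add_mono)
      show "1 \<le> exp (\<delta> / 2 * r\<^sup>2)" using f(1) by simp
      have "2 / \<delta> * (\<delta> / 2 * r\<^sup>2) \<le> 2 / \<delta> * exp (\<delta> / 2 * r\<^sup>2)"
        using f(1) exp_ge_add_one_self[of "\<delta> / 2 * r\<^sup>2"] by (intro mult_left_mono) (linarith, simp)
      then show "r\<^sup>2 \<le> 2 / \<delta> * exp (\<delta> / 2 * r\<^sup>2)" using f(1) by simp
    qed
    finally have "r \<le> (1 + 2 / \<delta>) * exp (\<delta> / 2 * r\<^sup>2)" by (simp add: algebra_simps)
    then have "r * exp (- \<delta> * r\<^sup>2) \<le> (1 + 2 / \<delta>) * exp (\<delta> / 2 * r\<^sup>2) * exp (- \<delta> * r\<^sup>2)"
      by (rule mult_right_mono) simp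
    also have "\<dots> = (1 + 2 / \<delta>) * exp (- (\<delta> / 2) * r\<^sup>2)"
      by (simp add: mult.assoc exp_add[symmetric] algebra_simps)
    finally show ?thesis .
  qed
  show ?thesis
  proof (rule gauss_dominatedI[of "\<delta> / 2" _ _ "C * (1 + 2 / \<delta>)"])
    fix i x assume i: "i \<in> S"
    have "\<bar>norm x * f i x\<bar> \<le> norm x * (C * exp (- \<delta> * (norm x)\<^sup>2))"
      using f(3)[OF i, of x] by (simp add: abs_mult mult_left_mono)
    also have "\<dots> \<le> C * ((1 + 2 / \<delta>) * exp (- (\<delta> / 2) * (norm x)\<^sup>2))"
      using mult_left_mono[OF r[of "norm x"] f(2)] by (simp add: mult.left_commute)
    finally show "\<bar>norm x * f i x\<bar> \<le> C * (1 + 2 / \<delta>) * exp (- (\<delta> / 2) * (norm x)\<^sup>2)"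
      by (simp add: mult.assoc)
  qed (use f in simp)
qed

lemma exp_neg_norm_square_translate:
  fixes x z :: "'v::real_inner"
  assumes "norm z \<le> 1" "0 < \<delta>"
  shows "exp (- \<delta> * (norm (x + z))\<^sup>2) \<le> exp \<delta> * exp (- (\<delta> / 2) * (norm x)\<^sup>2)"
proof -
  have "(norm x)\<^sup>2 \<le> (norm (x + z) + norm z)\<^sup>2"
    using norm_triangle_ineq4[of "x + z" z] by (intro power_mono) auto
  also have "\<dots> \<le> 2 * (norm (x + z))\<^sup>2 + 2 * (norm z)\<^sup>2"
    using sum_squares_bound[of "norm (x + z)" "norm z"] by (simp add: power2_sum)
  also have "(norm z)\<^sup>2 \<le> 1" using assms(1) by (simp add: power_le_one)
  finally have "(norm x)\<^sup>2 / 2 - 1 \<le> (norm (x + z))\<^sup>2" by simp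
  then have "\<delta> * ((norm x)\<^sup>2 / 2 - 1) \<le> \<delta> * (norm (x + z))\<^sup>2"
    using assms(2) by (intro mult_left_mono) auto
  then show ?thesis by (simp add: exp_add[symmetric] algebra_simps)
qed

text \<open>The shift becomes part of the index, with one constant for all shifts in the unit ball
  and half of the exponent as the price. This covers both difference quotients in space and kernels
  supported in that ball.\<close>

lemma gauss_dominated_translate:
  assumes "gauss_dominated S f"
  shows "gauss_dominated (S \<times> cball 0 1) (\<lambda>(i, z) x. f i (x + z))"
proof -
  obtain C \<delta> where f: "0 < \<delta>" "0 \<le> C" "\<And>i x. i \<in> S \<Longrightarrow> \<bar>f i x\<bar> \<le> C * exp (- \<delta> * (norm x)\<^sup>2)"
    using assms(1) by (rule gauss_dominatedE) blast
  show ?thesis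
  proof (rule gauss_dominatedI[of "\<delta> / 2" _ _ "C * exp \<delta>"], goal_cases)
    case (2 j x)
    then obtain i z where j: "j = (i, z)" "i \<in> S" "norm z \<le> 1" by (cases j) auto
    have "\<bar>f i (x + z)\<bar> \<le> C * exp (- \<delta> * (norm (x + z))\<^sup>2)" using f(3) j by blast
    also have "\<dots> \<le> C * (exp \<delta> * exp (- (\<delta> / 2) * (norm x)\<^sup>2))"
      using exp_neg_norm_square_translate[OF j(3) f(1), of x] f(2) by (rule mult_left_mono)
    finally show ?case by (simp add: j mult.assoc)
  qed (use f in simp)
qed

lemma gauss_dominated_integrable:
  fixes f :: "'i \<Rightarrow> 'b::euclidean_space \<Rightarrow> real"
  assumes "gauss_dominated S f" "i \<in> S" "f i \<in> borel_measurable lborel"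
  shows "integrable lborel (f i)"
proof -
  obtain C \<delta> where f: "0 < \<delta>" "0 \<le> C" "\<And>i x. i \<in> S \<Longrightarrow> \<bar>f i x\<bar> \<le> C * exp (- \<delta> * (norm x)\<^sup>2)"
    using assms(1) by (rule gauss_dominatedE) blast
  have "integrable lborel (\<lambda>x::'b. C * exp (- \<delta> * (norm x)\<^sup>2))"
    by (intro integrable_mult_right integrable_gaussian f)
  then show ?thesis
    by (rule Bochner_Integration.integrable_bound[OF _ assms(3)])
      (use f(2) f(3)[OF assms(2)] in \<open>auto simp: abs_mult intro!: AE_I2\<close>)
qed

lemma gauss_dominated_integral_bounded:
  fixes f :: "'i \<Rightarrow> 'b::euclidean_space \<Rightarrow> real"
  assumes "gauss_dominated S f"
  obtains B where "0 \<le> B" "\<And>i. i \<in> S \<Longrightarrow> \<bar>\<integral>x. f i x \<partial>lborel\<bar> \<le> B"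
proof -
  obtain C \<delta> where f: "0 < \<delta>" "0 \<le> C" "\<And>i x. i \<in> S \<Longrightarrow> \<bar>f i x\<bar> \<le> C * exp (- \<delta> * (norm x)\<^sup>2)"
    using assms(1) by (rule gauss_dominatedE) blast
  have int: "integrable lborel (\<lambda>x::'b. C * exp (- \<delta> * (norm x)\<^sup>2))"
    by (intro integrable_mult_right integrable_gaussian f)
  show ?thesis
  proof (rule that)
    show "0 \<le> (\<integral>x. C * exp (- \<delta> * (norm (x::'b))\<^sup>2) \<partial>lborel)"
      using f(2) by (intro integral_nonneg_AE) auto
    fix i assume "i \<in> S"
    have "\<bar>\<integral>x. f i x \<partial>lborel\<bar> \<le> (\<integral>x. \<bar>f i x\<bar> \<partial>lborel)"
      by (rule integral_abs_bound)
    also have "\<dots> \<le> (\<integral>x. C * exp (- \<delta> * (norm (x::'b))\<^sup>2) \<partial>lborel)"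
      by (rule integral_mono'[OF int]) (use f \<open>i \<in> S\<close> in auto)
    finally show "\<bar>\<integral>x. f i x \<partial>lborel\<bar> \<le> (\<integral>x. C * exp (- \<delta> * (norm (x::'b))\<^sup>2) \<partial>lborel)" .
  qed
qed

section \<open>Limits, continuity and derivatives under the integral sign\<close>

lemma gauss_dominated_LIMSEQ_integral:
  fixes f :: "nat \<Rightarrow> 'v::euclidean_space \<Rightarrow> real"
  assumes "gauss_dominated UNIV f" "\<And>k. f k \<in> borel_measurable lborel"
    "\<And>x. (\<lambda>k. f k x) \<longlonglongrightarrow> g x"
  shows "(\<lambda>k. \<integral>x. f k x \<partial>lborel) \<longlonglongrightarrow> (\<integral>x. g x \<partial>lborel)"
proof -
  obtain C \<delta> where f: "0 < \<delta>" "0 \<le> C" "\<And>k x. \<bar>f k x\<bar> \<le> C * exp (- \<delta> * (norm x)\<^sup>2)"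
    using assms(1) by (rule gauss_dominatedE) blast
  show ?thesis
  proof (rule integral_dominated_convergence)
    show "integrable lborel (\<lambda>x::'v. C * exp (- \<delta> * (norm x)\<^sup>2))"
      by (intro integrable_mult_right integrable_gaussian f)
    show "g \<in> borel_measurable lborel"
      using assms(2,3) by (rule borel_measurable_LIMSEQ_real[rotated])
  qed (use assms f in auto)
qed

lemma continuous_on_integral_gauss_dominated:
  fixes f :: "'i::metric_space \<Rightarrow> 'v::euclidean_space \<Rightarrow> real"
  assumes "gauss_dominated S f" "\<And>i. i \<in> S \<Longrightarrow> f i \<in> borel_measurable lborel"
    "\<And>x. continuous_on S (\<lambda>i. f i x)"
  shows "continuous_on S (\<lambda>i. \<integral>x. f i x \<partial>lborel)"
proof (rule continuous_on_sequentiallyI)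
  fix X :: "nat \<Rightarrow> 'i" and a
  assume X: "\<forall>n. X n \<in> S" and a: "a \<in> S" and lim: "X \<longlonglongrightarrow> a"
  show "(\<lambda>n. \<integral>x. f (X n) x \<partial>lborel) \<longlonglongrightarrow> (\<integral>x. f a x \<partial>lborel)"
  proof (rule gauss_dominated_LIMSEQ_integral)
    show "gauss_dominated UNIV (\<lambda>n. f (X n))"
      by (rule gauss_dominated_reindex[OF assms(1)]) (use X in auto)
    show "(\<lambda>n. f (X n) x) \<longlonglongrightarrow> f a x" for x
      using continuous_on_tendsto_compose[OF assms(3) lim a] X by simp
  qed (use assms(2) X in auto)
qed

text \<open>The mean value inequality hands the Gaussian bound on the derivatives down to the
  difference quotients, so dominated convergence applies along every sequence of increments.\<close>

lemma has_real_derivative_integral_gauss_dominated: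
  fixes f f' :: "real \<Rightarrow> 'v::euclidean_space \<Rightarrow> real"
  assumes S: "open S" "t \<in> S"
    and f: "gauss_dominated S f" "\<And>s. s \<in> S \<Longrightarrow> f s \<in> borel_measurable lborel"
    and f': "gauss_dominated S f'"
    and deriv: "\<And>s x. s \<in> S \<Longrightarrow> ((\<lambda>s. f s x) has_real_derivative f' s x) (at s)"
  shows "((\<lambda>s. \<integral>x. f s x \<partial>lborel) has_real_derivative (\<integral>x. f' t x \<partial>lborel)) (at t)"
proof -
  obtain C \<delta> where C: "0 < \<delta>" "0 \<le> C" "\<And>i x. i \<in> S \<Longrightarrow> \<bar>f' i x\<bar> \<le> C * exp (- \<delta> * (norm x)\<^sup>2)"
    using f' by (rule gauss_dominatedE) blast
  obtain e where e: "0 < e" "ball t e \<subseteq> S"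
    using S openE by blast
  have int: "integrable lborel (f s)" if "s \<in> S" for s
    using f that by (blast intro: gauss_dominated_integrable)
  have "((\<lambda>h. ((\<integral>x. f (t + h) x \<partial>lborel) - (\<integral>x. f t x \<partial>lborel)) / h) \<longlongrightarrow> (\<integral>x. f' t x \<partial>lborel))
      (at 0)"
    unfolding tendsto_at_iff_sequentially
  proof (intro allI impI)
    fix X :: "nat \<Rightarrow> real"
    assume X: "\<forall>i. X i \<in> UNIV - {0}" "X \<longlonglongrightarrow> 0"
    have "eventually (\<lambda>n. \<bar>X n\<bar> < e) sequentially"
      using order_tendstoD(2)[OF tendsto_rabs_zero[OF X(2)] e(1)] .
    then obtain N where N: "\<And>n. N \<le> n \<Longrightarrow> \<bar>X n\<bar> < e"
      by (auto simp: eventually_sequentially)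
    \<comment> \<open>Dropping the first \<open>N\<close> terms keeps all \<open>t + Y n\<close> in
      a ball inside \<open>S\<close>, where the derivatives exist and are bounded.\<close>
    define Y where "Y n = X (n + N)" for n
    have Y: "Y n \<noteq> 0" "\<bar>Y n\<bar> < e" "t + Y n \<in> S" for n
      using X(1) N[of "n + N"] e(2) by (auto simp: Y_def dist_real_def subset_iff)
    have Y0: "Y \<longlonglongrightarrow> 0" unfolding Y_def using X(2) by (rule LIMSEQ_ignore_initial_segment)
    have lim: "(\<lambda>n. \<integral>x. (f (t + Y n) x - f t x) / Y n \<partial>lborel) \<longlonglongrightarrow> (\<integral>x. f' t x \<partial>lborel)"
    proof (rule gauss_dominated_LIMSEQ_integral)
      show "gauss_dominated UNIV (\<lambda>n x. (f (t + Y n) x - f t x) / Y n)"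
      proof (rule gauss_dominatedI[OF C(1), of _ _ C])
        fix n x
        have "\<bar>f (t + Y n) x - f t x\<bar> \<le> C * exp (- \<delta> * (norm x)\<^sup>2) * \<bar>t + Y n - t\<bar>"
        proof -
          have "norm (f (t + Y n) x - f t x) \<le> C * exp (- \<delta> * (norm x)\<^sup>2) * norm (t + Y n - t)"
          proof (rule field_differentiable_bound[where S = "ball t e" and f' = "\<lambda>s. f' s x"])
            fix s assume "s \<in> ball t e"
            then have "s \<in> S" using e(2) by blast
            show "((\<lambda>s. f s x) has_field_derivative f' s x) (at s within ball t e)"
              by (rule has_field_derivative_at_within) (rule deriv[OF \<open>s \<in> S\<close>])
            show "norm (f' s x) \<le> C * exp (- \<delta> * (norm x)\<^sup>2)"
              using C(3)[OF \<open>s \<in> S\<close>] by simp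
          qed (use Y e in \<open>auto simp: dist_real_def\<close>)
          then show ?thesis by simp
        qed
        then show "\<bar>(f (t + Y n) x - f t x) / Y n\<bar> \<le> C * exp (- \<delta> * (norm x)\<^sup>2)"
          using Y(1)[of n] by (simp add: divide_le_eq)
      qed
      show "(\<lambda>x. (f (t + Y n) x - f t x) / Y n) \<in> borel_measurable lborel" for n
        using f(2) Y(3) S(2) by auto
      show "(\<lambda>n. (f (t + Y n) x - f t x) / Y n) \<longlonglongrightarrow> f' t x" for x
        using deriv[OF S(2), of x] Y(1) Y0
        by (auto simp: DERIV_def tendsto_at_iff_sequentially comp_def)
    qed
    have eq: "(\<integral>x. (f (t + Y n) x - f t x) / Y n \<partial>lborel)
        = ((\<integral>x. f (t + Y n) x \<partial>lborel) - (\<integral>x. f t x \<partial>lborel)) / Y n" for n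
      using int Y(3) S(2) by simp
    show "((\<lambda>h. ((\<integral>x. f (t + h) x \<partial>lborel) - (\<integral>x. f t x \<partial>lborel)) / h) \<circ> X)
        \<longlonglongrightarrow> (\<integral>x. f' t x \<partial>lborel)"
      using lim[unfolded eq] unfolding Y_def comp_def by (rule LIMSEQ_offset)
  qed
  then show ?thesis by (simp add: DERIV_def)
qed

section \<open>Directional derivatives and integration by parts\<close>

text \<open>Differentiability along the lines in direction \<open>v\<close> only: this is what
  composition with powers of the positive part and differentiation under the integral provide
  directly, without a detour through total derivatives.\<close>

definition has_partial ::
    "('v::real_normed_vector \<Rightarrow> real) \<Rightarrow> 'v \<Rightarrow> ('v \<Rightarrow> real) \<Rightarrow> bool" where
  "has_partial f v f' \<longleftrightarrow>
     (\<forall>x h. ((\<lambda>h. f (x + h *\<^sub>R v)) has_real_derivative f' (x + h *\<^sub>R v)) (at h))"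

lemma has_partialD:
  "has_partial f v f' \<Longrightarrow> ((\<lambda>h. f (x + h *\<^sub>R v)) has_real_derivative f' (x + h *\<^sub>R v)) (at h)"
  by (simp add: has_partial_def)

lemma has_partial_dir_deriv:
  assumes "\<And>z. f differentiable (at z)"
  shows "has_partial f v (dir_deriv v f)"
  unfolding has_partial_def
proof (intro allI)
  fix x h
  let ?D = "\<lambda>w. dir_deriv w f (x + h *\<^sub>R v)"
  have D: "(f has_derivative ?D) (at (x + h *\<^sub>R v))"
    using assms by (rule differentiable_has_derivative_at)
  have "((\<lambda>h. x + h *\<^sub>R v) has_derivative (\<lambda>r. r *\<^sub>R v)) (at h)"
    by (auto intro!: derivative_eq_intros)
  from has_derivative_compose[OF this D]
  have "((\<lambda>h. f (x + h *\<^sub>R v)) has_derivative (\<lambda>r. ?D (r *\<^sub>R v))) (at h)" .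
  moreover have "?D (r *\<^sub>R v) = ?D v * r" for r
    using linear_cmul[OF has_derivative_linear[OF D], of r v] by simp
  ultimately show "((\<lambda>h. f (x + h *\<^sub>R v)) has_real_derivative ?D v) (at h)"
    by (simp add: has_field_derivative_def)
qed

lemma has_partial_mult:
  "has_partial f v f' \<Longrightarrow> has_partial g v g' \<Longrightarrow>
    has_partial (\<lambda>x. f x * g x) v (\<lambda>x. f' x * g x + f x * g' x)"
  unfolding has_partial_def
  by (auto intro!: derivative_eq_intros)

lemma has_partial_add:
  "has_partial f v f' \<Longrightarrow> has_partial g v g' \<Longrightarrow> has_partial (\<lambda>x. f x + g x) v (\<lambda>x. f' x + g' x)"
  unfolding has_partial_def
  by (auto intro!: derivative_eq_intros)

lemma has_partial_compose_real:
  assumes "has_partial f v f'" and \<beta>: "\<And>r. (\<beta> has_real_derivative \<beta>' r) (at r)"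
  shows "has_partial (\<lambda>x. \<beta> (f x)) v (\<lambda>x. \<beta>' (f x) * f' x)"
  unfolding has_partial_def
proof (intro allI)
  fix x h
  show "((\<lambda>h. \<beta> (f (x + h *\<^sub>R v))) has_real_derivative \<beta>' (f (x + h *\<^sub>R v)) * f' (x + h *\<^sub>R v)) (at h)"
    by (rule DERIV_chain2[where f = \<beta> and g = "\<lambda>h. f (x + h *\<^sub>R v)", OF \<beta> has_partialD[OF assms(1)]])
qed

lemma lborel_integral_translate:
  fixes f :: "'v::euclidean_space \<Rightarrow> real"
  assumes "f \<in> borel_measurable borel"
  shows "(\<integral>x. f (x + c) \<partial>lborel) = (\<integral>x. f x \<partial>lborel)"
proof -
  have "(\<integral>x. f x \<partial>lborel) = (\<integral>x. f x \<partial>distr lborel borel ((+) c))"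
    by (simp add: lborel_distr_plus)
  also have "\<dots> = (\<integral>x. f (c + x) \<partial>lborel)"
    using assms by (intro integral_distr) auto
  finally show ?thesis by (simp add: add.commute)
qed

lemma lborel_integral_reflect:
  fixes f :: "'v::euclidean_space \<Rightarrow> real"
  assumes "f \<in> borel_measurable borel"
  shows "(\<integral>x. f (c - x) \<partial>lborel) = (\<integral>x. f x \<partial>lborel)"
proof -
  have "lborel = distr lborel borel (\<lambda>x::'v. c - x)"
    using lborel_affine[of "- 1" c] by (simp add: density_1)
  then have "(\<integral>x. f x \<partial>lborel) = (\<integral>x. f x \<partial>distr lborel borel (\<lambda>x. c - x))"
    by simp
  also have "\<dots> = (\<integral>x. f (c - x) \<partial>lborel)"
    using assms by (intro integral_distr) auto
  finally show ?thesis by simp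
qed

text \<open>By translation invariance the integral of f(x + h v) does not depend on
  \<open>h\<close>, while its derivative at 0 is the integral of \<open>f'\<close>. The norm bound
  on \<open>v\<close> keeps the shifts with |h| < 1 in the unit ball, where the Gaussian bound is
  uniform.\<close>

lemma integral_partial_eq_0:
  fixes f f' :: "'v::euclidean_space \<Rightarrow> real"
  assumes f: "has_partial f v f'" "norm v \<le> 1" "f \<in> borel_measurable borel"
    and gd: "gauss_dominated (UNIV :: unit set) (\<lambda>_. f)" "gauss_dominated (UNIV :: unit set) (\<lambda>_. f')"
  shows "(\<integral>x. f' x \<partial>lborel) = 0"
proof -
  let ?S = "{-1<..<1::real}"
  have tr: "gauss_dominated ?S (\<lambda>h x. g (x + h *\<^sub>R v))"
    if "gauss_dominated (UNIV :: unit set) (\<lambda>_. g)" for g :: "'v \<Rightarrow> real"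
  proof -
    have "norm (h *\<^sub>R v) \<le> 1" if "h \<in> ?S" for h
    proof -
      have "\<bar>h\<bar> \<le> 1" using that by auto
      then show ?thesis using f(2) mult_le_one[of "\<bar>h\<bar>" "norm v"] by simp
    qed
    then show ?thesis
      using gauss_dominated_reindex[OF gauss_dominated_translate[OF that], of ?S "\<lambda>h. ((), h *\<^sub>R v)"]
      by simp
  qed
  have "((\<lambda>h. \<integral>x. f (x + h *\<^sub>R v) \<partial>lborel) has_real_derivative (\<integral>x. f' (x + 0 *\<^sub>R v) \<partial>lborel)) (at 0)"
    by (rule has_real_derivative_integral_gauss_dominated[where S = ?S, OF _ _ tr[OF gd(1)] _ tr[OF gd(2)]])
      (use f in \<open>auto intro: has_partialD\<close>)
  moreover have "(\<integral>x. f (x + h *\<^sub>R v) \<partial>lborel) = (\<integral>x. f x \<partial>lborel)" for h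
    using f(3) by (rule lborel_integral_translate)
  ultimately show ?thesis
    using DERIV_unique[OF DERIV_const[of "\<integral>x. f x \<partial>lborel" "at (0::real)"]] by simp
qed

section \<open>Convolution with a compactly supported kernel\<close>

text \<open>Neither sign nor mass is prescribed, so directional derivatives of kernels are kernels
  again and the statements on \<open>conv\<close> apply to them.\<close>

definition smooth_kernel :: "('v::euclidean_space \<Rightarrow> real) \<Rightarrow> bool" where
  "smooth_kernel \<eta> \<longleftrightarrow> (\<forall>k. Ck k \<eta>) \<and> (\<forall>x. 1 < norm x \<longrightarrow> \<eta> x = 0)"

lemma smooth_kernel_continuous: "smooth_kernel \<eta> \<Longrightarrow> continuous_on UNIV \<eta>"
  unfolding smooth_kernel_def by (metis Ck.simps(1))

lemma smooth_kernel_differentiable: "smooth_kernel \<eta> \<Longrightarrow> \<eta> differentiable (at z)"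
  unfolding smooth_kernel_def by (metis Ck.simps(2))

lemma smooth_kernel_dir_deriv:
  assumes "smooth_kernel \<eta>"
  shows "smooth_kernel (dir_deriv v \<eta>)"
  unfolding smooth_kernel_def
proof (intro conjI allI impI)
  show "Ck k (dir_deriv v \<eta>)" for k
    using assms unfolding smooth_kernel_def by (metis Ck.simps(2))
  fix x :: 'a assume "1 < norm x"
  then have "x \<in> - cball 0 1" by simp
  have "(\<eta> has_derivative (\<lambda>_. 0)) (at x)"
    by (rule has_derivative_transform_within_open[OF has_derivative_const _ \<open>x \<in> - cball 0 1\<close>])
      (use assms in \<open>auto simp: smooth_kernel_def\<close>)
  then show "dir_deriv v \<eta> x = 0" by (rule dir_deriv_eqI)
qed

lemma smooth_kernel_bounded:
  assumes "smooth_kernel \<eta>"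
  obtains B where "0 \<le> B" "\<And>x. \<bar>\<eta> x\<bar> \<le> B"
proof -
  have "compact (\<eta> ` cball 0 1)"
    using smooth_kernel_continuous[OF assms]
    by (intro compact_continuous_image) (auto intro: continuous_on_subset)
  then obtain B where B: "0 < B" "\<And>x. x \<in> cball 0 1 \<Longrightarrow> \<bar>\<eta> x\<bar> \<le> B"
    using compact_imp_bounded bounded_pos by (metis (no_types, lifting) image_eqI real_norm_def)
  have "\<bar>\<eta> x\<bar> \<le> B" for x
    using B(2)[of x] B(1) assms by (cases "norm x \<le> 1") (auto simp: smooth_kernel_def)
  with B(1) that[of B] show ?thesis by simp
qed

lemma smooth_kernel_gauss_dominated:
  assumes "smooth_kernel \<eta>"
  shows "gauss_dominated S (\<lambda>_. \<eta>)"
proof -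
  obtain B where B: "0 \<le> B" "\<And>x. \<bar>\<eta> x\<bar> \<le> B"
    using assms by (rule smooth_kernel_bounded) blast
  show ?thesis
  proof (rule gauss_dominatedI[of 1 _ _ "B * exp 1"])
    fix x :: 'a
    show "\<bar>\<eta> x\<bar> \<le> B * exp 1 * exp (- 1 * (norm x)\<^sup>2)"
    proof (cases "norm x \<le> 1")
      case True
      then have "(norm x)\<^sup>2 \<le> 1" by (simp add: power_le_one)
      then have "B * 1 \<le> B * (exp 1 * exp (- 1 * (norm x)\<^sup>2))"
        using B(1) by (intro mult_left_mono) (simp_all add: exp_add[symmetric])
      with B(2)[of x] show ?thesis by (simp add: mult.assoc)
    next
      case False
      with assms B(1) show ?thesis by (simp add: smooth_kernel_def)
    qed
  qed simp
qed

definition conv :: "('v::euclidean_space \<Rightarrow> real) \<Rightarrow> ('v \<Rightarrow> real) \<Rightarrow> 'v \<Rightarrow> real" where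
  "conv \<eta> f x = (\<integral>y. f y * \<eta> (x - y) \<partial>lborel)"

context
  fixes \<eta> :: "'v::euclidean_space \<Rightarrow> real"
  assumes \<eta>: "smooth_kernel \<eta>"
begin

lemma kernel_translate_measurable [measurable]: "(\<lambda>y. \<eta> (x - y)) \<in> borel_measurable borel"
  by (rule borel_measurable_continuous_onI,
      rule continuous_on_compose2[OF smooth_kernel_continuous[OF \<eta>]])
     (auto intro!: continuous_intros)

lemma gauss_dominated_mult_kernel:
  assumes "gauss_dominated S f"
  shows "gauss_dominated (S \<times> UNIV) (\<lambda>(i, x) y. f i y * \<eta> (x - y))"
proof -
  obtain B where "\<And>x. \<bar>\<eta> x\<bar> \<le> B"
    using \<eta> by (rule smooth_kernel_bounded) blast
  then show ?thesis
    using gauss_dominated_mult_bounded(2)[OF gauss_dominated_reindex[OF assms, of "S \<times> UNIV" fst],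
        of "\<lambda>(i, x) y. \<eta> (x - y)" B]
    by (auto simp: case_prod_unfold)
qed

lemma conv_integrable:
  assumes "gauss_dominated S f" "i \<in> S" "f i \<in> borel_measurable borel"
  shows "integrable lborel (\<lambda>y. f i y * \<eta> (x - y))"
  using gauss_dominated_integrable[OF gauss_dominated_mult_kernel[OF assms(1)], of "(i, x)"] assms(2,3)
  by simp

lemma conv_diff:
  assumes "gauss_dominated S f" "i \<in> S" "f i \<in> borel_measurable borel"
    "gauss_dominated S' g" "j \<in> S'" "g j \<in> borel_measurable borel"
  shows "conv \<eta> (\<lambda>y. f i y - g j y) x = conv \<eta> (f i) x - conv \<eta> (g j) x"
  unfolding conv_def left_diff_distrib
  by (intro Bochner_Integration.integral_diff conv_integrable[OF assms(1-3)] conv_integrable[OF assms(4-6)])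

lemma conv_continuous_on:
  assumes "gauss_dominated S f" "i \<in> S" "f i \<in> borel_measurable borel"
  shows "continuous_on UNIV (conv \<eta> (f i))"
  unfolding conv_def[abs_def]
proof (rule continuous_on_integral_gauss_dominated)
  show "gauss_dominated UNIV (\<lambda>x y. f i y * \<eta> (x - y))"
    using gauss_dominated_reindex[OF gauss_dominated_mult_kernel[OF assms(1)], of UNIV "\<lambda>x. (i, x)"]
      assms(2) by simp
  show "continuous_on UNIV (\<lambda>x. f i y * \<eta> (x - y))" for y
    by (intro continuous_on_mult continuous_on_const
        continuous_on_compose2[OF smooth_kernel_continuous[OF \<eta>]]) (auto intro!: continuous_intros)
qed (use assms(3) in measurable)

lemma conv_continuous_on_param:
  fixes f :: "'i::metric_space \<Rightarrow> 'v \<Rightarrow> real"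
  assumes "gauss_dominated S f" "\<And>i. i \<in> S \<Longrightarrow> f i \<in> borel_measurable borel"
    "\<And>y. continuous_on S (\<lambda>i. f i y)"
  shows "continuous_on S (\<lambda>i. conv \<eta> (f i) x)"
  unfolding conv_def
proof (rule continuous_on_integral_gauss_dominated)
  show "gauss_dominated S (\<lambda>i y. f i y * \<eta> (x - y))"
    using gauss_dominated_reindex[OF gauss_dominated_mult_kernel[OF assms(1)], of S "\<lambda>i. (i, x)"] by simp
  show "(\<lambda>y. f i y * \<eta> (x - y)) \<in> borel_measurable lborel" if "i \<in> S" for i
    using assms(2)[OF that] by measurable
  show "continuous_on S (\<lambda>i. f i y * \<eta> (x - y))" for y
    by (intro continuous_on_mult continuous_on_const assms(3))
qed

end

lemma conv_has_partial:
  assumes \<eta>: "smooth_kernel \<eta>"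
    and f: "gauss_dominated S f" "i \<in> S" "f i \<in> borel_measurable borel"
  shows "has_partial (conv \<eta> (f i)) v (conv (dir_deriv v \<eta>) (f i))"
  unfolding has_partial_def conv_def
proof (intro allI)
  fix x h
  have gd: "gauss_dominated UNIV (\<lambda>h y. f i y * \<zeta> (x + h *\<^sub>R v - y))" if "smooth_kernel \<zeta>" for \<zeta>
    using gauss_dominated_reindex[OF gauss_dominated_mult_kernel[OF that f(1)], of UNIV "\<lambda>h. (i, x + h *\<^sub>R v)"]
      f(2) by simp
  show "((\<lambda>h. \<integral>y. f i y * \<eta> (x + h *\<^sub>R v - y) \<partial>lborel) has_real_derivative
      (\<integral>y. f i y * dir_deriv v \<eta> (x + h *\<^sub>R v - y) \<partial>lborel)) (at h)"
  proof (rule has_real_derivative_integral_gauss_dominated[OF open_UNIV UNIV_I gd[OF \<eta>] _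
        gd[OF smooth_kernel_dir_deriv[OF \<eta>]]])
    show "(\<lambda>y. f i y * \<eta> (x + h *\<^sub>R v - y)) \<in> borel_measurable lborel" for h
      using f(3) kernel_translate_measurable[OF \<eta>] by measurable
    fix h y
    have "((\<lambda>h. \<eta> ((x - y) + h *\<^sub>R v)) has_real_derivative dir_deriv v \<eta> ((x - y) + h *\<^sub>R v)) (at h)"
      by (intro has_partialD has_partial_dir_deriv smooth_kernel_differentiable \<eta>)
    then show "((\<lambda>h. f i y * \<eta> (x + h *\<^sub>R v - y)) has_real_derivative
        f i y * dir_deriv v \<eta> (x + h *\<^sub>R v - y)) (at h)"
      by (intro DERIV_cmult) (simp add: algebra_simps)
  qed
qed

text \<open>The derivative in y of q(y) \<eta>(x - y) integrates to zero, and the minus sign inside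
  \<eta> turns this into equality of the two convolutions.\<close>

lemma conv_partial_commute:
  assumes \<eta>: "smooth_kernel \<eta>" and v: "norm v \<le> 1"
    and q: "has_partial q v q'" "q \<in> borel_measurable borel" "q' \<in> borel_measurable borel"
      "gauss_dominated (UNIV :: unit set) (\<lambda>_. q)" "gauss_dominated (UNIV :: unit set) (\<lambda>_. q')"
  shows "conv \<eta> q' x = conv (dir_deriv v \<eta>) q x"
proof -
  let ?g = "\<lambda>y. q' y * \<eta> (x - y) + q y * - dir_deriv v \<eta> (x - y)"
  note d\<eta> = smooth_kernel_dir_deriv[OF \<eta>, of v]
  note [measurable] = kernel_translate_measurable[OF \<eta>] kernel_translate_measurable[OF d\<eta>] q(2,3)
  have gdk: "gauss_dominated (UNIV :: unit set) (\<lambda>_ y. r y * \<zeta> (x - y))"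
    if "smooth_kernel \<zeta>" "gauss_dominated (UNIV :: unit set) (\<lambda>_. r)" for r \<zeta> :: "'a \<Rightarrow> real"
    using gauss_dominated_reindex[OF gauss_dominated_mult_kernel[OF that], of UNIV "\<lambda>_. ((), x)"] by simp
  have int: "integrable lborel (\<lambda>y. q' y * \<eta> (x - y))" "integrable lborel (\<lambda>y. q y * dir_deriv v \<eta> (x - y))"
    using conv_integrable[OF \<eta> q(5) UNIV_I q(3)] conv_integrable[OF d\<eta> q(4) UNIV_I q(2)] by simp_all
  have "(\<integral>y. ?g y \<partial>lborel) = 0"
  proof (rule integral_partial_eq_0[OF _ v])
    have "((\<lambda>h. \<eta> (x - (y + h *\<^sub>R v))) has_real_derivative - dir_deriv v \<eta> (x - (y + h *\<^sub>R v))) (at h)" for y h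
    proof -
      have 1: "((\<lambda>h. \<eta> ((x - y) + h *\<^sub>R v)) has_real_derivative dir_deriv v \<eta> ((x - y) + (- h) *\<^sub>R v)) (at (- h))"
        by (intro has_partialD has_partial_dir_deriv smooth_kernel_differentiable \<eta>)
      have 2: "(uminus has_real_derivative - 1) (at h)"
        by (auto intro!: derivative_eq_intros)
      show ?thesis using DERIV_chain2[OF 1 2] by (simp add: algebra_simps)
    qed
    then have "has_partial (\<lambda>y. \<eta> (x - y)) v (\<lambda>y. - dir_deriv v \<eta> (x - y))"
      by (simp add: has_partial_def)
    with q(1) show "has_partial (\<lambda>y. q y * \<eta> (x - y)) v ?g"
      by (rule has_partial_mult)
    show "gauss_dominated (UNIV :: unit set) (\<lambda>_ y. q y * \<eta> (x - y))"
      by (rule gdk[OF \<eta> q(4)])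
    show "gauss_dominated (UNIV :: unit set) (\<lambda>_. ?g)"
      using gauss_dominated_diff[OF gdk[OF \<eta> q(5)] gdk[OF d\<eta> q(4)]] by simp
  qed measurable
  then show ?thesis using int by (simp add: conv_def)
qed

lemma conv_reflect:
  assumes "smooth_kernel \<eta>" "f \<in> borel_measurable borel"
  shows "conv \<eta> f x = (\<integral>z. f (x - z) * \<eta> z \<partial>lborel)"
  using lborel_integral_reflect[of "\<lambda>y. f y * \<eta> (x - y)" x] kernel_translate_measurable[OF assms(1)] assms(2)
  unfolding conv_def by simp

text \<open>Only the support in the unit ball and a common bound on the L1 norms of the kernels
  enter, so the Gaussian bound is uniform in the kernel as well as in \<open>i\<close>. It therefore
  persists as the mollification is removed.\<close>

lemma gauss_dominated_conv:
  fixes \<eta> :: "'j \<Rightarrow> 'v::euclidean_space \<Rightarrow> real"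
  assumes \<eta>: "\<And>j. j \<in> J \<Longrightarrow> smooth_kernel (\<eta> j)" "\<And>j. j \<in> J \<Longrightarrow> (\<integral>x. \<bar>\<eta> j x\<bar> \<partial>lborel) \<le> B"
    and f: "gauss_dominated S f" "\<And>i. i \<in> S \<Longrightarrow> f i \<in> borel_measurable borel"
  shows "gauss_dominated (J \<times> S) (\<lambda>(j, i). conv (\<eta> j) (f i))"
proof -
  obtain C \<delta> where C: "0 < \<delta>" "0 \<le> C" "\<And>i x. i \<in> S \<times> cball 0 1 \<Longrightarrow>
      \<bar>(\<lambda>(i, z) x. f i (x + z)) i x\<bar> \<le> C * exp (- \<delta> * (norm x)\<^sup>2)"
    by (rule gauss_dominatedE[OF gauss_dominated_translate[OF f(1)]]) blast
  show ?thesis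
  proof (rule gauss_dominatedI[OF C(1), of _ _ "C * B"], clarsimp)
    fix j i and x :: 'v assume j: "j \<in> J" and i: "i \<in> S"
    have int: "integrable lborel (\<eta> j)"
      using gauss_dominated_integrable[OF smooth_kernel_gauss_dominated[OF \<eta>(1)[OF j]], of "()" UNIV]
        borel_measurable_continuous_onI[OF smooth_kernel_continuous[OF \<eta>(1)[OF j]]] by simp
    let ?E = "C * exp (- (\<delta> * (norm x)\<^sup>2))"
    have "\<bar>f i (x - z) * \<eta> j z\<bar> \<le> ?E * \<bar>\<eta> j z\<bar>" for z
    proof (cases "norm z \<le> 1")
      case True
      then show ?thesis
        using C(3)[of "(i, - z)" x] i by (simp add: abs_mult mult_right_mono)
    next
      case False
      then show ?thesis using \<eta>(1)[OF j] by (simp add: smooth_kernel_def)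
    qed
    then have "(\<integral>z. \<bar>f i (x - z) * \<eta> j z\<bar> \<partial>lborel) \<le> (\<integral>z. ?E * \<bar>\<eta> j z\<bar> \<partial>lborel)"
      using int C(2) by (intro integral_mono') auto
    moreover have "\<bar>conv (\<eta> j) (f i) x\<bar> \<le> (\<integral>z. \<bar>f i (x - z) * \<eta> j z\<bar> \<partial>lborel)"
      unfolding conv_reflect[OF \<eta>(1)[OF j] f(2)[OF i]] by (rule integral_abs_bound)
    moreover have "(\<integral>z. ?E * \<bar>\<eta> j z\<bar> \<partial>lborel) \<le> ?E * B"
      using \<eta>(2)[OF j] C(2) by (simp add: mult_left_mono)
    ultimately show "\<bar>conv (\<eta> j) (f i) x\<bar> \<le> C * B * exp (- (\<delta> * (norm x)\<^sup>2))"
      by (simp add: algebra_simps)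
  qed
qed

section \<open>Approximate identities\<close>

lemma mollifiers_exist:
  obtains \<eta> :: "nat \<Rightarrow> 'v::euclidean_space \<Rightarrow> real"
  where "\<And>k. smooth_kernel (\<eta> k)" "\<And>k x. 0 \<le> \<eta> k x" "\<And>k. (\<integral>x. \<eta> k x \<partial>lborel) = 1"
    "\<And>k x. 1 / Suc k \<le> norm x \<Longrightarrow> \<eta> k x = 0"
proof
  define r where "r k = 1 / Suc k" for k
  have r: "0 < r k" "r k \<le> 1" for k by (auto simp: r_def)
  define I where "I k = (\<integral>x. bump (r k) (x::'v) \<partial>lborel)" for k
  define \<eta> where "\<eta> k x = 1 / I k * bump (r k) (x::'v)" for k x
  have ker: "smooth_kernel (bump (r k) :: 'v \<Rightarrow> real)" for k
    using r(1)[of k] r(2)[of k] by (auto simp: smooth_kernel_def Ck_bump intro!: bump_eq_0)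
  have int: "integrable lborel (bump (r k) :: 'v \<Rightarrow> real)" for k
    using gauss_dominated_integrable[OF smooth_kernel_gauss_dominated[OF ker[of k]], of "()" UNIV]
      borel_measurable_continuous_onI[OF smooth_kernel_continuous[OF ker[of k]]] by simp
  have "I k \<noteq> 0" for k
  proof
    assume "I k = 0"
    then have "AE x in lborel. bump (r k) (x::'v) = 0"
      using integral_nonneg_eq_0_iff_AE[OF int[of k]] by (simp add: I_def bump_nonneg)
    then have "AE x in lborel. (x::'v) \<notin> ball 0 (r k)"
      by (rule AE_mp) (auto dest: bump_pos intro!: AE_I2)
    then have "emeasure lborel (ball (0::'v) (r k)) = 0"
      by (subst (asm) AE_iff_measurable[OF _ refl]) (auto simp: ball_def)
    then have "measure lborel (ball (0::'v) (r k)) = 0"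
      by (simp add: measure_def)
    then show False
      using content_ball_pos[OF r(1)[of k], of "0::'v"] by simp
  qed
  then have I: "0 < I k" for k
    unfolding I_def by (metis integral_nonneg_AE AE_I2 bump_nonneg order_le_less)
  show "smooth_kernel (\<eta> k)" for k
    unfolding smooth_kernel_def
  proof (intro conjI allI impI)
    show "Ck j (\<eta> k)" for j
      unfolding \<eta>_def[abs_def] by (intro Ck_mult Ck_const Ck_bump)
  qed (use ker[of k] in \<open>auto simp: smooth_kernel_def \<eta>_def\<close>)
  show "0 \<le> \<eta> k x" for k x using I[of k] by (simp add: \<eta>_def bump_nonneg)
  show "(\<integral>x. \<eta> k x \<partial>lborel) = 1" for k using I[of k] by (simp add: \<eta>_def I_def[symmetric])
  show "1 / Suc k \<le> norm x \<Longrightarrow> \<eta> k x = 0" for k x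
    using r(1)[of k] by (simp add: \<eta>_def bump_eq_0 r_def)
qed

text \<open>Continuity of \<open>f\<close> gives convergence at every point, not merely almost
  everywhere. The family \<open>F\<close> carries the boundedness of \<open>f\<close> that makes the
  integrals exist.\<close>

lemma conv_mollifier_LIMSEQ:
  fixes \<eta> :: "nat \<Rightarrow> 'v::euclidean_space \<Rightarrow> real"
  assumes \<eta>: "\<And>k. smooth_kernel (\<eta> k)" "\<And>k x. 0 \<le> \<eta> k x" "\<And>k. (\<integral>x. \<eta> k x \<partial>lborel) = 1"
    "\<And>k x. 1 / Suc k \<le> norm x \<Longrightarrow> \<eta> k x = 0"
    and f: "continuous_on UNIV f" "gauss_dominated S F" "i \<in> S" "F i = f"
  shows "(\<lambda>k. conv (\<eta> k) f x) \<longlonglongrightarrow> f x"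
proof (rule LIMSEQ_I)
  fix e :: real assume e: "0 < e"
  have fm: "f \<in> borel_measurable borel" using f(1) by (rule borel_measurable_continuous_onI)
  obtain d where d: "0 < d" "\<And>y. dist y x < d \<Longrightarrow> dist (f y) (f x) < e / 2"
    using f(1) e unfolding continuous_on_iff by (metis UNIV_I half_gt_zero)
  obtain N where N: "1 / Suc N < d" using d(1) nat_approx_posE by blast
  have "norm (conv (\<eta> k) f x - f x) < e" if "N \<le> k" for k
  proof -
    have int\<eta>: "integrable lborel (\<eta> k)"
      using \<eta>(3)[of k] not_integrable_integral_eq by fastforce
    have int: "integrable lborel (\<lambda>z. f (x - z) * \<eta> k z)"
    proof -
      obtain B where B: "\<And>y. \<bar>f y\<bar> \<le> B"
        using gauss_dominated_bounded[OF f(2)] f(3,4) by metis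
      have "gauss_dominated (UNIV :: unit set) (\<lambda>_ z. f (x - z) * \<eta> k z)"
        by (rule gauss_dominated_mult_bounded(1)[OF smooth_kernel_gauss_dominated[OF \<eta>(1)] B])
      then show ?thesis
        by (rule gauss_dominated_integrable) (use fm int\<eta> in \<open>auto intro!: borel_measurable_times\<close>)
    qed
    have "conv (\<eta> k) f x - f x = (\<integral>z. f (x - z) * \<eta> k z \<partial>lborel) - (\<integral>z. f x * \<eta> k z \<partial>lborel)"
      using \<eta>(3)[of k] by (simp add: conv_reflect[OF \<eta>(1) fm])
    also have "\<dots> = (\<integral>z. f (x - z) * \<eta> k z - f x * \<eta> k z \<partial>lborel)"
      using int int\<eta> by simp
    finally have eq: "conv (\<eta> k) f x - f x = (\<integral>z. f (x - z) * \<eta> k z - f x * \<eta> k z \<partial>lborel)" .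
    have "\<bar>f (x - z) * \<eta> k z - f x * \<eta> k z\<bar> \<le> e / 2 * \<eta> k z" for z
    proof (cases "norm z < 1 / Suc k")
      case True
      also have "1 / Suc k \<le> 1 / Suc N" using that by (simp add: field_simps)
      finally have "dist (f (x - z)) (f x) < e / 2" using N by (intro d(2)) (simp add: dist_norm)
      then have "\<bar>f (x - z) - f x\<bar> * \<eta> k z \<le> e / 2 * \<eta> k z"
        using \<eta>(2)[of k z] by (intro mult_right_mono) (auto simp: dist_real_def)
      then show ?thesis
        using \<eta>(2)[of k z] by (simp add: left_diff_distrib[symmetric] abs_mult)
    next
      case False
      then show ?thesis using \<eta>(4)[of k z] by simp
    qed
    then have "(\<integral>z. \<bar>f (x - z) * \<eta> k z - f x * \<eta> k z\<bar> \<partial>lborel) \<le> (\<integral>z. e / 2 * \<eta> k z \<partial>lborel)"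
      using int\<eta> e \<eta>(2) by (intro integral_mono') auto
    moreover have "\<bar>conv (\<eta> k) f x - f x\<bar> \<le> (\<integral>z. \<bar>f (x - z) * \<eta> k z - f x * \<eta> k z\<bar> \<partial>lborel)"
      unfolding eq by (rule integral_abs_bound)
    ultimately show ?thesis using e \<eta>(3)[of k] by simp
  qed
  then show "\<exists>N. \<forall>k\<ge>N. norm (conv (\<eta> k) f x - f x) < e" by blast
qed

section \<open>Weak solutions of ordinary differential equations\<close>

lemma bump_shift_continuous: "continuous_on S (\<lambda>s. bump r (s - t :: real))"
proof -
  have "continuous_on UNIV (bump r :: real \<Rightarrow> real)" using Ck_bump[of 0 r] by simp
  then show ?thesis
    by (rule continuous_on_compose2) (auto intro!: continuous_intros)
qed

text \<open>One half of the fundamental lemma of the calculus of variations, to be used for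
  \<open>G\<close> and for its negative: if \<open>G\<close> were positive at \<open>t\<close>, a
  narrow bump there would have a positive integral against it.\<close>

lemma bump_test_nonpos:
  fixes G :: "real \<Rightarrow> real"
  assumes G: "continuous_on {0<..<T} G" and t: "t \<in> {0<..<T}"
    and int: "\<And>r. 0 < r \<Longrightarrow> {t - r..t + r} \<subseteq> {0<..<T} \<Longrightarrow>
      integral {0<..<T} (\<lambda>s. bump r (s - t) * G s) = 0"
  shows "G t \<le> 0"
proof (rule ccontr)
  assume "\<not> G t \<le> 0"
  then have Gt: "0 < G t" by simp
  obtain d where d: "0 < d" "\<And>s. s \<in> {0<..<T} \<Longrightarrow> dist s t < d \<Longrightarrow> dist (G s) (G t) < G t"
    using G t Gt unfolding continuous_on_iff by metis
  define r where "r = min (d / 2) (min (t / 2) ((T - t) / 2))"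
  have r: "0 < r" "r < d" "{t - r..t + r} \<subseteq> {0<..<T}"
  proof -
    show "0 < r" "r < d" using d(1) t by (auto simp: r_def)
    have "r \<le> t / 2" "r \<le> (T - t) / 2" unfolding r_def by linarith+
    then have "0 < t - r" "t + r < T" using t by (auto simp: field_simps)
    then show "{t - r..t + r} \<subseteq> {0<..<T}" by auto
  qed
  let ?f = "\<lambda>s. bump r (s - t) * G s"
  have cont: "continuous_on {t - r..t + r} ?f"
    by (intro continuous_on_mult bump_shift_continuous continuous_on_subset[OF G r(3)])
  have nonneg: "0 \<le> ?f s" if "s \<in> {t - r..t + r}" for s
  proof -
    have "dist s t < d" using that r by (auto simp: dist_real_def)
    then have "0 < G s" using d(2)[of s] that r(3) by (auto simp: dist_real_def)
    then show ?thesis using bump_nonneg[of r "s - t"] by simp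
  qed
  have "integral {0<..<T} ?f = integral {t - r..t + r} ?f"
  proof (rule integral_unique, rule has_integral_on_superset)
    show "(?f has_integral integral {t - r..t + r} ?f) {t - r..t + r}"
      by (intro integrable_integral integrable_continuous_interval cont)
    fix s assume "s \<notin> {t - r..t + r}"
    then have "r \<le> norm (s - t)" by auto
    then show "?f s = 0" using r(1) by (simp add: bump_eq_0)
  qed (rule r(3))
  with int[OF r(1,3)] have "integral {t - r..t + r} ?f = 0" by simp
  then have "\<forall>s\<in>{t - r..t + r}. ?f s = 0"
    using integral_eq_0_iff[OF cont _ nonneg] r(1) by simp
  from bspec[OF this, of t] r(1) have "?f t = 0" by simp
  with Gt bump_pos[of "0::real" r] r(1) show False by simp
qed

text \<open>A smooth step: the difference of two shifted copies is compactly supported, and its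
  derivative is a difference of two bumps.\<close>

lemma bump_antiderivative:
  assumes r: "0 < r"
  obtains N :: "real \<Rightarrow> real" where "\<And>x. (N has_real_derivative bump r x) (at x)"
    "\<And>k. Ck k N" "\<And>x. r \<le> x \<Longrightarrow> N x = N r" "\<And>x. x \<le> - r \<Longrightarrow> N x = N (- r)"
proof -
  obtain N where N: "\<And>x. (N has_real_derivative bump r x) (at x)"
    using continuous_antiderivative_exists[of "bump r"] bump_shift_continuous[of UNIV r 0] by auto
  have cont: "continuous_on S N" for S
    using N by (auto intro!: continuous_at_imp_continuous_on DERIV_isCont)
  have "Ck k N" for k
    by (rule Ck_SucD, rule Ck_real_derivI[OF N Ck_bump])
  moreover have "N x = N r" if "r \<le> x" for x
  proof (cases "x = r")
    case False
    with that have "r < x" by simp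
    then show ?thesis
    proof (rule DERIV_isconst_end[OF _ cont])
      fix y assume "r < y"
      then have "bump r y = 0" using r by (intro bump_eq_0) auto
      with N[of y] show "(N has_real_derivative 0) (at y)" by simp
    qed
  qed simp
  moreover have "N x = N (- r)" if "x \<le> - r" for x
  proof (cases "x = - r")
    case False
    with that have "x < - r" by simp
    then have "N (- r) = N x"
    proof (rule DERIV_isconst_end[OF _ cont])
      fix y assume "y < - r"
      then have "bump r y = 0" using r by (intro bump_eq_0) auto
      with N[of y] show "(N has_real_derivative 0) (at y)" by simp
    qed
    then show ?thesis by simp
  qed simp
  ultimately show ?thesis using N that by blast
qed

lemma bounded_continuous_on_Ioo_integrable:
  fixes f :: "real \<Rightarrow> real"
  assumes "continuous_on {a<..<b} f" "\<And>s. s \<in> {a<..<b} \<Longrightarrow> \<bar>f s\<bar> \<le> B"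
  shows "set_integrable lborel {a<..<b} f"
  unfolding set_integrable_def
proof (rule integrableI_bounded_set[where A = "{a<..<b}" and B = B])
  show "(\<lambda>s. indicat_real {a<..<b} s *\<^sub>R f s) \<in> borel_measurable lborel"
    using borel_measurable_continuous_on_indicator[OF _ assms(1)] by simp
  show "AE s in lborel. s \<in> {a<..<b} \<longrightarrow> norm (indicat_real {a<..<b} s *\<^sub>R f s) \<le> B"
    using assms(2) by auto
qed (use emeasure_lborel_box_finite[of a b] in auto)

text \<open>The candidate is P(s) = V0 + the integral of A over [0, s]. It satisfies the same weak
  identity as \<open>V\<close>, so the difference is annihilated by all bumps and vanishes; the
  derivative and the limit at 0 are then read off \<open>P\<close>. Test functions may be nonzero at
  time 0, which is how \<open>V0\<close> is detected.\<close>

lemma weak_time_derivative: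
  fixes V A :: "real \<Rightarrow> real"
  assumes T: "0 < T" and V: "continuous_on {0<..<T} V" "\<And>s. s \<in> {0<..<T} \<Longrightarrow> \<bar>V s\<bar> \<le> B"
    and A: "continuous_on {0<..<T} A" "\<And>s. s \<in> {0<..<T} \<Longrightarrow> \<bar>A s\<bar> \<le> B"
    and weak: "\<And>\<theta> a b. (\<And>k. Ck k \<theta>) \<Longrightarrow> b < T \<Longrightarrow> (\<And>s. s \<notin> {a..b} \<Longrightarrow> \<theta> s = 0) \<Longrightarrow>
      (LINT s:{0<..<T}|lborel. dir_deriv 1 \<theta> s * V s + \<theta> s * A s) + \<theta> 0 * V0 = 0"
  shows "t \<in> {0<..<T} \<Longrightarrow> (V has_real_derivative A t) (at t)"
    and "(V \<longlongrightarrow> V0) (at_right 0)"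
proof -
  \<comment> \<open>Extension by zero gives an integrable function on the closed interval, so that
    \<open>P\<close> is continuous up to both ends.\<close>
  define A0 where "A0 s = (if s \<in> {0<..<T} then A s else 0)" for s
  define P where "P s = V0 + integral {0..s} A0" for s
  have A0_int: "A0 integrable_on {0..T}"
    unfolding integrable_on_Icc_iff_Ioo
    using set_borel_integral_eq_integral(1)[OF bounded_continuous_on_Ioo_integrable[OF A]]
    by (rule integrable_eq) (auto simp: A0_def)
  have P_cont: "continuous_on {0..T} P"
    unfolding P_def by (intro continuous_on_add continuous_on_const indefinite_integral_continuous_1 A0_int)
  have P_deriv: "(P has_real_derivative A s) (at s)" if s: "s \<in> {0<..<T}" for s
  proof -
    have "continuous (at s) A"
      using A(1) s by (simp add: continuous_on_eq_continuous_at)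
    moreover have "eventually (\<lambda>r. A0 r = A r) (nhds s)"
      using eventually_nhds_in_open[OF open_greaterThanLessThan s] by (auto elim!: eventually_mono simp: A0_def)
    ultimately have "continuous (at s) A0"
      by (simp add: isCont_cong)
    then have "((\<lambda>u. integral {0..u} A0) has_vector_derivative A0 s) (at s within ({0..T} - {}))"
      using s by (intro integral_has_vector_derivative_continuous_at[OF A0_int])
        (auto intro: continuous_at_imp_continuous_at_within)
    moreover have "at s within ({0..T} - {}) = at s"
      using s by (intro at_within_interior) auto
    ultimately show ?thesis
      using s unfolding P_def[abs_def]
      by (auto intro!: derivative_eq_intros simp: A0_def has_real_derivative_iff_has_vector_derivative)
  qed
  let ?D = "\<lambda>s. V s - P s"
  have D_cont: "continuous_on {0<..<T} ?D"
    by (intro continuous_on_diff V continuous_on_subset[OF P_cont]) auto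
  have zero: "integral {0<..<T} (\<lambda>s. bump r (s - t) * ?D s) = 0"
    if t: "t \<in> {0<..<T}" and r: "0 < r" "{t - r..t + r} \<subseteq> {0<..<T}" for t r
  proof -
    have tr: "0 < t - r" "t + r < T" using subsetD[OF r(2), of "t - r"] subsetD[OF r(2), of "t + r"] r(1) by auto
    obtain N :: "real \<Rightarrow> real" where N: "\<And>x. (N has_real_derivative bump r x) (at x)"
      "\<And>k. Ck k N" "\<And>x. r \<le> x \<Longrightarrow> N x = N r" "\<And>x. x \<le> - r \<Longrightarrow> N x = N (- r)"
      using bump_antiderivative[OF r(1)] by blast
    \<comment> \<open>the second bump lies at negative times and only serves to make \<open>\<theta>\<close> compactly supported\<close>
    define \<theta> where "\<theta> s = N (1 + r + s) - N (- t + s)" for s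
    have \<theta>_Ck: "Ck k \<theta>" for k
    proof -
      have "Ck k (\<lambda>s. N (1 + r + s) + (- 1) * N (- t + s))"
        by (intro Ck_add Ck_mult Ck_const Ck_compose_affine[OF bounded_linear_ident N(2)])
      then show ?thesis by (simp add: \<theta>_def[abs_def])
    qed
    have \<theta>_deriv: "(\<theta> has_real_derivative bump r (1 + r + s) - bump r (- t + s)) (at s)" for s
      unfolding \<theta>_def[abs_def]
      using DERIV_shift[of N "bump r (1 + r + s)" s "1 + r"] DERIV_shift[of N "bump r (- t + s)" s "- t"] N(1)
      by (auto intro!: DERIV_diff simp: add.commute)
    have \<theta>': "dir_deriv 1 \<theta> s = - bump r (s - t)" if "0 < s" for s
    proof -
      have "dir_deriv 1 \<theta> s = bump r (1 + r + s) - bump r (- t + s)"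
        using dir_deriv_eqI[OF \<theta>_deriv[unfolded has_field_derivative_def], of 1 s] by simp
      moreover have "bump r (1 + r + s) = 0"
        using that r(1) by (intro bump_eq_0) auto
      ultimately show ?thesis by simp
    qed
    have \<theta>_supp: "\<theta> s = 0" if "s \<notin> {- 1 - 2 * r..t + r}" for s
      using that r(1) tr N(3)[of "1 + r + s"] N(3)[of "- t + s"] N(4)[of "1 + r + s"] N(4)[of "- t + s"]
      by (auto simp: \<theta>_def)
    have w: "(LINT s:{0<..<T}|lborel. dir_deriv 1 \<theta> s * V s + \<theta> s * A s) + \<theta> 0 * V0 = 0"
      by (rule weak[OF \<theta>_Ck tr(2) \<theta>_supp])
    have \<theta>_cont: "continuous_on S \<theta>" "continuous_on S (dir_deriv 1 \<theta>)" for S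
    proof -
      have "continuous_on UNIV \<theta>" "continuous_on UNIV (dir_deriv 1 \<theta>)"
        using \<theta>_Ck[of 0] \<theta>_Ck[of "Suc 0"] by auto
      then show "continuous_on S \<theta>" "continuous_on S (dir_deriv 1 \<theta>)"
        by (auto intro: continuous_on_subset)
    qed
    have bdd: "\<exists>K. \<forall>s\<in>{0<..<T}. \<bar>f s\<bar> \<le> K" if "continuous_on {0..T} f" for f :: "real \<Rightarrow> real"
      using compact_imp_bounded[OF compact_continuous_image[OF that compact_Icc]]
      by (force simp: bounded_iff)
    obtain K where K: "\<And>s. s \<in> {0<..<T} \<Longrightarrow> \<bar>\<theta> s\<bar> \<le> K" using bdd[OF \<theta>_cont(1)] by blast
    obtain K' where K': "\<And>s. s \<in> {0<..<T} \<Longrightarrow> \<bar>dir_deriv 1 \<theta> s\<bar> \<le> K'" using bdd[OF \<theta>_cont(2)] by blast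
    have "set_integrable lborel {0<..<T} (\<lambda>s. dir_deriv 1 \<theta> s * V s + \<theta> s * A s)"
    proof (rule bounded_continuous_on_Ioo_integrable)
      show "continuous_on {0<..<T} (\<lambda>s. dir_deriv 1 \<theta> s * V s + \<theta> s * A s)"
        by (intro continuous_on_add continuous_on_mult V A \<theta>_cont)
      fix s assume s: "s \<in> {0<..<T}"
      have "\<bar>dir_deriv 1 \<theta> s * V s\<bar> \<le> K' * B" "\<bar>\<theta> s * A s\<bar> \<le> K * B"
        using mult_mono[OF K'[OF s] V(2)[OF s]] mult_mono[OF K[OF s] A(2)[OF s]]
          order_trans[OF abs_ge_zero K'[OF s]] order_trans[OF abs_ge_zero K[OF s]]
        by (simp_all add: abs_mult)
      then show "\<bar>dir_deriv 1 \<theta> s * V s + \<theta> s * A s\<bar> \<le> K' * B + K * B" by linarith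
    qed
    note w_int = set_borel_integral_eq_integral[OF this]
    \<comment> \<open>The product rule for \<theta> P, with end values 0 at \<open>T\<close> and
      \<open>\<theta> 0 * V0\<close> at 0, reproduces for \<open>P\<close> the identity that
      \<open>w\<close> states for \<open>V\<close>; the terms with \<open>A\<close> cancel in the
      difference.\<close>
    have "((\<lambda>s. dir_deriv 1 \<theta> s * P s + \<theta> s * A s) has_integral (\<theta> T * P T - \<theta> 0 * P 0)) {0..T}"
    proof (rule fundamental_theorem_of_calculus_interior)
      show "continuous_on {0..T} (\<lambda>s. \<theta> s * P s)"
        by (intro continuous_on_mult \<theta>_cont P_cont)
      fix s assume s: "s \<in> {0<..<T}"
      have "(\<theta> has_real_derivative dir_deriv 1 \<theta> s) (at s)"
        using \<theta>_deriv[of s] dir_deriv_eqI[OF \<theta>_deriv[unfolded has_field_derivative_def], of 1 s] by simp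
      from DERIV_mult[OF this P_deriv[OF s]]
      show "((\<lambda>s. \<theta> s * P s) has_vector_derivative dir_deriv 1 \<theta> s * P s + \<theta> s * A s) (at s)"
        by (simp add: has_real_derivative_iff_has_vector_derivative mult.commute)
    qed (use T in simp)
    moreover have "\<theta> T = 0" using \<theta>_supp[of T] tr by auto
    moreover have "P 0 = V0" by (simp add: P_def)
    ultimately have "((\<lambda>s. dir_deriv 1 \<theta> s * P s + \<theta> s * A s) has_integral - (\<theta> 0 * V0)) {0<..<T}"
      by (simp add: has_integral_Icc_iff_Ioo)
    moreover have "((\<lambda>s. dir_deriv 1 \<theta> s * V s + \<theta> s * A s) has_integral - (\<theta> 0 * V0)) {0<..<T}"
      using w w_int by (simp add: has_integral_iff)
    ultimately have "((\<lambda>s. (dir_deriv 1 \<theta> s * P s + \<theta> s * A s) - (dir_deriv 1 \<theta> s * V s + \<theta> s * A s))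
        has_integral - (\<theta> 0 * V0) - - (\<theta> 0 * V0)) {0<..<T}"
      by (rule has_integral_diff)
    then have "((\<lambda>s. bump r (s - t) * ?D s) has_integral - (\<theta> 0 * V0) - - (\<theta> 0 * V0)) {0<..<T}"
      by (rule has_integral_eq[rotated]) (auto simp: \<theta>' algebra_simps)
    then have "((\<lambda>s. bump r (s - t) * ?D s) has_integral 0) {0<..<T}" by simp
    then show ?thesis by (rule integral_unique)
  qed
  have VP: "V t = P t" if t: "t \<in> {0<..<T}" for t
  proof -
    have "?D t \<le> 0"
      by (rule bump_test_nonpos[OF D_cont t zero[OF t]])
    moreover have "- ?D t \<le> 0"
    proof (rule bump_test_nonpos[OF continuous_on_minus[OF D_cont] t])
      fix r assume "0 < r" "{t - r..t + r} \<subseteq> {0<..<T}"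
      from zero[OF t this] show "integral {0<..<T} (\<lambda>s. bump r (s - t) * - ?D s) = 0"
        by (subst mult_minus_right, subst integral_neg) simp
    qed
    ultimately show ?thesis by simp
  qed
  show "(V has_real_derivative A t) (at t)" if t: "t \<in> {0<..<T}"
  proof -
    have "eventually (\<lambda>s. V s = P s) (nhds t)"
      using eventually_nhds_in_open[OF open_greaterThanLessThan t] by (auto elim!: eventually_mono simp: VP)
    then show ?thesis
      using DERIV_cong_ev[of t t V P "A t" "A t"] P_deriv[OF t] by simp
  qed
  have "(P \<longlongrightarrow> P 0) (at 0 within {0..T})"
    using P_cont T by (auto simp: continuous_on_def)
  then have "(P \<longlongrightarrow> V0) (at_right 0)"
    using T by (simp add: P_def at_within_Icc_at_right)
  moreover have "eventually (\<lambda>s. P s = V s) (at_right 0)"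
    using T eventually_at_right_less[of 0] eventually_at_rightI[of 0 T] VP
    by (auto simp: eventually_at_right_field)
  ultimately show "(V \<longlongrightarrow> V0) (at_right 0)"
    by (rule Lim_transform_eventually)
qed

section \<open>Mollified weak solutions\<close>

lemma dir_deriv_tensor:
  fixes \<eta> :: "'v::euclidean_space \<Rightarrow> real" and \<theta> :: "real \<Rightarrow> real"
  assumes \<theta>: "\<theta> differentiable (at s)" and \<eta>: "\<eta> differentiable (at (x - y))"
  shows "dir_deriv (r, w) (\<lambda>(s, y). \<theta> s * \<eta> (x - y)) (s, y) =
    r * dir_deriv 1 \<theta> s * \<eta> (x - y) - \<theta> s * dir_deriv w \<eta> (x - y)"
proof -
  have 1: "((\<lambda>z. \<theta> (fst z)) has_derivative (\<lambda>d. dir_deriv (fst d) \<theta> s)) (at (s, y))"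
    using has_derivative_compose[OF has_derivative_fst[OF has_derivative_ident]
        differentiable_has_derivative_at[of \<theta> "fst (s, y)"]] \<theta> by simp
  have "((\<lambda>z::real \<times> 'v. x - snd z) has_derivative (\<lambda>d. - snd d)) (at (s, y))"
    by (auto intro!: derivative_eq_intros)
  from has_derivative_compose[OF this, of \<eta> "\<lambda>w. dir_deriv w \<eta> (x - y)"]
  have 2: "((\<lambda>z. \<eta> (x - snd z)) has_derivative (\<lambda>d. dir_deriv (- snd d) \<eta> (x - y))) (at (s, y))"
    using differentiable_has_derivative_at[OF \<eta>] by simp
  have lin: "dir_deriv (- w) \<eta> (x - y) = - dir_deriv w \<eta> (x - y)"
    using linear_neg[OF has_derivative_linear[OF differentiable_has_derivative_at[OF \<eta>]]] .
  have "dir_deriv r \<theta> s = r * dir_deriv 1 \<theta> s"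
    using linear_cmul[OF has_derivative_linear[OF differentiable_has_derivative_at[OF \<theta>]], of r 1]
    by simp
  with lin dir_deriv_eqI[OF has_derivative_mult[OF 1 2], of "(r, w)"]
  show ?thesis by (simp add: case_prod_unfold)
qed

text \<open>\<open>H\<close> stands for \<Xi>(p) p. With the nonlinearity hidden in a second
  function the equation is linear in the pair, and mollification in space preserves it; the coupling
  of the two returns later as a Lipschitz bound.\<close>

locale fp_weak =
  fixes T :: real and p H :: "real \<Rightarrow> real^'n \<Rightarrow> real" and p0 :: "real^'n \<Rightarrow> real"
  assumes T: "0 < T"
    and p_cont: "continuous_on ({0<..<T} \<times> UNIV) (\<lambda>(t, x). p t x)"
    and H_cont: "continuous_on ({0<..<T} \<times> UNIV) (\<lambda>(t, x). H t x)"
    and p_gd: "gauss_dominated {0<..<T} p"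
    and H_gd: "gauss_dominated {0<..<T} H"
    and weak: "\<And>\<phi>. test_function T \<phi> \<Longrightarrow>
      (LINT (t, x):{0<..<T} \<times> UNIV|lborel.
         p t x * (partial_t \<phi> (t, x) + laplace_x \<phi> (t, x)) - H t x * (grad_Phi x \<bullet> grad_x \<phi> (t, x)))
      + (LINT x|lborel. p0 x * \<phi> (0, x)) = 0"
begin

text \<open>Component \<open>i\<close> of H \<nabla>\<Phi>, so that the equation reads p_t =
  \<Delta>p + div drift.\<close>

definition drift :: "'n \<Rightarrow> real \<Rightarrow> real^'n \<Rightarrow> real" where
  "drift i t y = 2 * y $ i * H t y"

text \<open>The mollified right-hand side \<Delta>p + div drift, with every derivative moved to the
  kernel.\<close>

definition rate :: "(real^'n \<Rightarrow> real) \<Rightarrow> real \<Rightarrow> real^'n \<Rightarrow> real" where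
  "rate \<eta> t x = (\<Sum>i\<in>UNIV. conv (dir_deriv (axis i 1) (dir_deriv (axis i 1) \<eta>)) (p t) x
     + conv (dir_deriv (axis i 1) \<eta>) (drift i t) x)"

lemma continuous_on_slice:
  fixes f :: "real \<Rightarrow> real^'n \<Rightarrow> real"
  assumes "continuous_on ({0<..<T} \<times> UNIV) (\<lambda>(t, x). f t x)"
  shows "t \<in> {0<..<T} \<Longrightarrow> continuous_on UNIV (f t)" "continuous_on {0<..<T} (\<lambda>t. f t x)"
proof -
  have 1: "continuous_on UNIV (\<lambda>x::real^'n. (t, x))" and 2: "continuous_on {0<..<T} (\<lambda>t. (t, x))"
    by (intro continuous_intros)+
  show "t \<in> {0<..<T} \<Longrightarrow> continuous_on UNIV (f t)"
    using continuous_on_compose2[OF assms 1] by (auto simp: image_subset_iff)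
  show "continuous_on {0<..<T} (\<lambda>t. f t x)"
    using continuous_on_compose2[OF assms 2] by auto
qed

lemma p_measurable: "t \<in> {0<..<T} \<Longrightarrow> p t \<in> borel_measurable borel"
  by (rule borel_measurable_continuous_onI[OF continuous_on_slice(1)[OF p_cont]])

lemma drift_cont: "continuous_on ({0<..<T} \<times> UNIV) (\<lambda>(t, x). drift i t x)"
  using H_cont unfolding drift_def case_prod_unfold
  by (intro continuous_intros)

lemma drift_measurable: "t \<in> {0<..<T} \<Longrightarrow> drift i t \<in> borel_measurable borel"
  by (rule borel_measurable_continuous_onI[OF continuous_on_slice(1)[OF drift_cont]])

lemma drift_gd: "gauss_dominated {0<..<T} (drift i)"
  by (rule gauss_dominated_bound[OF gauss_dominated_norm_mult[OF H_gd], of _ 2])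
     (auto simp: drift_def abs_mult component_le_norm_cart mult_right_mono)

text \<open>The weak equation is tested with \<theta>(s) \<eta>(x - y) for fixed x. Each derivative
  in y brings a minus sign, which leaves the Laplacian unchanged and turns the drift term into a
  divergence; Fubini does the rest.\<close>

lemma weak_conv:
  fixes \<theta> :: "real \<Rightarrow> real"
  assumes \<eta>: "smooth_kernel \<eta>" and \<theta>: "\<And>k. Ck k \<theta>" "b < T" "\<And>s. s \<notin> {a..b} \<Longrightarrow> \<theta> s = 0"
  shows "(LINT s:{0<..<T}|lborel. dir_deriv 1 \<theta> s * conv \<eta> (p s) x + \<theta> s * rate \<eta> s x)
    + \<theta> 0 * conv \<eta> p0 x = 0"
proof -
  let ?e = "\<lambda>i::'n. axis i (1::real)"
  define \<phi> :: "real \<times> (real^'n) \<Rightarrow> real" where "\<phi> = (\<lambda>(s, y). \<theta> s * \<eta> (x - y))"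
  have \<theta>_diff: "\<theta> differentiable (at s)" for s
    using \<theta>(1)[of "Suc 0"] by simp
  note \<eta>' = smooth_kernel_dir_deriv[OF \<eta>]
  note \<eta>'' = smooth_kernel_dir_deriv[OF \<eta>']
  have \<theta>_cont: "continuous_on S \<theta>" "continuous_on S (dir_deriv 1 \<theta>)" for S
  proof -
    have "continuous_on UNIV \<theta>" "continuous_on UNIV (dir_deriv 1 \<theta>)"
      using \<theta>(1)[of 0] \<theta>(1)[of "Suc 0"] by auto
    then show "continuous_on S \<theta>" "continuous_on S (dir_deriv 1 \<theta>)"
      by (auto intro: continuous_on_subset)
  qed
  have test: "test_function T \<phi>"
    unfolding test_function_def
  proof (intro conjI allI)
    show "Ck k \<phi>" for k
    proof -
      have "Ck k (\<lambda>z::real \<times> (real^'n). \<theta> (0 + fst z) * \<eta> (x + - snd z))"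
        using \<eta> by (intro Ck_mult Ck_compose_affine bounded_linear_fst bounded_linear_minus
            bounded_linear_snd \<theta>) (auto simp: smooth_kernel_def)
      then show ?thesis by (simp add: \<phi>_def case_prod_unfold)
    qed
    have "{z. \<phi> z \<noteq> 0} \<subseteq> {a..b} \<times> cball x 1"
      using \<theta>(3) \<eta> by (force simp: \<phi>_def smooth_kernel_def dist_norm)
    then have sub: "closure {z. \<phi> z \<noteq> 0} \<subseteq> {a..b} \<times> cball x 1"
      by (intro closure_minimal closed_Times) auto
    show "compact (closure {z. \<phi> z \<noteq> 0})"
      using compact_Int_closed[of "{a..b} \<times> cball x 1" "closure {z. \<phi> z \<noteq> 0}"] sub
      by (simp add: compact_Times Int_absorb1)
    show "closure {z. \<phi> z \<noteq> 0} \<subseteq> {..<T} \<times> UNIV"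
      using sub \<theta>(2) by auto
  qed
  have \<phi>_t: "partial_t \<phi> (s, y) = dir_deriv 1 \<theta> s * \<eta> (x - y)" for s y
    unfolding partial_t_def \<phi>_def
    by (subst dir_deriv_tensor[OF \<theta>_diff smooth_kernel_differentiable[OF \<eta>]])
      (simp add: linear_0[OF has_derivative_linear[OF differentiable_has_derivative_at[OF smooth_kernel_differentiable[OF \<eta>]]]])
  have \<phi>_x: "partial_x i (\<lambda>(s, y). \<theta> s * \<zeta> (x - y)) (s, y) = - \<theta> s * dir_deriv (?e i) \<zeta> (x - y)"
    if "smooth_kernel \<zeta>" for i s y and \<zeta> :: "real^'n \<Rightarrow> real"
    unfolding partial_x_def
    by (subst dir_deriv_tensor[OF \<theta>_diff smooth_kernel_differentiable[OF that]]) simp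
  have \<phi>_xx: "partial_x i (partial_x i \<phi>) (s, y) = \<theta> s * dir_deriv (?e i) (dir_deriv (?e i) \<eta>) (x - y)" for i s y
  proof -
    have eq: "partial_x i \<phi> = (\<lambda>(s, y). - \<theta> s * dir_deriv (?e i) \<eta> (x - y))"
      unfolding \<phi>_def using \<phi>_x[OF \<eta>] by auto
    have "(\<lambda>s. - \<theta> s) differentiable (at s)" for s using \<theta>_diff by simp
    note tensor = dir_deriv_tensor[OF this smooth_kernel_differentiable[OF \<eta>'[of "?e i"]], where r = 0 and w = "?e i" and x = x and s = s and y = y]
    have "partial_x i (partial_x i \<phi>) (s, y) =
        dir_deriv (0, ?e i) (\<lambda>(s, y). - \<theta> s * dir_deriv (?e i) \<eta> (x - y)) (s, y)"
      unfolding eq unfolding partial_x_def ..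
    with tensor show ?thesis by simp
  qed
  define M where "M s y = p s y * \<eta> (x - y)" for s y
  define N where "N s y = (\<Sum>i\<in>UNIV. p s y * dir_deriv (?e i) (dir_deriv (?e i) \<eta>) (x - y)
      + drift i s y * dir_deriv (?e i) \<eta> (x - y))" for s y
  define F where "F s y = dir_deriv 1 \<theta> s * M s y + \<theta> s * N s y" for s y
  have F_eq: "p s y * (partial_t \<phi> (s, y) + laplace_x \<phi> (s, y)) - H s y * (grad_Phi y \<bullet> grad_x \<phi> (s, y))
      = F s y" for s y
  proof -
    have "grad_Phi y \<bullet> grad_x \<phi> (s, y) = (\<Sum>i\<in>UNIV. 2 * y $ i * (- \<theta> s * dir_deriv (?e i) \<eta> (x - y)))"
      using \<phi>_x[OF \<eta>] by (simp add: grad_Phi_def grad_x_def inner_vec_def \<phi>_def)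
    then show ?thesis
      by (simp add: F_def M_def N_def \<phi>_t laplace_x_def \<phi>_xx drift_def sum.distrib sum_distrib_left
          sum_negf algebra_simps)
  qed
  have gdk: "gauss_dominated {0<..<T} (\<lambda>s y. f s y * \<zeta> (x - y))"
    if "smooth_kernel \<zeta>" "gauss_dominated {0<..<T} f" for f \<zeta>
    using gauss_dominated_reindex[OF gauss_dominated_mult_kernel[OF that], of "{0<..<T}" "\<lambda>s. (s, x)"] by simp
  have contk: "continuous_on ({0<..<T} \<times> UNIV) (\<lambda>(s, y). f s y * \<zeta> (x - y))"
    if "smooth_kernel \<zeta>" "continuous_on ({0<..<T} \<times> UNIV) (\<lambda>(t, x). f t x)" for f \<zeta>
    using that(2) unfolding case_prod_unfold
    by (intro continuous_on_mult continuous_on_compose2[OF smooth_kernel_continuous[OF that(1)]])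
      (auto intro!: continuous_intros)
  have bdd: "\<exists>K. \<forall>s\<in>{0<..<T}. \<bar>f s\<bar> \<le> K" if "continuous_on {0..T} f" for f :: "real \<Rightarrow> real"
    using compact_imp_bounded[OF compact_continuous_image[OF that compact_Icc]]
    by (force simp: bounded_iff)
  obtain K where K: "\<And>s. s \<in> {0<..<T} \<Longrightarrow> \<bar>\<theta> s\<bar> \<le> K" using bdd[OF \<theta>_cont(1)] by blast
  obtain K' where K': "\<And>s. s \<in> {0<..<T} \<Longrightarrow> \<bar>dir_deriv 1 \<theta> s\<bar> \<le> K'" using bdd[OF \<theta>_cont(2)] by blast
  have N_gd: "gauss_dominated {0<..<T} N"
    unfolding N_def[abs_def]
    by (intro gauss_dominated_sum gauss_dominated_add gdk \<eta>' \<eta>'' p_gd drift_gd) simp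
  have F_gd: "gauss_dominated {0<..<T} F"
    unfolding F_def[abs_def]
  proof (rule gauss_dominated_add)
    show "gauss_dominated {0<..<T} (\<lambda>s y. dir_deriv 1 \<theta> s * M s y)"
      unfolding M_def using K' by (intro gauss_dominated_mult_bounded(1) gdk \<eta> p_gd)
    show "gauss_dominated {0<..<T} (\<lambda>s y. \<theta> s * N s y)"
      using K by (intro gauss_dominated_mult_bounded(1) N_gd)
  qed
  have F_cont: "continuous_on ({0<..<T} \<times> UNIV) (\<lambda>z. F (fst z) (snd z))"
  proof -
    have M_cont: "continuous_on ({0<..<T} \<times> UNIV) (\<lambda>z. M (fst z) (snd z))"
      using contk[OF \<eta> p_cont] by (simp add: M_def case_prod_unfold)
    have N_cont: "continuous_on ({0<..<T} \<times> UNIV) (\<lambda>z. N (fst z) (snd z))"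
      unfolding N_def
      by (intro continuous_on_sum continuous_on_add
          contk[OF \<eta>'' p_cont, unfolded case_prod_unfold] contk[OF \<eta>' drift_cont, unfolded case_prod_unfold])
    have \<theta>_fst: "continuous_on ({0<..<T} \<times> (UNIV :: (real^'n) set)) (\<lambda>z. \<theta> (fst z))"
      "continuous_on ({0<..<T} \<times> (UNIV :: (real^'n) set)) (\<lambda>z. dir_deriv 1 \<theta> (fst z))"
      by (rule continuous_on_compose2[OF \<theta>_cont(1)[of UNIV]], auto intro!: continuous_intros)
        (rule continuous_on_compose2[OF \<theta>_cont(2)[of UNIV]], auto intro!: continuous_intros)
    show ?thesis
      unfolding F_def by (intro continuous_on_add continuous_on_mult M_cont N_cont \<theta>_fst)
  qed
  define I where "I z = indicat_real ({0<..<T} \<times> UNIV) z *\<^sub>R F (fst z) (snd z)" for z :: "real \<times> (real^'n)"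
  have I_int: "integrable lborel I"
  proof (rule gauss_dominated_integrable[of "UNIV :: unit set" "\<lambda>_. I" "()"])
    show "I \<in> borel_measurable lborel"
      unfolding I_def[abs_def]
      using borel_measurable_continuous_on_indicator[OF _ F_cont] by (simp add: borel_open open_Times)
    obtain C \<delta> where C: "0 < \<delta>" "0 \<le> C"
      "\<And>s y. s \<in> {0<..<T} \<Longrightarrow> \<bar>F s y\<bar> \<le> C * exp (- \<delta> * (norm y)\<^sup>2)"
      using F_gd by (rule gauss_dominatedE) blast
    \<comment> \<open>Domination is wanted on space-time: for 0 < s < T the missing factor
      exp(-\<delta> s^2) costs at most exp(\<delta> T^2).\<close>
    show "gauss_dominated (UNIV :: unit set) (\<lambda>_. I)"
    proof (rule gauss_dominatedI[OF C(1), of _ _ "C * exp (\<delta> * T\<^sup>2)"])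
      fix z :: "real \<times> (real^'n)"
      obtain s y where z: "z = (s, y)" by (cases z)
      show "\<bar>I z\<bar> \<le> C * exp (\<delta> * T\<^sup>2) * exp (- \<delta> * (norm z)\<^sup>2)"
      proof (cases "s \<in> {0<..<T}")
        case True
        have "s\<^sup>2 \<le> T\<^sup>2" using True by (intro power_mono) auto
        then have "\<delta> * s\<^sup>2 \<le> \<delta> * T\<^sup>2" using C(1) by simp
        moreover have "(norm z)\<^sup>2 = s\<^sup>2 + (norm y)\<^sup>2" by (simp add: z norm_Pair)
        ultimately have "C * exp (- \<delta> * (norm y)\<^sup>2) \<le> C * (exp (\<delta> * T\<^sup>2) * exp (- \<delta> * (norm z)\<^sup>2))"
          using C(2) by (intro mult_left_mono) (simp_all add: exp_add[symmetric] algebra_simps)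
        with C(3)[OF True, of y] True show ?thesis by (simp add: I_def z mult.assoc)
      qed (use C(2) in \<open>auto simp: I_def z\<close>)
    qed
  qed simp
  have inner: "(\<integral>y. I (s, y) \<partial>lborel) = indicat_real {0<..<T} s *\<^sub>R
      (dir_deriv 1 \<theta> s * conv \<eta> (p s) x + \<theta> s * rate \<eta> s x)" for s
  proof (cases "s \<in> {0<..<T}")
    case s: True
    have intM: "integrable lborel (M s)"
      unfolding M_def by (rule conv_integrable[OF \<eta> p_gd s p_measurable[OF s]])
    note i1 = conv_integrable[OF \<eta>'' p_gd s p_measurable[OF s]]
      and i2 = conv_integrable[OF \<eta>' drift_gd s drift_measurable[OF s]]
    have intN: "integrable lborel (N s)"
      unfolding N_def by (intro Bochner_Integration.integrable_sum Bochner_Integration.integrable_add i1 i2)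
    have "(\<integral>y. N s y \<partial>lborel) = rate \<eta> s x"
      unfolding N_def rate_def conv_def
      by (subst Bochner_Integration.integral_sum, intro Bochner_Integration.integrable_add i1 i2,
          subst Bochner_Integration.integral_add, rule i1, rule i2, rule refl)
    moreover have "(\<integral>y. M s y \<partial>lborel) = conv \<eta> (p s) x" by (simp add: M_def conv_def)
    moreover have "I (s, y) = F s y" for y using s by (simp add: I_def)
    ultimately show ?thesis
      using s intM intN by (simp add: F_def)
  qed (simp add: I_def)
  have "(LINT (t, x):{0<..<T} \<times> UNIV|lborel.
         p t x * (partial_t \<phi> (t, x) + laplace_x \<phi> (t, x)) - H t x * (grad_Phi x \<bullet> grad_x \<phi> (t, x)))
      = (\<integral>z. I z \<partial>(lborel \<Otimes>\<^sub>M lborel))"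
    unfolding set_lebesgue_integral_def I_def lborel_prod
    by (intro Bochner_Integration.integral_cong) (auto simp: F_eq)
  also have "\<dots> = (\<integral>s. (\<integral>y. I (s, y) \<partial>lborel) \<partial>lborel)"
    using I_int by (intro lborel_pair.integral_fst'[symmetric]) (simp add: lborel_prod)
  also have "\<dots> = (LINT s:{0<..<T}|lborel. dir_deriv 1 \<theta> s * conv \<eta> (p s) x + \<theta> s * rate \<eta> s x)"
    unfolding inner set_lebesgue_integral_def ..
  finally have "(LINT s:{0<..<T}|lborel. dir_deriv 1 \<theta> s * conv \<eta> (p s) x + \<theta> s * rate \<eta> s x)
      + (LINT y|lborel. p0 y * \<phi> (0, y)) = 0"
    using weak[OF test] by simp
  moreover have "(LINT y|lborel. p0 y * \<phi> (0, y)) = \<theta> 0 * conv \<eta> p0 x"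
    by (simp add: \<phi>_def conv_def mult.left_commute)
  ultimately show ?thesis by simp
qed

lemma conv_gd:
  assumes "smooth_kernel \<eta>" "gauss_dominated {0<..<T} f" "\<And>t. t \<in> {0<..<T} \<Longrightarrow> f t \<in> borel_measurable borel"
  shows "gauss_dominated {0<..<T} (\<lambda>t. conv \<eta> (f t))"
  using gauss_dominated_reindex[OF gauss_dominated_conv[of "UNIV :: unit set" "\<lambda>_. \<eta>", OF _ order_refl assms(2,3)],
      of "{0<..<T}" "\<lambda>t. ((), t)"] assms(1)
  by simp

lemma rate_gd:
  assumes "smooth_kernel \<eta>"
  shows "gauss_dominated {0<..<T} (rate \<eta>)"
  unfolding rate_def[abs_def]
  by (intro gauss_dominated_sum gauss_dominated_add conv_gd smooth_kernel_dir_deriv assms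
      p_gd drift_gd p_measurable drift_measurable) simp_all

lemma rate_continuous_on_time:
  assumes "smooth_kernel \<eta>"
  shows "continuous_on {0<..<T} (\<lambda>t. rate \<eta> t x)"
  unfolding rate_def
  by (intro continuous_on_sum continuous_on_add conv_continuous_on_param smooth_kernel_dir_deriv assms
      p_gd drift_gd p_measurable drift_measurable continuous_on_slice(2) p_cont drift_cont)

text \<open>For each fixed x the mollified density is a classical solution in time and attains the
  mollified initial value, although for \<open>p\<close> only the weak equation is assumed.\<close>

lemma
  assumes "smooth_kernel \<eta>"
  shows conv_time_derivative:
      "t \<in> {0<..<T} \<Longrightarrow> ((\<lambda>t. conv \<eta> (p t) x) has_real_derivative rate \<eta> t x) (at t)"
    and conv_initial: "((\<lambda>t. conv \<eta> (p t) x) \<longlongrightarrow> conv \<eta> p0 x) (at_right 0)"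
proof -
  obtain B1 where B1: "\<And>t. t \<in> {0<..<T} \<Longrightarrow> \<bar>conv \<eta> (p t) x\<bar> \<le> B1"
    using gauss_dominated_bounded[OF conv_gd[OF assms p_gd p_measurable]] by metis
  obtain B2 where B2: "\<And>t. t \<in> {0<..<T} \<Longrightarrow> \<bar>rate \<eta> t x\<bar> \<le> B2"
    using gauss_dominated_bounded[OF rate_gd[OF assms]] by metis
  have "continuous_on {0<..<T} (\<lambda>t. conv \<eta> (p t) x)"
    by (intro conv_continuous_on_param assms p_gd p_measurable continuous_on_slice(2) p_cont)
  note * = weak_time_derivative[OF T this _ rate_continuous_on_time[OF assms] _ weak_conv[OF assms],
      where B = "max B1 B2"]
  show "t \<in> {0<..<T} \<Longrightarrow> ((\<lambda>t. conv \<eta> (p t) x) has_real_derivative rate \<eta> t x) (at t)"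
    using B1 B2 by (intro *(1)) (auto simp: le_max_iff_disj)
  show "((\<lambda>t. conv \<eta> (p t) x) \<longlongrightarrow> conv \<eta> p0 x) (at_right 0)"
    using B1 B2 by (intro *(2)) (auto simp: le_max_iff_disj)
qed

end

section \<open>The energy inequality\<close>

lemma max0_power_has_derivative:
  fixes r :: real
  assumes "2 \<le> k"
  shows "((\<lambda>r. max 0 r ^ k) has_real_derivative real k * max 0 r ^ (k - 1)) (at r)"
proof (cases "r = 0")
  case False
  consider "0 < r" | "r < 0" using False by linarith
  then show ?thesis
  proof cases
    case 1
    have "((\<lambda>r. r ^ k) has_real_derivative real k * max 0 r ^ (k - 1)) (at r)"
      using 1 by (auto intro!: derivative_eq_intros)
    moreover have "eventually (\<lambda>s. max 0 s ^ k = s ^ k) (nhds r)"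
      using eventually_nhds_in_open[of "{0<..}" r] 1 by (auto elim!: eventually_mono)
    ultimately show ?thesis using DERIV_cong_ev by fastforce
  next
    case 2
    have zero: "real k * max 0 r ^ (k - 1) = 0" using 2 assms by (simp add: zero_power)
    have "((\<lambda>r. 0) has_real_derivative real k * max 0 r ^ (k - 1)) (at r)"
      unfolding zero by simp
    moreover have "eventually (\<lambda>s. max 0 s ^ k = 0) (nhds r)"
      using eventually_nhds_in_open[of "{..<0}" r] 2 assms by (auto elim!: eventually_mono)
    ultimately show ?thesis by (subst DERIV_cong_ev[OF refl _ refl]) 
  qed
next
  case True
  define m where "m = k - 2"
  have k: "k = Suc (Suc m)" using assms by (simp add: m_def)
  \<comment> \<open>The difference quotient at 0 is \<open>max 0 h ^ (k - 1)\<close> times a factor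
    that is 0 or 1.\<close>
  have "((\<lambda>h. max 0 h ^ Suc m * (max 0 h / h)) \<longlongrightarrow> 0) (at (0::real))"
  proof (rule Lim_null_comparison)
    show "eventually (\<lambda>h. norm (max 0 h ^ Suc m * (max 0 h / h)) \<le> max 0 h ^ Suc m) (at (0::real))"
      by (rule always_eventually) (auto simp: abs_mult max_def)
    have "((\<lambda>h. max 0 h ^ Suc m) \<longlongrightarrow> max 0 0 ^ Suc m) (at (0::real))"
      by (intro tendsto_intros)
    then show "((\<lambda>h. max 0 h ^ Suc m) \<longlongrightarrow> 0) (at (0::real))" by simp
  qed
  then show ?thesis
    using True by (simp add: DERIV_def k mult.assoc mult.commute[of "max 0 _ ^ m"])
qed

lemma max0_square_has_derivative:
  "((\<lambda>r. 3 * max 0 r ^ 2) has_real_derivative 6 * max 0 r) (at (r::real))"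
  using DERIV_cmult[OF max0_power_has_derivative[of 2 r], of 3] by simp

lemma max0_cube_has_derivative:
  "((\<lambda>r. max 0 r ^ 3) has_real_derivative 3 * max 0 r ^ 2) (at (r::real))"
  using max0_power_has_derivative[of 3 r] by simp

text \<open>\<open>q_partial\<close> says that the flux of the comparison function vanishes in every
  direction, which is stronger than stationarity; thus no second derivative of \<open>q\<close> has
  to appear.\<close>

locale fp_comparison = fp_weak T p H p0
  for T :: real and p H :: "real \<Rightarrow> real^'n \<Rightarrow> real" and p0 :: "real^'n \<Rightarrow> real" +
  fixes q Hq :: "real^'n \<Rightarrow> real" and \<Lambda> :: real
  assumes q_cont: "continuous_on UNIV q" and Hq_cont: "continuous_on UNIV Hq"
    and q_gd: "gauss_dominated (UNIV :: unit set) (\<lambda>_. q)"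
    and Hq_gd: "gauss_dominated (UNIV :: unit set) (\<lambda>_. Hq)"
    and q_partial: "\<And>i. has_partial q (axis i 1) (\<lambda>x. - (2 * x $ i * Hq x))"
    and p0_measurable: "p0 \<in> borel_measurable borel"
    and p0_le: "\<And>x. 0 \<le> p0 x \<and> p0 x \<le> q x"
    and lip: "\<And>t x. t \<in> {0<..<T} \<Longrightarrow> \<bar>H t x - Hq x\<bar> \<le> \<Lambda> * \<bar>p t x - q x\<bar>"
begin

definition w :: "real \<Rightarrow> real^'n \<Rightarrow> real" where
  "w t x = p t x - q x"

definition g :: "'n \<Rightarrow> real \<Rightarrow> real^'n \<Rightarrow> real" where
  "g i t x = drift i t x - 2 * x $ i * Hq x"

lemma q_measurable: "q \<in> borel_measurable borel"
  by (rule borel_measurable_continuous_onI[OF q_cont])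

lemma q_drift_cont: "continuous_on UNIV (\<lambda>x. 2 * x $ i * Hq x)"
  by (intro continuous_intros Hq_cont)

lemma q_drift_measurable: "(\<lambda>x. 2 * x $ i * Hq x) \<in> borel_measurable borel"
  by (rule borel_measurable_continuous_onI[OF q_drift_cont])

lemma q_drift_gd: "gauss_dominated (UNIV :: unit set) (\<lambda>_ x. 2 * x $ i * Hq x)"
  by (rule gauss_dominated_bound[OF gauss_dominated_norm_mult[OF Hq_gd], of _ 2])
     (auto simp: abs_mult component_le_norm_cart mult_right_mono)

lemma const_gd:
  assumes "gauss_dominated (UNIV :: unit set) (\<lambda>_. f)"
  shows "gauss_dominated S (\<lambda>_. f)"
  using gauss_dominated_reindex[OF assms, of S "\<lambda>_. ()"] by simp

lemma w_gd: "gauss_dominated {0<..<T} w"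
  unfolding w_def[abs_def] by (rule gauss_dominated_diff[OF p_gd const_gd[OF q_gd]])

lemma g_gd: "gauss_dominated {0<..<T} (g i)"
  unfolding g_def[abs_def] by (rule gauss_dominated_diff[OF drift_gd const_gd[OF q_drift_gd]])

lemma w_measurable: "t \<in> {0<..<T} \<Longrightarrow> w t \<in> borel_measurable borel"
  unfolding w_def[abs_def] by (intro borel_measurable_diff p_measurable q_measurable)

lemma g_measurable: "t \<in> {0<..<T} \<Longrightarrow> g i t \<in> borel_measurable borel"
  unfolding g_def[abs_def] by (intro borel_measurable_diff drift_measurable q_drift_measurable)

lemma w_cont: "t \<in> {0<..<T} \<Longrightarrow> continuous_on UNIV (w t)" "continuous_on {0<..<T} (\<lambda>t. w t x)"
  unfolding w_def
  by (intro continuous_on_diff q_cont continuous_on_const continuous_on_slice p_cont; assumption)+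

lemma g_cont: "t \<in> {0<..<T} \<Longrightarrow> continuous_on UNIV (g i t)" "continuous_on {0<..<T} (\<lambda>t. g i t x)"
  unfolding g_def
  by (intro continuous_on_diff q_drift_cont continuous_on_const continuous_on_slice drift_cont; assumption)+

definition energy :: "(real^'n \<Rightarrow> real) \<Rightarrow> real \<Rightarrow> real" where
  "energy \<eta> t = (\<integral>x. max 0 (conv \<eta> (w t) x) ^ 3 \<partial>lborel)"

text \<open>Not the derivative of \<open>energy\<close> but the bound that remains after completing
  the square. It contains only undifferentiated kernels, hence has a limit when the kernel shrinks
  to a point.\<close>

definition production :: "(real^'n \<Rightarrow> real) \<Rightarrow> real \<Rightarrow> real" where
  "production \<eta> t =
     (\<integral>x. 3 / 2 * max 0 (conv \<eta> (w t) x) * (\<Sum>i\<in>UNIV. (conv \<eta> (g i t) x)\<^sup>2) \<partial>lborel)"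

lemma max0_gd:
  "gauss_dominated S f \<Longrightarrow> gauss_dominated S (\<lambda>i x. max 0 (f i x))"
  by (rule gauss_dominated_bound[of S f _ 1]) auto

context
  fixes \<eta> :: "real^'n \<Rightarrow> real"
  assumes \<eta>: "smooth_kernel \<eta>"
begin

private abbreviation e :: "'n \<Rightarrow> real^'n" where "e i \<equiv> axis i 1"
private abbreviation v :: "real \<Rightarrow> real^'n \<Rightarrow> real" where "v t \<equiv> conv \<eta> (w t)"
private abbreviation vi :: "'n \<Rightarrow> real \<Rightarrow> real^'n \<Rightarrow> real" where
  "vi i t \<equiv> conv (dir_deriv (e i) \<eta>) (w t)"
text \<open>The flux of the mollified \<open>p\<close> in direction \<open>i\<close>;
  \<open>Ji\<close> is its derivative in that direction, and \<open>rate\<close> is the sum of the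
  \<open>Ji\<close>.\<close>

private abbreviation J :: "'n \<Rightarrow> real \<Rightarrow> real^'n \<Rightarrow> real" where
  "J i t \<equiv> \<lambda>x. conv (dir_deriv (e i) \<eta>) (p t) x + conv \<eta> (drift i t) x"
private abbreviation Ji :: "'n \<Rightarrow> real \<Rightarrow> real^'n \<Rightarrow> real" where
  "Ji i t \<equiv> \<lambda>x. conv (dir_deriv (e i) (dir_deriv (e i) \<eta>)) (p t) x + conv (dir_deriv (e i) \<eta>) (drift i t) x"

lemma conv_w_eq:
  assumes "smooth_kernel \<zeta>" "t \<in> {0<..<T}"
  shows "conv \<zeta> (w t) x = conv \<zeta> (p t) x - conv \<zeta> q x"
  unfolding w_def[abs_def]
  by (rule conv_diff[OF assms(1) p_gd assms(2) p_measurable[OF assms(2)] q_gd UNIV_I q_measurable])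

text \<open>The flux of \<open>q\<close> stays zero under mollification, since the derivative of
  \<open>q\<close> can be moved to the kernel. Subtracting it replaces \<open>p\<close> by
  \<open>w\<close> and the drift by \<open>g\<close>.\<close>

lemma flux_eq:
  assumes t: "t \<in> {0<..<T}"
  shows "J i t x = vi i t x + conv \<eta> (g i t) x"
proof -
  have "conv \<eta> (g i t) x = conv \<eta> (drift i t) x - conv \<eta> (\<lambda>x. 2 * x $ i * Hq x) x"
    unfolding g_def[abs_def]
    by (rule conv_diff[OF \<eta> drift_gd t drift_measurable[OF t] q_drift_gd UNIV_I q_drift_measurable])
  moreover have "conv \<eta> (\<lambda>x. - (2 * x $ i * Hq x)) x = conv (dir_deriv (e i) \<eta>) q x"
  proof (rule conv_partial_commute[OF \<eta> _ q_partial q_measurable _ q_gd])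
    show "(\<lambda>x. - (2 * x $ i * Hq x)) \<in> borel_measurable borel"
      using q_drift_measurable by measurable
    show "gauss_dominated (UNIV :: unit set) (\<lambda>_ x. - (2 * x $ i * Hq x))"
      using gauss_dominated_cmult[OF q_drift_gd[of i], of "- 1"] by simp
  qed simp
  moreover have "conv \<eta> (\<lambda>x. - (2 * x $ i * Hq x)) x = - conv \<eta> (\<lambda>x. 2 * x $ i * Hq x) x"
    by (simp add: conv_def)
  ultimately show ?thesis
    using conv_w_eq[OF smooth_kernel_dir_deriv[OF \<eta>, of "e i"] t, of x] by simp
qed

lemma conv_slice_measurable:
  assumes "smooth_kernel \<zeta>" "gauss_dominated {0<..<T} f" "\<And>t. t \<in> {0<..<T} \<Longrightarrow> f t \<in> borel_measurable borel"
    "t \<in> {0<..<T}"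
  shows "conv \<zeta> (f t) \<in> borel_measurable borel"
  by (rule borel_measurable_continuous_onI[OF conv_continuous_on[OF assms(1,2,4) assms(3)[OF assms(4)]]])

lemma energy_derivative:
  assumes t: "t \<in> {0<..<T}"
  shows "(energy \<eta> has_real_derivative (\<integral>x. 3 * max 0 (v t x) ^ 2 * rate \<eta> t x \<partial>lborel)) (at t)"
  unfolding energy_def[abs_def]
proof (rule has_real_derivative_integral_gauss_dominated[OF open_greaterThanLessThan t])
  note v_gd = conv_gd[OF \<eta> w_gd w_measurable]
  show "gauss_dominated {0<..<T} (\<lambda>t x. max 0 (v t x) ^ 3)"
    by (intro gauss_dominated_power max0_gd v_gd) auto
  show "gauss_dominated {0<..<T} (\<lambda>t x. 3 * max 0 (v t x) ^ 2 * rate \<eta> t x)"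
    by (intro gauss_dominated_mult gauss_dominated_cmult gauss_dominated_power max0_gd v_gd rate_gd \<eta>) auto
  show "(\<lambda>x. max 0 (v s x) ^ 3) \<in> borel_measurable lborel" if "s \<in> {0<..<T}" for s
    using conv_slice_measurable[OF \<eta> w_gd w_measurable that] by measurable
  fix s x assume s: "s \<in> {0<..<T}"
  have "((\<lambda>s. conv \<eta> (p s) x - conv \<eta> q x) has_real_derivative rate \<eta> s x) (at s)"
    using conv_time_derivative[OF \<eta> s, of x] by (auto intro!: derivative_eq_intros)
  moreover have "eventually (\<lambda>s. v s x = conv \<eta> (p s) x - conv \<eta> q x) (nhds s)"
    using eventually_nhds_in_open[OF open_greaterThanLessThan s]
    by (rule eventually_mono) (rule conv_w_eq[OF \<eta>])
  ultimately have "((\<lambda>s. v s x) has_real_derivative rate \<eta> s x) (at s)"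
    using DERIV_cong_ev[OF refl, of "\<lambda>s. v s x" "\<lambda>s. conv \<eta> (p s) x - conv \<eta> q x" s "rate \<eta> s x" "rate \<eta> s x"]
    by simp
  from DERIV_chain2[where f = "\<lambda>r. max 0 r ^ 3" and g = "\<lambda>s. v s x", OF max0_cube_has_derivative this]
  show "((\<lambda>s. max 0 (v s x) ^ 3) has_real_derivative 3 * max 0 (v s x) ^ 2 * rate \<eta> s x) (at s)" .
qed

lemma production_gd:
  "gauss_dominated {0<..<T} (\<lambda>t x. 3 / 2 * max 0 (v t x) * (\<Sum>i\<in>UNIV. (conv \<eta> (g i t) x)\<^sup>2))"
  by (intro gauss_dominated_mult gauss_dominated_cmult gauss_dominated_sum gauss_dominated_power max0_gd
      conv_gd \<eta> w_gd w_measurable g_gd g_measurable) auto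

lemma production_measurable:
  assumes t: "t \<in> {0<..<T}"
  shows "(\<lambda>x. 3 / 2 * max 0 (v t x) * (\<Sum>i\<in>UNIV. (conv \<eta> (g i t) x)\<^sup>2)) \<in> borel_measurable lborel"
  unfolding measurable_lborel2
  using conv_slice_measurable[OF \<eta> w_gd w_measurable t] conv_slice_measurable[OF \<eta> g_gd g_measurable t]
  by (intro borel_measurable_times borel_measurable_sum borel_measurable_power borel_measurable_max
      borel_measurable_const)

text \<open>Integration by parts turns the time derivative into \<open>- \<Sum>i. \<integral> 6 max 0 v * vi * (vi + gi)\<close>;
  completing the square removes the derivatives \<open>vi\<close> altogether.\<close>

lemma energy_derivative_le_production:
  assumes t: "t \<in> {0<..<T}"
  shows "(\<integral>x. 3 * max 0 (v t x) ^ 2 * rate \<eta> t x \<partial>lborel) \<le> production \<eta> t"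
proof -
  let ?a = "\<lambda>i x. 6 * max 0 (v t x) * vi i t x * J i t x"
  let ?b = "\<lambda>i x. 3 * max 0 (v t x) ^ 2 * Ji i t x"
  note k1 = smooth_kernel_dir_deriv[OF \<eta>] and k2 = smooth_kernel_dir_deriv[OF smooth_kernel_dir_deriv[OF \<eta>]]
  note pm = conv_slice_measurable[OF _ p_gd p_measurable t]
    and dm = conv_slice_measurable[OF _ drift_gd drift_measurable t]
    and wm = conv_slice_measurable[OF _ w_gd w_measurable t]
  note [measurable] = pm[OF k1] pm[OF k2] dm[OF \<eta>] dm[OF k1] wm[OF \<eta>] wm[OF k1]
  note gds = gauss_dominated_mult gauss_dominated_add gauss_dominated_cmult gauss_dominated_power max0_gd
    conv_gd[OF k1 p_gd p_measurable] conv_gd[OF k2 p_gd p_measurable] conv_gd[OF \<eta> drift_gd drift_measurable]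
    conv_gd[OF k1 drift_gd drift_measurable] conv_gd[OF \<eta> w_gd w_measurable] conv_gd[OF k1 w_gd w_measurable]
  have slice: "gauss_dominated (UNIV :: unit set) (\<lambda>_. f t)" if "gauss_dominated {0<..<T} f"
    for f :: "real \<Rightarrow> real^'n \<Rightarrow> real"
    using gauss_dominated_reindex[OF that, of UNIV "\<lambda>_. t"] t by simp
  have a_gd: "gauss_dominated (UNIV :: unit set) (\<lambda>_. ?a i)"
    and b_gd: "gauss_dominated (UNIV :: unit set) (\<lambda>_. ?b i)"
    and f_gd: "gauss_dominated (UNIV :: unit set) (\<lambda>_ x. 3 * max 0 (v t x) ^ 2 * J i t x)" for i
    by (rule slice, intro gds, simp_all)+
  have a_int: "integrable lborel (?a i)" and b_int: "integrable lborel (?b i)" for i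
    using gauss_dominated_integrable[OF a_gd UNIV_I, of i] gauss_dominated_integrable[OF b_gd UNIV_I, of i]
    by simp_all
  have ibp: "(\<integral>x. ?b i x \<partial>lborel) = - (\<integral>x. ?a i x \<partial>lborel)" for i
  proof -
    have 1: "has_partial (v t) (e i) (vi i t)"
      by (rule conv_has_partial[OF \<eta> w_gd t w_measurable[OF t]])
    have 2: "has_partial (J i t) (e i) (Ji i t)"
      by (intro has_partial_add conv_has_partial[OF k1 p_gd t p_measurable[OF t]]
          conv_has_partial[OF \<eta> drift_gd t drift_measurable[OF t]])
    have "has_partial (\<lambda>x. 3 * max 0 (v t x) ^ 2 * J i t x) (e i) (\<lambda>x. ?a i x + ?b i x)"
      using has_partial_mult[OF has_partial_compose_real[OF 1 max0_square_has_derivative] 2] .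
    then have "(\<integral>x. ?a i x + ?b i x \<partial>lborel) = 0"
      by (rule integral_partial_eq_0[OF _ _ _ f_gd gauss_dominated_add[OF a_gd b_gd]]) simp_all
    then show ?thesis using a_int b_int by simp
  qed
  have "(\<integral>x. 3 * max 0 (v t x) ^ 2 * rate \<eta> t x \<partial>lborel) = (\<integral>x. (\<Sum>i\<in>UNIV. ?b i x) \<partial>lborel)"
    by (simp only: rate_def sum_distrib_left)
  also have "\<dots> = (\<Sum>i\<in>UNIV. \<integral>x. - ?a i x \<partial>lborel)"
    using b_int ibp by simp
  also have "\<dots> = (\<integral>x. (\<Sum>i\<in>UNIV. - ?a i x) \<partial>lborel)"
    using a_int by (intro Bochner_Integration.integral_sum[symmetric]) simp
  also have "\<dots> \<le> production \<eta> t"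
    unfolding production_def
  proof (rule integral_mono)
    show "integrable lborel (\<lambda>x. \<Sum>i\<in>UNIV. - ?a i x)"
      using a_int by (intro Bochner_Integration.integrable_sum) simp
    show "integrable lborel (\<lambda>x. 3 / 2 * max 0 (v t x) * (\<Sum>i\<in>UNIV. (conv \<eta> (g i t) x)\<^sup>2))"
      by (rule gauss_dominated_integrable[OF production_gd t production_measurable[OF t]])
    fix x
    have "- ?a i x \<le> 3 / 2 * max 0 (v t x) * (conv \<eta> (g i t) x)\<^sup>2" for i
    proof -
      let ?u = "vi i t x" and ?h = "conv \<eta> (g i t) x"
      \<comment> \<open>Minimising u (u + h) over the derivative u gives -h^2 / 4; the factor 6 then
        yields the 3/2 of \<open>production\<close>.\<close>
      have "0 \<le> (?u + ?h / 2)\<^sup>2" by simp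
      then have "- (?u * (?u + ?h)) \<le> ?h\<^sup>2 / 4" by (simp add: power2_eq_square algebra_simps)
      then have "6 * max 0 (v t x) * (- (?u * (?u + ?h))) \<le> 6 * max 0 (v t x) * (?h\<^sup>2 / 4)"
        by (intro mult_left_mono) auto
      then show ?thesis unfolding flux_eq[OF t] by (simp add: algebra_simps)
    qed
    then show "(\<Sum>i\<in>UNIV. - ?a i x) \<le> 3 / 2 * max 0 (v t x) * (\<Sum>i\<in>UNIV. (conv \<eta> (g i t) x)\<^sup>2)"
      unfolding sum_distrib_left by (intro sum_mono)
  qed
  finally show ?thesis .
qed

lemma production_cont: "continuous_on {0<..<T} (production \<eta>)"
  unfolding production_def[abs_def]
proof (rule continuous_on_integral_gauss_dominated[OF production_gd])
  show "continuous_on {0<..<T} (\<lambda>t. 3 / 2 * max 0 (v t x) * (\<Sum>i\<in>UNIV. (conv \<eta> (g i t) x)\<^sup>2))" for x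
    by (intro continuous_intros conv_continuous_on_param[OF \<eta>] w_gd g_gd w_measurable g_measurable w_cont g_cont)
qed (rule production_measurable)

lemma production_nonneg: "0 \<le> production \<eta> t"
  unfolding production_def by (intro integral_nonneg_AE AE_I2 mult_nonneg_nonneg sum_nonneg) auto

lemma production_integrable:
  assumes "t \<le> T"
  shows "production \<eta> integrable_on {0<..<t}"
proof -
  obtain B where "\<And>t. t \<in> {0<..<T} \<Longrightarrow> \<bar>production \<eta> t\<bar> \<le> B"
    unfolding production_def using gauss_dominated_integral_bounded[OF production_gd] by blast
  then show ?thesis
    using assms by (intro set_borel_integral_eq_integral(1) bounded_continuous_on_Ioo_integrable[where B = B]
        continuous_on_subset[OF production_cont]) auto
qed

text \<open>A nonnegative kernel preserves p0 \<le> q, so the positive part vanishes in the limit.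
  It suffices to take sequences of times, and after a shift of index they stay in the interval where
  the Gaussian bound holds.\<close>

lemma energy_initial:
  assumes \<eta>_nonneg: "\<And>x. 0 \<le> \<eta> x"
  shows "(energy \<eta> \<longlongrightarrow> 0) (at_right 0)"
  unfolding tendsto_at_iff_sequentially
proof (intro allI impI)
  fix X :: "nat \<Rightarrow> real" assume X: "\<forall>i. X i \<in> {0<..} - {0}" "X \<longlonglongrightarrow> 0"
  have "eventually (\<lambda>n. X n < T) sequentially"
    using order_tendstoD(2)[OF X(2) T] .
  then obtain N where N: "\<And>n. N \<le> n \<Longrightarrow> X n < T" by (auto simp: eventually_sequentially)
  define Z where "Z n = X (n + N)" for n
  have Z: "Z n \<in> {0<..<T}" for n using N[of "n + N"] X(1) by (simp add: Z_def)
  have Z0: "filterlim Z (at_right 0) sequentially"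
  proof -
    have "Z n \<noteq> 0" for n using Z[of n] by simp
    moreover have "Z \<longlonglongrightarrow> 0"
      unfolding Z_def by (rule LIMSEQ_ignore_initial_segment[OF X(2)])
    ultimately show ?thesis
      unfolding filterlim_at using Z by (auto intro!: always_eventually)
  qed
  have init: "conv \<eta> p0 x \<le> conv \<eta> q x" for x
    unfolding conv_def
  proof (rule integral_mono)
    have "gauss_dominated (UNIV :: unit set) (\<lambda>_. p0)"
    proof (rule gauss_dominated_bound[OF q_gd, of _ 1])
      show "\<bar>p0 y\<bar> \<le> 1 * \<bar>q y\<bar>" for y using p0_le[of y] by simp
    qed
    then show "integrable lborel (\<lambda>y. p0 y * \<eta> (x - y))"
      using conv_integrable[OF \<eta> _ UNIV_I p0_measurable] by blast
    show "integrable lborel (\<lambda>y. q y * \<eta> (x - y))"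
      by (rule conv_integrable[OF \<eta> q_gd UNIV_I q_measurable])
  qed (use p0_le \<eta>_nonneg in \<open>auto intro!: mult_right_mono\<close>)
  have "(\<lambda>n. \<integral>x. max 0 (v (Z n) x) ^ 3 \<partial>lborel) \<longlonglongrightarrow> (\<integral>x. 0 \<partial>(lborel :: (real^'n) measure))"
  proof (rule gauss_dominated_LIMSEQ_integral)
    show "gauss_dominated UNIV (\<lambda>n x. max 0 (v (Z n) x) ^ 3)"
      using gauss_dominated_reindex[OF conv_gd[OF \<eta> w_gd w_measurable], of UNIV Z] Z
      by (intro gauss_dominated_power max0_gd) auto
    show "(\<lambda>x. max 0 (v (Z n) x) ^ 3) \<in> borel_measurable lborel" for n
      using conv_slice_measurable[OF \<eta> w_gd w_measurable Z] by measurable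
    fix x
    have "(\<lambda>n. conv \<eta> (p (Z n)) x - conv \<eta> q x) \<longlonglongrightarrow> conv \<eta> p0 x - conv \<eta> q x"
      using filterlim_compose[OF conv_initial[OF \<eta>, of x] Z0] by (intro tendsto_intros)
    from tendsto_power[OF tendsto_max[OF tendsto_const this]]
    have "(\<lambda>n. max 0 (v (Z n) x) ^ 3) \<longlonglongrightarrow> max 0 (conv \<eta> p0 x - conv \<eta> q x) ^ 3"
      unfolding conv_w_eq[OF \<eta> Z] .
    moreover have "max 0 (conv \<eta> p0 x - conv \<eta> q x) = 0"
      using init[of x] by (intro max_absorb1) simp
    ultimately show "(\<lambda>n. max 0 (v (Z n) x) ^ 3) \<longlonglongrightarrow> 0"
      by (metis zero_power zero_less_numeral)
  qed
  then have "(\<lambda>n. energy \<eta> (X (n + N))) \<longlonglongrightarrow> 0" by (simp add: energy_def Z_def)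
  then show "(energy \<eta> \<circ> X) \<longlonglongrightarrow> 0"
    unfolding comp_def by (rule LIMSEQ_offset)
qed

text \<open>The derivative is known only inside the open interval: the inequality is integrated from
  \<open>s\<close> to \<open>t\<close>, and then \<open>s\<close> tends to 0, where the energy
  vanishes. As the production is nonnegative, its integral may be enlarged to start at 0.\<close>

lemma energy_le:
  assumes \<eta>_nonneg: "\<And>x. 0 \<le> \<eta> x" and t: "t \<in> {0<..<T}"
  shows "energy \<eta> t \<le> integral {0<..<t} (production \<eta>)"
proof -
  have "energy \<eta> t - energy \<eta> s \<le> integral {0<..<t} (production \<eta>)" if s: "0 < s" "s < t" for s
  proof -
    have sub: "{s..t} \<subseteq> {0<..<T}" using s t by auto
    have "((\<lambda>r. \<integral>x. 3 * max 0 (v r x) ^ 2 * rate \<eta> r x \<partial>lborel) has_integral energy \<eta> t - energy \<eta> s) {s..t}"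
    proof (rule fundamental_theorem_of_calculus)
      fix r assume "r \<in> {s..t}"
      then have "r \<in> {0<..<T}" using sub by blast
      from energy_derivative[OF this]
      show "(energy \<eta> has_vector_derivative (\<integral>x. 3 * max 0 (v r x) ^ 2 * rate \<eta> r x \<partial>lborel)) (at r within {s..t})"
        unfolding has_real_derivative_iff_has_vector_derivative by (rule has_vector_derivative_at_within)
    qed (use s in simp)
    moreover have R: "production \<eta> integrable_on {s..t}"
      by (rule integrable_continuous_interval[OF continuous_on_subset[OF production_cont sub]])
    ultimately have "energy \<eta> t - energy \<eta> s \<le> integral {s..t} (production \<eta>)"
      using energy_derivative_le_production sub
      by (intro has_integral_le[OF _ integrable_integral]) (auto simp: subset_iff)
    also have "\<dots> = integral {s<..<t} (production \<eta>)"
      by (rule integral_open_interval_real)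
    also have "\<dots> \<le> integral {0<..<t} (production \<eta>)"
    proof (rule integral_subset_le)
      show "production \<eta> integrable_on {s<..<t}"
        using R integrable_on_Icc_iff_Ioo by blast
    qed (use s t production_nonneg production_integrable in auto)
    finally show ?thesis .
  qed
  then have "eventually (\<lambda>s. energy \<eta> t - energy \<eta> s \<le> integral {0<..<t} (production \<eta>)) (at_right 0)"
    using t by (auto simp: eventually_at_right_field)
  moreover have "((\<lambda>s. energy \<eta> t - energy \<eta> s) \<longlongrightarrow> energy \<eta> t - 0) (at_right 0)"
    by (intro tendsto_intros energy_initial \<eta>_nonneg)
  ultimately show ?thesis
    using tendsto_upperbound[of "\<lambda>s. energy \<eta> t - energy \<eta> s" "energy \<eta> t - 0" "at_right 0"] by simp
qed

end

end

section \<open>A Gronwall argument\<close>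

text \<open>The coefficient \<open>a * R\<^sup>2\<close> of the growth rate is unbounded, but the inhomogeneity decays like
  \<open>exp (- \<gamma> * R\<^sup>2)\<close>: on time intervals of length \<open>\<gamma> / (4 * a)\<close> the decay wins as \<open>R \<rightarrow> \<infinity>\<close>.\<close>

lemma gronwall_gaussian_tail_step:
  fixes Y r :: "real \<Rightarrow> real"
  assumes a: "0 < a" and \<gamma>: "0 < \<gamma>" and D: "0 \<le> D" and T: "0 < T" and t0: "0 \<le> t0"
    and Y: "\<And>t. t \<in> {0<..<T} \<Longrightarrow> 0 \<le> Y t \<and> Y t \<le> B"
    and r_int: "\<And>t. t \<in> {0<..<T} \<Longrightarrow> r integrable_on {0<..<t}"
    and Y_le: "\<And>t. t \<in> {0<..<T} \<Longrightarrow> Y t \<le> integral {0<..<t} r"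
    and r_le: "\<And>R s. s \<in> {0<..<T} \<Longrightarrow> r s \<le> a * R\<^sup>2 * Y s + D * exp (- \<gamma> * R\<^sup>2)"
    and zero: "\<And>t. t \<in> {0<..<T} \<Longrightarrow> t \<le> t0 \<Longrightarrow> Y t = 0"
    and t: "t \<in> {0<..<T}" "t \<le> t0 + \<gamma> / (4 * a)"
  shows "Y t = 0"
proof -
  have bound: "Y t \<le> 2 * T * D * exp (- (\<gamma> / 2) * R\<^sup>2)" if R: "1 \<le> R" for R
  proof -
    define \<alpha> where "\<alpha> = a * R\<^sup>2"
    define b where "b = D * exp (- \<gamma> * R\<^sup>2)"
    have \<alpha>: "0 < \<alpha>" using a R by (simp add: \<alpha>_def)
    have b: "0 \<le> b" using D by (simp add: b_def)
    \<comment> \<open>The weight has twice the growth rate, so integrating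
      \<open>\<alpha> * Y\<close> returns only half of the supremum \<open>N\<close>, and the bound
      N \<le> N/2 + T b closes.\<close>
    define Z where "Z s = Y s * exp (- (2 * \<alpha> * (s - t0)))" for s
    define N where "N = (SUP s\<in>{0<..<T}. Z s)"
    have B: "0 \<le> B" using Y[OF t(1)] by linarith
    have "Z s \<le> B * exp (2 * \<alpha> * t0)" if "s \<in> {0<..<T}" for s
    proof -
      have "0 \<le> \<alpha> * s" using that \<alpha> by simp
      then have "- (2 * \<alpha> * (s - t0)) \<le> 2 * \<alpha> * t0" by (simp add: right_diff_distrib)
      then show ?thesis unfolding Z_def using Y[OF that] B by (intro mult_mono) auto
    qed
    then have bdd: "bdd_above (Z ` {0<..<T})" by (intro bdd_aboveI2)
    have Z_le: "Z s \<le> N" if "s \<in> {0<..<T}" for s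
      unfolding N_def using that bdd by (rule cSUP_upper)
    have Y_N: "Y s \<le> N * exp (2 * \<alpha> * (s - t0))" if "s \<in> {0<..<T}" for s
    proof -
      have "Y s = Z s * exp (2 * \<alpha> * (s - t0))"
        by (simp add: Z_def mult.assoc exp_add[symmetric])
      with Z_le[OF that] show ?thesis by (simp add: mult_right_mono)
    qed
    have N: "0 \<le> N"
      using order_trans[OF _ Z_le[OF t(1)], of 0] Y[OF t(1)] by (simp add: Z_def)
    have "Z s \<le> N / 2 + T * b" if s: "s \<in> {0<..<T}" for s
    proof (cases "s \<le> t0")
      \<comment> \<open>Times up to \<open>t0\<close>, where the weight is at least 1, are harmless
        because \<open>Y\<close> vanishes there; afterwards the weight is at most 1.\<close>
      case True
      with zero[OF s] N b T show ?thesis by (simp add: Z_def)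
    next
      case False
      let ?h = "\<lambda>u. \<alpha> * N * exp (2 * \<alpha> * (u - t0)) + b"
      let ?P = "\<lambda>u. N / 2 * exp (2 * \<alpha> * (u - t0)) + b * u"
      have h: "(?h has_integral ?P s - ?P 0) {0<..<s}"
        unfolding has_integral_Icc_iff_Ioo[symmetric]
      proof (rule fundamental_theorem_of_calculus)
        fix u
        have "(?P has_real_derivative ?h u) (at u)"
          by (auto intro!: derivative_eq_intros)
        then show "(?P has_vector_derivative ?h u) (at u within {0..s})"
          unfolding has_real_derivative_iff_has_vector_derivative by (rule has_vector_derivative_at_within)
      qed (use s in simp)
      have "Y s \<le> integral {0<..<s} r" by (rule Y_le[OF s])
      also have "\<dots> \<le> ?P s - ?P 0"
      proof (rule has_integral_le[OF integrable_integral[OF r_int[OF s]] h])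
        fix u assume "u \<in> {0<..<s}"
        then have u: "u \<in> {0<..<T}" using s by auto
        have "r u \<le> \<alpha> * Y u + b" using r_le[OF u, of R] by (simp add: \<alpha>_def b_def)
        also have "\<alpha> * Y u \<le> \<alpha> * (N * exp (2 * \<alpha> * (u - t0)))"
          using Y_N[OF u] \<alpha> by (intro mult_left_mono) auto
        finally show "r u \<le> ?h u" by (simp add: mult.assoc)
      qed
      also have "\<dots> \<le> N / 2 * exp (2 * \<alpha> * (s - t0)) + T * b"
      proof -
        have "0 \<le> N / 2 * exp (2 * \<alpha> * (0 - t0))" using N by simp
        moreover have "b * s \<le> T * b" using b s mult_left_mono[of s T b] by (simp add: mult.commute[of T])
        ultimately show ?thesis by simp
      qed
      finally have "Z s \<le> (N / 2 * exp (2 * \<alpha> * (s - t0)) + T * b) * exp (- (2 * \<alpha> * (s - t0)))"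
        unfolding Z_def by (intro mult_right_mono) auto
      also have "\<dots> = N / 2 + T * b * exp (- (2 * \<alpha> * (s - t0)))"
        by (simp add: distrib_right mult.assoc exp_add[symmetric])
      also have "T * b * exp (- (2 * \<alpha> * (s - t0))) \<le> T * b"
        using False \<alpha> b T by (intro mult_left_le) auto
      finally show ?thesis by simp
    qed
    then have "N \<le> N / 2 + T * b"
      unfolding N_def using T by (intro cSUP_least) auto
    then have "Y t \<le> 2 * T * b * exp (2 * \<alpha> * (t - t0))"
      using order_trans[OF Y_N[OF t(1)] mult_right_mono[of N "2 * T * b"]] by simp
    \<comment> \<open>Over a time step of length \<open>\<gamma> / (4 * a)\<close> the growth
      exponent reaches at most \<gamma> R^2 / 2, so half of the decay in \<open>b\<close>
      survives.\<close>
    also have "\<dots> \<le> 2 * T * b * exp (\<gamma> / 2 * R\<^sup>2)"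
    proof -
      have "2 * \<alpha> * (t - t0) \<le> 2 * \<alpha> * (\<gamma> / (4 * a))"
        using \<alpha> t(2) by (intro mult_left_mono) auto
      also have "\<dots> = \<gamma> / 2 * R\<^sup>2" using a by (simp add: \<alpha>_def)
      finally show ?thesis using T b by (intro mult_left_mono) auto
    qed
    also have "\<dots> = 2 * T * D * exp (- (\<gamma> / 2) * R\<^sup>2)"
      by (simp add: b_def mult.assoc exp_add[symmetric])
    finally show ?thesis .
  qed
  have "filterlim (\<lambda>n. (\<gamma> / 2) * (real n)\<^sup>2) at_top sequentially"
    using \<gamma> by (intro filterlim_tendsto_pos_mult_at_top[OF tendsto_const] filterlim_pow_at_top
        filterlim_real_sequentially) auto
  then have "(\<lambda>n. exp (- ((\<gamma> / 2) * (real n)\<^sup>2))) \<longlonglongrightarrow> 0"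
    by (intro filterlim_compose[OF exp_at_bot] filterlim_compose[OF filterlim_uminus_at_bot_at_top])
  then have lim: "(\<lambda>n. 2 * T * D * exp (- (\<gamma> / 2) * (real n)\<^sup>2)) \<longlonglongrightarrow> 2 * T * D * 0"
    by (intro tendsto_mult tendsto_const) simp
  have "Y t \<le> 2 * T * D * 0"
  proof (rule tendsto_lowerbound[OF lim eventually_sequentiallyI[of 1]])
    fix n :: nat assume "1 \<le> n"
    then show "Y t \<le> 2 * T * D * exp (- (\<gamma> / 2) * (real n)\<^sup>2)" by (intro bound) simp
  qed simp
  with Y[OF t(1)] show ?thesis by simp
qed

text \<open>The step length does not depend on the starting time, so finitely many steps reach any
  \<open>t\<close>. The induction starts at time 0, where the claim is vacuous.\<close>

lemma gronwall_gaussian_tail: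
  fixes Y r :: "real \<Rightarrow> real"
  assumes a: "0 < a" and \<gamma>: "0 < \<gamma>" and D: "0 \<le> D" and T: "0 < T"
    and Y: "\<And>t. t \<in> {0<..<T} \<Longrightarrow> 0 \<le> Y t \<and> Y t \<le> B"
    and r_int: "\<And>t. t \<in> {0<..<T} \<Longrightarrow> r integrable_on {0<..<t}"
    and Y_le: "\<And>t. t \<in> {0<..<T} \<Longrightarrow> Y t \<le> integral {0<..<t} r"
    and r_le: "\<And>R s. s \<in> {0<..<T} \<Longrightarrow> r s \<le> a * R\<^sup>2 * Y s + D * exp (- \<gamma> * R\<^sup>2)"
    and t: "t \<in> {0<..<T}"
  shows "Y t = 0"
proof -
  let ?\<tau> = "\<gamma> / (4 * a)"
  have \<tau>: "0 < ?\<tau>" using a \<gamma> by simp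
  have "\<forall>t\<in>{0<..<T}. t \<le> real n * ?\<tau> \<longrightarrow> Y t = 0" for n
  proof (induction n)
    case (Suc n)
    show ?case
    proof (intro ballI impI)
      fix t assume t: "t \<in> {0<..<T}" "t \<le> real (Suc n) * ?\<tau>"
      have "t \<le> real n * ?\<tau> + ?\<tau>" using t(2) by (simp add: add_divide_distrib distrib_right)
      moreover have "Y s = 0" if "s \<in> {0<..<T}" "s \<le> real n * ?\<tau>" for s
        using Suc that by blast
      moreover have "0 \<le> real n * ?\<tau>" using a \<gamma> by simp
      ultimately show "Y t = 0"
        by (intro gronwall_gaussian_tail_step[OF a \<gamma> D T _ Y r_int Y_le r_le _ t(1)])
    qed
  qed simp
  moreover obtain n where "t \<le> real n * ?\<tau>"
    using reals_Archimedean3[OF \<tau>] less_imp_le by metis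
  ultimately show ?thesis using t by blast
qed

lemma nonneg_continuous_integral_0_imp_0:
  fixes f :: "'v::euclidean_space \<Rightarrow> real"
  assumes "continuous_on UNIV f" "\<And>x. 0 \<le> f x" "integrable lborel f" "(\<integral>x. f x \<partial>lborel) = 0"
  shows "f x = 0"
proof (rule ccontr)
  assume "f x \<noteq> 0"
  have "open (f -` (- {0}))"
    using assms(1) by (rule open_vimage[rotated]) auto
  then obtain e where e: "0 < e" "ball x e \<subseteq> f -` (- {0})"
    using \<open>f x \<noteq> 0\<close> by (auto elim: openE)
  have "AE x in lborel. f x = 0"
    using integral_nonneg_eq_0_iff_AE[OF assms(3)] assms(2,4) by simp
  then have "AE y in lborel. y \<notin> ball x e"
    by (rule AE_mp) (use e(2) in \<open>auto intro!: AE_I2\<close>)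
  then have "emeasure lborel (ball x e) = 0"
    by (subst (asm) AE_iff_measurable[OF _ refl]) (auto simp: ball_def)
  then have "measure lborel (ball x e) = 0"
    by (simp add: measure_def)
  then show False
    using content_ball_pos[OF e(1), of x] by simp
qed

section \<open>Comparison with a stationary solution\<close>

context fp_comparison
begin

definition excess :: "real \<Rightarrow> real" where
  "excess t = (\<integral>x. max 0 (w t x) ^ 3 \<partial>lborel)"

definition excess_production :: "real \<Rightarrow> real" where
  "excess_production t = (\<integral>x. 3 / 2 * max 0 (w t x) * (\<Sum>i\<in>UNIV. (g i t x)\<^sup>2) \<partial>lborel)"

lemma excess_gd: "gauss_dominated {0<..<T} (\<lambda>t x. max 0 (w t x) ^ 3)"
  by (intro gauss_dominated_power max0_gd w_gd) simp

lemma excess_integrable: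
  assumes t: "t \<in> {0<..<T}"
  shows "integrable lborel (\<lambda>x. max 0 (w t x) ^ 3)"
  by (rule gauss_dominated_integrable[OF excess_gd t]) (use w_measurable[OF t] in measurable)

text \<open>The mollified inequality passes to the limit: in space by a Gaussian uniform in the
  kernel, in time by a constant uniform in \<open>k\<close> and \<open>t\<close>. Dominated
  convergence in time also yields the integrability of the limit.\<close>

lemma excess_le_production:
  "t \<in> {0<..<T} \<Longrightarrow> excess t \<le> integral {0<..<t} excess_production"
  "t \<in> {0<..<T} \<Longrightarrow> excess_production integrable_on {0<..<t}"
proof -
  obtain \<eta> :: "nat \<Rightarrow> real^'n \<Rightarrow> real"
    where \<eta>: "\<And>k. smooth_kernel (\<eta> k)" "\<And>k x. 0 \<le> \<eta> k x" "\<And>k. (\<integral>x. \<eta> k x \<partial>lborel) = 1"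
      "\<And>k x. 1 / Suc k \<le> norm x \<Longrightarrow> \<eta> k x = 0"
    by (rule mollifiers_exist) blast
  have abs\<eta>: "(\<integral>x. \<bar>\<eta> k x\<bar> \<partial>lborel) \<le> 1" for k
    using \<eta>(2,3)[of k] by simp
  have conv_family: "gauss_dominated (UNIV \<times> {0<..<T}) (\<lambda>(k, t). conv (\<eta> k) (f t))"
    if "gauss_dominated {0<..<T} f" "\<And>t. t \<in> {0<..<T} \<Longrightarrow> f t \<in> borel_measurable borel" for f
    by (rule gauss_dominated_conv[OF \<eta>(1) abs\<eta> that])
  note w_fam = conv_family[OF w_gd w_measurable] and g_fam = conv_family[OF g_gd g_measurable]
  have conv_lim: "(\<lambda>k. conv (\<eta> k) (f t) x) \<longlonglongrightarrow> f t x"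
    if "gauss_dominated {0<..<T} f" "t \<in> {0<..<T}" "continuous_on UNIV (f t)" for f t x
    by (rule conv_mollifier_LIMSEQ[OF \<eta> that(3,1,2) refl])
  have prod_fam: "gauss_dominated (UNIV \<times> {0<..<T}) (\<lambda>(k, t) x.
      3 / 2 * max 0 (conv (\<eta> k) (w t) x) * (\<Sum>i\<in>UNIV. (conv (\<eta> k) (g i t) x)\<^sup>2))"
    using w_fam g_fam unfolding case_prod_unfold
    by (intro gauss_dominated_mult gauss_dominated_cmult gauss_dominated_sum gauss_dominated_power max0_gd) auto
  have energy_lim: "(\<lambda>k. energy (\<eta> k) t) \<longlonglongrightarrow> excess t" if t: "t \<in> {0<..<T}" for t
    unfolding energy_def excess_def
  proof (rule gauss_dominated_LIMSEQ_integral)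
    show "gauss_dominated UNIV (\<lambda>k x. max 0 (conv (\<eta> k) (w t) x) ^ 3)"
      using gauss_dominated_reindex[OF w_fam, of UNIV "\<lambda>k. (k, t)"] t
      by (intro gauss_dominated_power max0_gd) auto
    show "(\<lambda>x. max 0 (conv (\<eta> k) (w t) x) ^ 3) \<in> borel_measurable lborel" for k
      using conv_slice_measurable[OF \<eta>(1) \<eta>(1) w_gd w_measurable t] by measurable
    show "(\<lambda>k. max 0 (conv (\<eta> k) (w t) x) ^ 3) \<longlonglongrightarrow> max 0 (w t x) ^ 3" for x
      by (intro tendsto_power tendsto_max tendsto_const conv_lim w_gd t w_cont)
  qed
  have prod_lim: "(\<lambda>k. production (\<eta> k) t) \<longlonglongrightarrow> excess_production t" if t: "t \<in> {0<..<T}" for t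
    unfolding production_def excess_production_def
  proof (rule gauss_dominated_LIMSEQ_integral)
    show "gauss_dominated UNIV (\<lambda>k x. 3 / 2 * max 0 (conv (\<eta> k) (w t) x) * (\<Sum>i\<in>UNIV. (conv (\<eta> k) (g i t) x)\<^sup>2))"
      using gauss_dominated_reindex[OF prod_fam, of UNIV "\<lambda>k. (k, t)"] t by simp
    show "(\<lambda>x. 3 / 2 * max 0 (conv (\<eta> k) (w t) x) * (\<Sum>i\<in>UNIV. (conv (\<eta> k) (g i t) x)\<^sup>2)) \<in> borel_measurable lborel" for k
      by (rule production_measurable[OF \<eta>(1) t])
    show "(\<lambda>k. 3 / 2 * max 0 (conv (\<eta> k) (w t) x) * (\<Sum>i\<in>UNIV. (conv (\<eta> k) (g i t) x)\<^sup>2))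
        \<longlonglongrightarrow> 3 / 2 * max 0 (w t x) * (\<Sum>i\<in>UNIV. (g i t x)\<^sup>2)" for x
      by (intro tendsto_mult tendsto_sum tendsto_power tendsto_max tendsto_const conv_lim w_gd g_gd t w_cont g_cont)
  qed
  obtain B where B': "\<And>z. z \<in> UNIV \<times> {0<..<T} \<Longrightarrow> \<bar>\<integral>x. (\<lambda>(k, t) x.
      3 / 2 * max 0 (conv (\<eta> k) (w t) x) * (\<Sum>i\<in>UNIV. (conv (\<eta> k) (g i t) x)\<^sup>2)) z x \<partial>lborel\<bar> \<le> B"
    by (rule gauss_dominated_integral_bounded[OF prod_fam]) blast
  have B: "\<bar>production (\<eta> k) t\<bar> \<le> B" if "t \<in> {0<..<T}" for k t
    unfolding production_def using B'[of "(k, t)"] that by simp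
  assume t: "t \<in> {0<..<T}"
  have const_int: "(\<lambda>_. B) integrable_on {0<..<t}"
    unfolding integrable_on_Icc_iff_Ioo[symmetric] by (rule integrable_const_ivl)
  have prod_int: "production (\<eta> k) integrable_on {0<..<t}" for k
    using t by (intro production_integrable \<eta>(1)) simp
  have prod_le: "norm (production (\<eta> k) s) \<le> B" and prod_tendsto: "(\<lambda>k. production (\<eta> k) s) \<longlonglongrightarrow> excess_production s"
    if "s \<in> {0<..<t}" for k s
    using that t B prod_lim by auto
  note dc = dominated_convergence[OF prod_int const_int prod_le prod_tendsto]
  show "excess_production integrable_on {0<..<t}" by (rule dc)
  have "energy (\<eta> k) t \<le> integral {0<..<t} (production (\<eta> k))" for k
    using \<eta>(1,2) t by (rule energy_le)
  then show "excess t \<le> integral {0<..<t} excess_production"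
    by (intro LIMSEQ_le[OF energy_lim[OF t] dc(2)]) auto
qed

lemma excess_production_bound:
  obtains a \<gamma> D where "0 < a" "0 < \<gamma>" "0 \<le> D"
    "\<And>R t. t \<in> {0<..<T} \<Longrightarrow> excess_production t \<le> a * R\<^sup>2 * excess t + D * exp (- \<gamma> * R\<^sup>2)"
proof -
  let ?f = "\<lambda>t x. max 0 (w t x) ^ 3"
  \<comment> \<open>The 6 is 3/2 times the 4 in |g|^2 \<le> 4 \<Lambda>^2 |x|^2 w^2; the added 1
    keeps \<open>a\<close> positive when \<Lambda> is 0.\<close>
  define a where "a = 6 * \<Lambda>\<^sup>2 + 1"
  have a: "0 < a" by (simp add: a_def add_nonneg_pos)
  have "gauss_dominated {0<..<T} (\<lambda>t x. norm x * (norm x * ?f t x))"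
    by (intro gauss_dominated_norm_mult excess_gd)
  then obtain C \<delta> where C: "0 < \<delta>" "0 \<le> C"
    "\<And>t x. t \<in> {0<..<T} \<Longrightarrow> \<bar>norm x * (norm x * ?f t x)\<bar> \<le> C * exp (- \<delta> * (norm x)\<^sup>2)"
    by (rule gauss_dominatedE) blast
  have int: "integrable lborel (\<lambda>x::real^'n. exp (- (\<delta> / 2) * (norm x)\<^sup>2))"
    using C(1) by (intro integrable_gaussian) simp
  define D where "D = a * C * (\<integral>x. exp (- (\<delta> / 2) * (norm (x::real^'n))\<^sup>2) \<partial>lborel)"
  show ?thesis
  proof (rule that[OF a, of "\<delta> / 2" D])
    show "0 < \<delta> / 2" using C(1) by simp
    show "0 \<le> D" using a C(2) by (auto simp: D_def intro!: mult_nonneg_nonneg integral_nonneg_AE)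
    fix R t :: real assume t: "t \<in> {0<..<T}"
    have pw: "3 / 2 * max 0 (w t x) * (\<Sum>i\<in>UNIV. (g i t x)\<^sup>2) \<le>
        a * R\<^sup>2 * ?f t x + a * C * exp (- (\<delta> / 2) * R\<^sup>2) * exp (- (\<delta> / 2) * (norm x)\<^sup>2)" for x
    proof -
      have "(\<Sum>i\<in>UNIV. (g i t x)\<^sup>2) = (\<Sum>i\<in>UNIV. 4 * (H t x - Hq x)\<^sup>2 * (x $ i)\<^sup>2)"
        by (intro sum.cong) (auto simp: g_def drift_def power2_eq_square algebra_simps)
      also have "\<dots> = 4 * (H t x - Hq x)\<^sup>2 * (norm x)\<^sup>2"
        unfolding power2_norm_eq_inner inner_vec_def sum_distrib_left by (simp add: power2_eq_square)
      also have "\<dots> \<le> 4 * (\<Lambda>\<^sup>2 * (w t x)\<^sup>2) * (norm x)\<^sup>2"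
      proof (intro mult_right_mono mult_left_mono)
        have "\<bar>H t x - Hq x\<bar>\<^sup>2 \<le> (\<Lambda> * \<bar>w t x\<bar>)\<^sup>2"
          using lip[OF t, of x] by (intro power_mono) (auto simp: w_def)
        then show "(H t x - Hq x)\<^sup>2 \<le> \<Lambda>\<^sup>2 * (w t x)\<^sup>2" by (simp add: power_mult_distrib)
      qed auto
      finally have "3 / 2 * max 0 (w t x) * (\<Sum>i\<in>UNIV. (g i t x)\<^sup>2)
          \<le> 3 / 2 * max 0 (w t x) * (4 * (\<Lambda>\<^sup>2 * (w t x)\<^sup>2) * (norm x)\<^sup>2)"
        by (intro mult_left_mono) auto
      also have "\<dots> = 6 * \<Lambda>\<^sup>2 * ((norm x)\<^sup>2 * ?f t x)"
        by (cases "0 \<le> w t x") (auto simp: max_def power3_eq_cube power2_eq_square)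
      also have "\<dots> \<le> a * ((norm x)\<^sup>2 * ?f t x)"
        by (intro mult_right_mono) (auto simp: a_def)
      also have "(norm x)\<^sup>2 * ?f t x \<le> R\<^sup>2 * ?f t x + C * (exp (- (\<delta> / 2) * R\<^sup>2) * exp (- (\<delta> / 2) * (norm x)\<^sup>2))"
      proof (cases "(norm x)\<^sup>2 \<le> R\<^sup>2")
        case True
        then have "(norm x)\<^sup>2 * ?f t x \<le> R\<^sup>2 * ?f t x" by (intro mult_right_mono) auto
        moreover have "0 \<le> C * (exp (- (\<delta> / 2) * R\<^sup>2) * exp (- (\<delta> / 2) * (norm x)\<^sup>2))"
          using C(2) by simp
        ultimately show ?thesis by linarith
      next
        case False
        have "(norm x)\<^sup>2 * ?f t x \<le> C * exp (- \<delta> * (norm x)\<^sup>2)"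
          using C(3)[OF t, of x] by (simp add: power2_eq_square mult.assoc)
        \<comment> \<open>Outside the ball of radius |R|, half of the exponent becomes the tail
          factor in \<open>R\<close>, and the other half stays integrable in
          \<open>x\<close>.\<close>
        also have "\<dots> \<le> C * (exp (- (\<delta> / 2) * R\<^sup>2) * exp (- (\<delta> / 2) * (norm x)\<^sup>2))"
        proof (intro mult_left_mono C(2))
          have "\<delta> * R\<^sup>2 \<le> \<delta> * (norm x)\<^sup>2" using False C(1) by simp
          then show "exp (- \<delta> * (norm x)\<^sup>2) \<le> exp (- (\<delta> / 2) * R\<^sup>2) * exp (- (\<delta> / 2) * (norm x)\<^sup>2)"
            unfolding exp_add[symmetric] exp_le_cancel_iff by simp
        qed
        also have "\<dots> \<le> R\<^sup>2 * ?f t x + \<dots>" by simp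
        finally show ?thesis .
      qed
      finally show ?thesis using a by (simp add: algebra_simps)
    qed
    have int1: "integrable lborel (\<lambda>x. a * R\<^sup>2 * ?f t x)"
      by (intro integrable_mult_right excess_integrable t)
    have int2: "integrable lborel (\<lambda>x::real^'n. a * C * exp (- (\<delta> / 2) * R\<^sup>2) * exp (- (\<delta> / 2) * (norm x)\<^sup>2))"
      by (intro integrable_mult_right int)
    have "excess_production t \<le>
        (\<integral>x. a * R\<^sup>2 * ?f t x + a * C * exp (- (\<delta> / 2) * R\<^sup>2) * exp (- (\<delta> / 2) * (norm x)\<^sup>2) \<partial>lborel)"
      unfolding excess_production_def
      using pw a C(2) by (intro integral_mono' Bochner_Integration.integrable_add int1 int2) auto
    also have "\<dots> = (\<integral>x. a * R\<^sup>2 * ?f t x \<partial>lborel)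
        + (\<integral>x. a * C * exp (- (\<delta> / 2) * R\<^sup>2) * exp (- (\<delta> / 2) * (norm (x::real^'n))\<^sup>2) \<partial>lborel)"
      by (rule Bochner_Integration.integral_add[OF int1 int2])
    also have "\<dots> = a * R\<^sup>2 * excess t + D * exp (- (\<delta> / 2) * R\<^sup>2)"
      by (simp only: Bochner_Integration.integral_mult_right_zero excess_def D_def mult_ac)
    finally show "excess_production t \<le> a * R\<^sup>2 * excess t + D * exp (- (\<delta> / 2) * R\<^sup>2)" .
  qed
qed

text \<open>The constants of the Gaussian bound on \<open>p\<close> enter the Gronwall argument
  merely as finite numbers and leave no trace in the conclusion. Continuity in space turns zero
  excess into an inequality at every point.\<close>

theorem comparison:
  assumes t: "t \<in> {0<..<T}"
  shows "p t x \<le> q x"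
proof -
  obtain a \<gamma> D where *: "0 < a" "0 < \<gamma>" "0 \<le> D"
    "\<And>R t. t \<in> {0<..<T} \<Longrightarrow> excess_production t \<le> a * R\<^sup>2 * excess t + D * exp (- \<gamma> * R\<^sup>2)"
    by (rule excess_production_bound) blast
  obtain B where B: "\<And>t. t \<in> {0<..<T} \<Longrightarrow> \<bar>excess t\<bar> \<le> B"
    unfolding excess_def using gauss_dominated_integral_bounded[OF excess_gd] by blast
  have nonneg: "0 \<le> excess t" for t
    unfolding excess_def by (intro integral_nonneg_AE) auto
  have "excess t = 0"
    using gronwall_gaussian_tail[OF *(1-3) T _ excess_le_production(2,1) *(4) t, of B] B nonneg
    by (metis abs_le_D1)
  then have "max 0 (w t x) ^ 3 = 0"
    unfolding excess_def
    by (intro nonneg_continuous_integral_0_imp_0[OF _ _ excess_integrable[OF t]] continuous_on_power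
        continuous_on_max continuous_on_const w_cont t) auto
  then show ?thesis by (simp add: w_def max_def split: if_splits)
qed

end

section \<open>The Gaussian bound\<close>

text \<open>A small closed ball around the point is an admissible compact set, and since its
  exponent is positive the modulus tends to 0; the exponent may change from point to point.\<close>

lemma locally_parabolic_holder_continuous_on:
  fixes p :: "real \<Rightarrow> real^'n \<Rightarrow> real"
  assumes "locally_parabolic_holder T p"
  shows "continuous_on ({0<..<T} \<times> UNIV) (\<lambda>(t, x). p t x)"
  unfolding continuous_on_def
proof
  fix z :: "real \<times> (real^'n)" assume "z \<in> {0<..<T} \<times> UNIV"
  then obtain t x where z: "z = (t, x)" "t \<in> {0<..<T}" by auto
  have op: "open ({0<..<T} \<times> (UNIV :: (real^'n) set))"
    by (intro open_Times) auto
  then obtain e where e: "0 < e" "cball z e \<subseteq> {0<..<T} \<times> UNIV"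
    using z open_contains_cball by (metis SigmaI UNIV_I)
  obtain \<alpha> H where \<alpha>: "0 < \<alpha>" and H: "\<And>s y. (s, y) \<in> cball z e \<Longrightarrow>
      \<bar>p t x - p s y\<bar> \<le> H * (norm (x - y) + sqrt \<bar>t - s\<bar>) powr \<alpha>"
  proof -
    have "compact (cball z e)" by simp
    with assms e(2) obtain \<alpha> H where "0 < \<alpha>" "\<forall>(t, x)\<in>cball z e. \<forall>(s, y)\<in>cball z e.
        \<bar>p t x - p s y\<bar> \<le> H * (norm (x - y) + sqrt \<bar>t - s\<bar>) powr \<alpha>"
      unfolding locally_parabolic_holder_def by blast
    moreover have "(t, x) \<in> cball z e" using z e(1) by simp
    ultimately show ?thesis by (intro that[of \<alpha> H]) blast+
  qed
  let ?d = "\<lambda>u. norm (x - snd u) + sqrt \<bar>t - fst u\<bar>"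
  have "((\<lambda>u. p (fst u) (snd u) - p t x) \<longlongrightarrow> 0) (at z)"
  proof (rule Lim_null_comparison)
    have "eventually (\<lambda>u. u \<in> cball z e) (at z)"
      using eventually_at_ball[OF e(1), of z UNIV] by (rule eventually_mono) auto
    then show "eventually (\<lambda>u. norm (p (fst u) (snd u) - p t x) \<le> H * ?d u powr \<alpha>) (at z)"
    proof (rule eventually_mono)
      fix u assume "u \<in> cball z e"
      then show "norm (p (fst u) (snd u) - p t x) \<le> H * ?d u powr \<alpha>"
        using H[of "fst u" "snd u"] by (simp add: abs_minus_commute)
    qed
    have "(?d \<longlongrightarrow> norm (x - snd z) + sqrt \<bar>t - fst z\<bar>) (at z)"
      by (intro tendsto_intros)
    then have "((\<lambda>u. ?d u powr \<alpha>) \<longlongrightarrow> 0) (at z)"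
      using \<alpha> by (intro tendsto_zero_powrI[OF _ tendsto_const]) (auto simp: z)
    from tendsto_mult[OF tendsto_const this]
    show "((\<lambda>u. H * ?d u powr \<alpha>) \<longlongrightarrow> 0) (at z)" by simp
  qed
  then have "((\<lambda>u. p (fst u) (snd u)) \<longlongrightarrow> p t x) (at z)"
    by (simp add: Lim_null[symmetric])
  then show "((\<lambda>(t, x). p t x) \<longlongrightarrow> (case z of (t, x) \<Rightarrow> p t x)) (at z within {0<..<T} \<times> UNIV)"
    by (auto simp: z case_prod_unfold intro: tendsto_within_subset)
qed

lemma has_partial_norm_square:
  fixes v :: "'v::real_inner"
  shows "has_partial (\<lambda>x. (norm x)\<^sup>2) v (\<lambda>x. 2 * (x \<bullet> v))"
  unfolding has_partial_def
proof (intro allI)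
  fix x :: 'v and h
  have "(norm (x + h *\<^sub>R v))\<^sup>2 = (norm x)\<^sup>2 + 2 * h * (x \<bullet> v) + h\<^sup>2 * (v \<bullet> v)" for h
    unfolding power2_norm_eq_inner
    by (simp add: inner_add_left inner_add_right inner_commute[of v x] power2_eq_square distrib_left)
  moreover have "((\<lambda>h. (norm x)\<^sup>2 + 2 * h * (x \<bullet> v) + h\<^sup>2 * (v \<bullet> v)) has_real_derivative
      2 * ((x + h *\<^sub>R v) \<bullet> v)) (at h)"
    by (auto intro!: derivative_eq_intros simp: inner_add_left)
  ultimately show "((\<lambda>h. (norm (x + h *\<^sub>R v))\<^sup>2) has_real_derivative 2 * ((x + h *\<^sub>R v) \<bullet> v)) (at h)"
    by simp
qed

text \<open>The order of the quantifiers carries the independence of \<open>T\<close>: when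
  \<open>c\<close> is chosen, only c0, b0 and, about \<Xi>, its value at 0 and its Lipschitz
  constant are known.\<close>

theorem lemma1:
  fixes b0 c0 \<xi>0 L :: real
  assumes "c0 > 0" and "b0 > \<xi>0"
  shows "\<exists>c>0. \<forall>(T::real) (\<kappa>::real) (K::real) (\<Xi> :: real \<Rightarrow> real) (p0 :: real^'n \<Rightarrow> real)
            (M :: 'w measure) (W :: real \<Rightarrow> 'w \<Rightarrow> real^'n) (X :: real \<Rightarrow> 'w \<Rightarrow> real^'n)
            (p :: real \<Rightarrow> real^'n \<Rightarrow> real).
      0 < T \<longrightarrow>
      Cb_C1_halfline \<Xi> \<longrightarrow> L-lipschitz_on {0..} \<Xi> \<longrightarrow> \<Xi> 0 = \<xi>0 \<longrightarrow>
      0 < \<kappa> \<longrightarrow> \<kappa> < K \<longrightarrow> K / \<kappa> \<le> 2 \<longrightarrow> (\<forall>r\<ge>0. \<kappa> \<le> \<Xi> r \<and> \<Xi> r \<le> K) \<longrightarrow>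
      b0 > \<kappa> / 2 \<longrightarrow>
      probability_density p0 \<longrightarrow> essentially_bounded p0 \<longrightarrow>
      (\<forall>x. p0 x \<le> c0 * exp (- b0 * (norm x)\<^sup>2)) \<longrightarrow>
      prob_space M \<longrightarrow> standard_brownian_motion M W \<longrightarrow>
      strong_solution M W T (\<lambda>t x. - \<Xi> (p t x) *\<^sub>R grad_Phi x) X \<longrightarrow>
      distributed M lborel (X 0) (\<lambda>x. ennreal (p0 x)) \<longrightarrow>
      (\<forall>t\<in>{0<..<T}. distributed M lborel (X t) (\<lambda>x. ennreal (p t x)) \<and> (\<forall>x. 0 \<le> p t x)) \<longrightarrow>
      locally_parabolic_holder T p \<longrightarrow>
      weak_FP_solution \<Xi> T p0 p \<longrightarrow>
      (\<exists>c\<^sub>T \<gamma>\<^sub>T. 0 < c\<^sub>T \<and> 0 < \<gamma>\<^sub>T \<and> \<gamma>\<^sub>T < \<kappa> / 2 \<and>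
         (\<forall>t\<in>{0<..<T}. \<forall>x. p t x \<le> c\<^sub>T * exp (- \<gamma>\<^sub>T * (norm x)\<^sup>2))) \<longrightarrow>
      (\<forall>t\<in>{0<..<T}. \<forall>x. p t x \<le> c * exp (- \<Xi> 0 * (norm x)\<^sup>2))"
proof (cases "0 < \<xi>0 \<and> 0 \<le> L")
  \<comment> \<open>\<open>\<xi>0\<close> and \<open>L\<close> are arbitrary reals at first; unless
    the former is positive and the latter nonnegative, the hypotheses on \<Xi> contradict each other
    and any \<open>c\<close> will do.\<close>
  case False
  have "\<not> (L-lipschitz_on {0..} \<Xi> \<and> \<Xi> 0 = \<xi>0 \<and> 0 < \<kappa> \<and> (\<forall>r\<ge>0. \<kappa> \<le> \<Xi> r \<and> \<Xi> r \<le> K))"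
    for \<Xi> :: "real \<Rightarrow> real" and \<kappa> K
    using False lipschitz_on_nonneg[of L "{0..}" \<Xi>] by force
  then show ?thesis by (intro exI[of _ 1]) auto
next
  case True
  obtain c where c: "0 < c"
    and profile: "\<And>\<Xi> \<kappa> K. L-lipschitz_on {0..} \<Xi> \<Longrightarrow> \<Xi> 0 = \<xi>0 \<Longrightarrow> 0 < \<kappa> \<Longrightarrow> K \<le> 2 * \<kappa> \<Longrightarrow>
       (\<And>r. 0 \<le> r \<Longrightarrow> \<kappa> \<le> \<Xi> r \<and> \<Xi> r \<le> K) \<Longrightarrow>
       \<exists>Q. (\<forall>s. 0 < Q s \<and> (Q has_real_derivative - (\<Xi> (Q s) * Q s)) (at s)) \<and>
           (\<forall>s\<ge>0. c0 * exp (- b0 * s) \<le> Q s \<and> Q s \<le> c * exp (- \<xi>0 * s))"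
    using stationary_profile_exists[of c0 \<xi>0 b0 L] assms True by blast
  show ?thesis
  proof (intro exI[of _ c] conjI c allI impI ballI)
    fix T \<kappa> K :: real and \<Xi> :: "real \<Rightarrow> real" and p0 :: "real^'n \<Rightarrow> real" and M :: "'w measure"
      and X :: "real \<Rightarrow> 'w \<Rightarrow> real^'n" and p :: "real \<Rightarrow> real^'n \<Rightarrow> real" and t :: real and x :: "real^'n"
    assume T: "0 < T" and lip: "L-lipschitz_on {0..} \<Xi>" and \<Xi>0: "\<Xi> 0 = \<xi>0"
      and \<kappa>: "0 < \<kappa>" and ratio: "K / \<kappa> \<le> 2" and bd: "\<forall>r\<ge>0. \<kappa> \<le> \<Xi> r \<and> \<Xi> r \<le> K"
      and p0: "probability_density p0" and p0_le: "\<forall>x. p0 x \<le> c0 * exp (- b0 * (norm x)\<^sup>2)"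
      and "\<forall>t\<in>{0<..<T}. distributed M lborel (X t) (\<lambda>x. ennreal (p t x)) \<and> (\<forall>x. 0 \<le> p t x)"
      and holder: "locally_parabolic_holder T p" and weak: "weak_FP_solution \<Xi> T p0 p"
      and gauss: "\<exists>c\<^sub>T \<gamma>\<^sub>T. 0 < c\<^sub>T \<and> 0 < \<gamma>\<^sub>T \<and> \<gamma>\<^sub>T < \<kappa> / 2 \<and>
         (\<forall>t\<in>{0<..<T}. \<forall>x. p t x \<le> c\<^sub>T * exp (- \<gamma>\<^sub>T * (norm x)\<^sup>2))"
      and t: "t \<in> {0<..<T}"
    then have p_nonneg: "\<And>t x. t \<in> {0<..<T} \<Longrightarrow> 0 \<le> p t x" by blast
    have \<Xi>_bd: "0 \<le> r \<Longrightarrow> \<bar>\<Xi> r\<bar> \<le> K" for r using bd \<kappa> by force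
    have \<Xi>_cont: "continuous_on {0..} \<Xi>" using lip by (rule lipschitz_on_continuous_on)
    obtain Q where Q: "\<And>s. 0 < Q s" "\<And>s. (Q has_real_derivative - (\<Xi> (Q s) * Q s)) (at s)"
      "\<And>s. 0 \<le> s \<Longrightarrow> c0 * exp (- b0 * s) \<le> Q s \<and> Q s \<le> c * exp (- \<xi>0 * s)"
      using profile[OF lip \<Xi>0 \<kappa>, of K] ratio bd \<kappa> by (auto simp: divide_le_eq)
    \<comment> \<open>With s = |x|^2 the chain rule gives the gradient 2 x Q'(|x|^2) = -2 x \<Xi>(q)
      q, which is the vanishing flux, and the lower bound on \<open>Q\<close> becomes the Gaussian
      above \<open>p0\<close>.\<close>
    define q where "q x = Q ((norm x)\<^sup>2)" for x :: "real^'n"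
    define Hq where "Hq x = \<Xi> (q x) * q x" for x
    define H where "H t x = \<Xi> (p t x) * p t x" for t x
    have q_pos: "0 < q x" for x by (simp add: q_def Q)
    have q_le: "q x \<le> c * exp (- \<xi>0 * (norm x)\<^sup>2)" for x
      using Q(3)[of "(norm x)\<^sup>2"] by (simp add: q_def)
    have q_cont: "continuous_on UNIV q"
      unfolding q_def
      by (rule continuous_on_compose2[of UNIV Q])
        (auto intro!: continuous_intros continuous_at_imp_continuous_on DERIV_isCont[OF Q(2)])
    have Hq_cont: "continuous_on UNIV Hq"
      unfolding Hq_def
      by (intro continuous_on_mult q_cont continuous_on_compose2[OF \<Xi>_cont q_cont])
        (use q_pos in \<open>auto intro: less_imp_le\<close>)
    have p_cont: "continuous_on ({0<..<T} \<times> UNIV) (\<lambda>(t, x). p t x)"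
      by (rule locally_parabolic_holder_continuous_on[OF holder])
    have H_cont: "continuous_on ({0<..<T} \<times> UNIV) (\<lambda>(t, x). H t x)"
      using p_cont unfolding H_def case_prod_unfold
      by (intro continuous_on_mult continuous_on_compose2[OF \<Xi>_cont]) (auto simp: p_nonneg)
    have p_gd: "gauss_dominated {0<..<T} p"
    proof -
      obtain C \<gamma> where "0 < \<gamma>" "\<forall>t\<in>{0<..<T}. \<forall>x. p t x \<le> C * exp (- \<gamma> * (norm x)\<^sup>2)"
        using gauss by blast
      then show ?thesis using p_nonneg by (intro gauss_dominatedI[of \<gamma> _ _ C]) auto
    qed
    have q_gd: "gauss_dominated (UNIV :: unit set) (\<lambda>_. q)"
    proof (rule gauss_dominatedI[of \<xi>0 _ _ c])
      show "0 < \<xi>0" using True by blast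
      show "\<bar>q x\<bar> \<le> c * exp (- \<xi>0 * (norm x)\<^sup>2)" for x using q_le[of x] q_pos[of x] by simp
    qed
    obtain B where B: "\<And>x. q x \<le> B"
      using gauss_dominated_bounded[OF q_gd] by (metis UNIV_I abs_le_D1)
    \<comment> \<open>From \<Xi>(p) p - \<Xi>(q) q = \<Xi>(p) (p - q) + q (\<Xi>(p) - \<Xi>(q)): the
      Lipschitz difference is paired with \<open>q\<close>, so \<open>B\<close> is a bound on the
      profile.\<close>
    interpret fp_comparison T p H p0 q Hq "K + B * L"
    proof
      show "gauss_dominated {0<..<T} H"
        by (rule gauss_dominated_bound[OF p_gd, of _ K])
          (use \<Xi>_bd p_nonneg in \<open>auto simp: H_def abs_mult intro!: mult_right_mono\<close>)
      show "gauss_dominated (UNIV :: unit set) (\<lambda>_. Hq)"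
        by (rule gauss_dominated_bound[OF q_gd, of _ K])
          (use \<Xi>_bd q_pos in \<open>auto simp: Hq_def abs_mult less_imp_le intro!: mult_right_mono\<close>)
      show "(LINT (t, x):{0<..<T} \<times> UNIV|lborel.
            p t x * (partial_t \<phi> (t, x) + laplace_x \<phi> (t, x)) - H t x * (grad_Phi x \<bullet> grad_x \<phi> (t, x)))
          + (LINT x|lborel. p0 x * \<phi> (0, x)) = 0" if "test_function T \<phi>" for \<phi>
        using weak that unfolding weak_FP_solution_def H_def by (simp add: algebra_simps)
      show "has_partial q (axis i 1) (\<lambda>x. - (2 * x $ i * Hq x))" for i
        using has_partial_compose_real[OF has_partial_norm_square Q(2), of "axis i (1::real)"]
        by (simp add: q_def[abs_def] Hq_def inner_axis mult.commute mult.left_commute)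
      show "p0 \<in> borel_measurable borel" using p0 by (simp add: probability_density_def)
      show "0 \<le> p0 x \<and> p0 x \<le> q x" for x
        using p0 p0_le Q(3)[of "(norm x)\<^sup>2"] by (auto simp: probability_density_def q_def intro: order_trans)
      show "\<bar>H t x - Hq x\<bar> \<le> (K + B * L) * \<bar>p t x - q x\<bar>" if t: "t \<in> {0<..<T}" for t x
      proof -
        have "H t x - Hq x = \<Xi> (p t x) * (p t x - q x) + q x * (\<Xi> (p t x) - \<Xi> (q x))"
          by (simp add: H_def Hq_def algebra_simps)
        moreover have "\<bar>\<Xi> (p t x) * (p t x - q x)\<bar> \<le> K * \<bar>p t x - q x\<bar>"
          unfolding abs_mult by (intro mult_right_mono \<Xi>_bd p_nonneg t) simp
        moreover have "\<bar>q x * (\<Xi> (p t x) - \<Xi> (q x))\<bar> \<le> B * (L * \<bar>p t x - q x\<bar>)"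
        proof -
          have "\<bar>\<Xi> (p t x) - \<Xi> (q x)\<bar> \<le> L * \<bar>p t x - q x\<bar>"
            using lipschitz_onD[OF lip, of "p t x" "q x"] p_nonneg[OF t, of x] q_pos[of x]
            by (simp add: dist_real_def)
          then show ?thesis
            using B[of x] q_pos[of x] unfolding abs_mult by (intro mult_mono) auto
        qed
        ultimately show ?thesis by (simp add: distrib_right mult.assoc)
      qed
    qed (use T p_cont H_cont p_gd q_cont Hq_cont q_gd in auto)
    have "p t x \<le> q x" using t by (rule comparison)
    with q_le[of x] show "p t x \<le> c * exp (- \<Xi> 0 * (norm x)\<^sup>2)"
      unfolding \<Xi>0 by linarith
  qed
qed

end
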